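(* Let $d\ge2$, $\Omega\subset\mathbb R^d$ a bounded polytope, $\mu>0$, $\lambda>0$, $\iota\in(0,1]$, and let $\mathcal T_h$ be a shape-regular simplicial mesh of $\Omega$. There is a constant $C$, depending at most on $\Omega$, $d$, $\mu$ and the mesh shape regularity (hence independent of $h,\iota,\lambda$), such that for all $\Phi_h\in\Sigma_h$ and $u_h\in V_h$, $$\iota^{-1}\|\Phi_h\|_{\widetilde{\mathcal A}}+|\!|\!|u_h|\!|\!|_{\iota,h}\le C\sup_{(0,0)\ne(\Psi_h,v_h)\in\Sigma_h\times V_h}\frac{a(\Phi_h,\Psi_h)+b_h(\Psi_h,u_h)+b_h(\Phi_h,v_h)-c_h(u_h,v_h)}{\iota^{-1}\|\Psi_h\|_{\widetilde{\mathcal A}}+|\!|\!|v_h|\!|\!|_{\iota,h}}.$$ Consequently, for every $f\in L^2(\Omega;\mathbb R^d)$, the mixed finite element method: find $(\Phi_h,u_h)\in\Sigma_h\times V_h$ such that $$a(\Phi_h,\Psi_h)+b_h(\Psi_h,u_h)=0\quad\forall\,\Psi_h\in\Sigma_h,\qquad b_h(\Phi_h,v_h)-c_h(u_h,v_h)=-(f,v_h)\quad\forall\,v_h\in V_h,$$ is well-posed.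
   Context: Notation. $\mathbb S$: symmetric real $d\times d$ matrices; $I$: identity matrix. $\mathbb S\otimes\mathbb R^d$: third-order tensors with $\Psi_{ijk}=\Psi_{jik}$; $(\tau\otimes v)_{ijk}=\tau_{ij}v_k$; $(\Psi n)_{ij}=\sum_k\Psi_{ijk}n_k$; $\operatorname{tr}(\Psi)_k=\sum_i\Psi_{iik}$; $(\operatorname{div}\Psi)_{ij}=\sum_k\partial_k\Psi_{ijk}$. $(\cdot,\cdot)_D$ is the $L^2(D)$ inner product (Frobenius for tensors), $D=\Omega$ if omitted. $\varepsilon(v)$ is the symmetric gradient, $\sigma(v)=2\mu\varepsilon(v)+\lambda(\operatorname{div}v)I$; $\varepsilon_h,\sigma_h,\operatorname{div}_h$ are the elementwise versions. $\widetilde{\mathcal A}\Psi=\frac1{2\mu}\big(\Psi-\frac{\lambda}{2\mu+d\lambda}I\otimes\operatorname{tr}(\Psi)\big)$, $\|\Psi\|^2_{\widetilde{\mathcal A}}=(\widetilde{\mathcal A}\Psi,\Psi)$. Mesh. $h_T,h_F$ are diameters of elements/faces, $h=\max_Th_T$; $\mathcal F_h$ is the set of all $(d-1)$-dimensional faces and $\mathcal F(T)$ that of the faces of $T$; $n_F$ is a fixed unit normal of $F$ (outward if $F\subset\partial\Omega$). Jump on an interior face $F=T^+\cap T^-$: $[\![v]\!]|_F=v|_{T^+}\,(n_F\cdot n_{\partial T^+})+v|_{T^-}\,(n_F\cdot n_{\partial T^-})$; on a boundary face $[\![v]\!]|_F=v|_F$. $\mathbb P_k(D;\mathbb X)$: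 $\mathbb X$-valued polynomials of degree $\le k$ on $D$. Finite element spaces. $\Sigma(T;\mathbb S\otimes\mathbb R^d)=\mathbb P_0(T;\mathbb S\otimes\mathbb R^d)+\mathbb P_0(T;\mathbb S)\otimes x$. $\Sigma_h=\{\Psi\in L^2(\Omega;\mathbb S\otimes\mathbb R^d):\Psi|_T\in\Sigma(T;\mathbb S\otimes\mathbb R^d)\ \forall T\in\mathcal T_h$, and for each interior face $F$ and $q\in\mathbb P_0(F;\mathbb S)$ the value $(\Psi n_F,q)_F$ is the same from both sides$\}$, a subspace of $H(\operatorname{div},\Omega;\mathbb S\otimes\mathbb R^d)$. $V_h$ (vector Crouzeix–Raviart space) $=\{v\in L^2(\Omega;\mathbb R^d):v|_T\in\mathbb P_1(T;\mathbb R^d)\ \forall T$, $\int_F[\![v]\!]=0\ \forall F\in\mathcal F_h\}$. Forms: $a(\Phi,\Psi)=\iota^{-2}(\widetilde{\mathcal A}\Phi,\Psi)$, $b_h(\Psi,v)=(\operatorname{div}\Psi,\varepsilon_h(v))$, $c_h(u,v)=(\sigma_h(u),\varepsilon_h(v))+\sum_{F\in\mathcal F_h}h_F^{-1}([\![u]\!],[\![v]\!])_F$. Norms: $|\!|\!|v|\!|\!|^2_{1,h}=2\mu\|\varepsilon_h(v)\|_0^2+\lambda\|\operatorname{div}_hv\|_0^2+\sum_{F\in\mathcal F_h}h_F^{-1}\|[\![v]\!]\|^2_{0,F}$; $|\!|\!|v|\!|\!|^2_{2,h}=\sum_{F\in\mathcal F_h}h_F^{-1}\big(2\mu\|[\![\varepsilon_h(v)]\!]\|^2_{0,F}+\lambda\|[\![\operatorname{div}_hv]\!]\|_{0,F}^2\big)$;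 $|\!|\!|v|\!|\!|^2_{\iota,h}=\iota^2|\!|\!|v|\!|\!|^2_{2,h}+|\!|\!|v|\!|\!|^2_{1,h}$. *)

theory Defs
  imports "HOL-Analysis.Analysis"
begin

section \<open>Symmetric matrices and third-order tensors\<close>

text \<open>
  A third-order tensor is an element \<open>\<Psi>\<close> of \<open>real^'n^'n^'n\<close> with entries \<open>\<Psi> $ i $ j $ k\<close>;
  the inner product of this Euclidean space is the Frobenius product.
\<close>

definition sym_mat :: "(real^'n^'n) set" where
  "sym_mat = {\<tau>. \<forall>i j. \<tau> $ i $ j = \<tau> $ j $ i}"

definition sym_tens :: "(real^'n^'n^'n) set" where
  "sym_tens = {\<Psi>. \<forall>i j k. \<Psi> $ i $ j $ k = \<Psi> $ j $ i $ k}"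

definition tens_outer :: "real^'n^'n \<Rightarrow> real^'n \<Rightarrow> real^'n^'n^'n" where
  "tens_outer \<tau> v = (\<chi> i j k. \<tau> $ i $ j * v $ k)"

definition tens_vec :: "real^'n^'n^'n \<Rightarrow> real^'n \<Rightarrow> real^'n^'n" where
  "tens_vec \<Psi> w = (\<chi> i j. \<Sum>k\<in>UNIV. \<Psi> $ i $ j $ k * w $ k)"

definition tens_tr :: "real^'n^'n^'n \<Rightarrow> real^'n" where
  "tens_tr \<Psi> = (\<chi> k. \<Sum>i\<in>UNIV. \<Psi> $ i $ i $ k)"

definition compliance :: "real \<Rightarrow> real \<Rightarrow> real^'n^'n^'n \<Rightarrow> real^'n^'n^'n" where
  "compliance \<mu> lam \<Psi> =
     (1 / (2 * \<mu>)) *\<^sub>R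
       (\<Psi> - (lam / (2 * \<mu> + real CARD('n) * lam)) *\<^sub>R tens_outer (mat 1) (tens_tr \<Psi>))"


section \<open>Differential operators\<close>

definition partial_deriv :: "'n \<Rightarrow> (real^'n \<Rightarrow> 'b::real_normed_vector) \<Rightarrow> real^'n \<Rightarrow> 'b" where
  "partial_deriv k g x = frechet_derivative g (at x) (axis k 1)"

definition vec_div :: "(real^'n \<Rightarrow> real^'n) \<Rightarrow> real^'n \<Rightarrow> real" where
  "vec_div v x = (\<Sum>i\<in>UNIV. partial_deriv i v x $ i)"

definition sym_grad :: "(real^'n \<Rightarrow> real^'n) \<Rightarrow> real^'n \<Rightarrow> real^'n^'n" where
  "sym_grad v x = (\<chi> i j. (partial_deriv j v x $ i + partial_deriv i v x $ j) / 2)"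

definition stress :: "real \<Rightarrow> real \<Rightarrow> (real^'n \<Rightarrow> real^'n) \<Rightarrow> real^'n \<Rightarrow> real^'n^'n" where
  "stress \<mu> lam v x = (2 * \<mu>) *\<^sub>R sym_grad v x + (lam * vec_div v x) *\<^sub>R mat 1"

definition tens_div :: "(real^'n \<Rightarrow> real^'n^'n^'n) \<Rightarrow> real^'n \<Rightarrow> real^'n^'n" where
  "tens_div \<Psi> x = (\<chi> i j. \<Sum>k\<in>UNIV. partial_deriv k \<Psi> x $ i $ j $ k)"


section \<open>Domains and meshes\<close>

text \<open>
  Polytopes are not required to be convex: the domain is the interior of a finite union of convex
  polytopes. The condition \<open>\<Omega> = interior (closure \<Omega>)\<close> excludes slits.
\<close>

definition polytopal_domain :: "(real^'n) set \<Rightarrow> bool" where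
  "polytopal_domain \<Omega> \<longleftrightarrow>
     \<Omega> \<noteq> {} \<and> bounded \<Omega> \<and> open \<Omega> \<and> \<Omega> = interior (closure \<Omega>) \<and>
     (\<exists>\<P>. finite \<P> \<and> (\<forall>P\<in>\<P>. polytope P) \<and> closure \<Omega> = \<Union>\<P>)"

definition simplicial_mesh :: "(real^'n) set \<Rightarrow> (real^'n) set set \<Rightarrow> bool" where
  "simplicial_mesh \<Omega> \<T> \<longleftrightarrow>
     triangulation \<T> \<and> (\<forall>T\<in>\<T>. int CARD('n) simplex T) \<and> \<Union>\<T> = closure \<Omega>"

definition inball_diameter :: "(real^'n) set \<Rightarrow> real" where
  "inball_diameter T = Sup {2 * r | r x. 0 \<le> r \<and> cball x r \<subseteq> T}"

definition shape_regular :: "real \<Rightarrow> (real^'n) set set \<Rightarrow> bool" where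
  "shape_regular \<kappa> \<T> \<longleftrightarrow> (\<forall>T\<in>\<T>. diameter T \<le> \<kappa> * inball_diameter T)"

definition mesh_faces :: "(real^'n) set set \<Rightarrow> (real^'n) set set" where
  "mesh_faces \<T> = {F. \<exists>T\<in>\<T>. F facet_of T}"

text \<open>
  The condition on \<open>\<nu>\<close> forces \<open>\<nu>\<close> to be orthogonal to \<open>F\<close> when \<open>F \<subseteq> T\<close>, and determines it
  uniquely when \<open>F\<close> is a facet of a simplex \<open>T\<close> with nonempty interior.
\<close>

definition outer_normal :: "(real^'n) set \<Rightarrow> (real^'n) set \<Rightarrow> real^'n" where
  "outer_normal T F = (THE \<nu>. norm \<nu> = 1 \<and> (\<forall>x\<in>F. \<forall>y\<in>T. \<nu> \<bullet> (y - x) \<le> 0))"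

definition face_normals ::
    "(real^'n) set \<Rightarrow> (real^'n) set set \<Rightarrow> ((real^'n) set \<Rightarrow> real^'n) \<Rightarrow> bool" where
  "face_normals \<Omega> \<T> n \<longleftrightarrow>
     (\<forall>F\<in>mesh_faces \<T>. norm (n F) = 1 \<and> (\<forall>x\<in>F. \<forall>y\<in>F. n F \<bullet> (y - x) = 0)) \<and>
     (\<forall>T\<in>\<T>. \<forall>F. F facet_of T \<and> F \<subseteq> frontier \<Omega> \<longrightarrow> n F = outer_normal T F)"


section \<open>Integrals, traces and jumps\<close>

definition L2_ip :: "(real^'n) set \<Rightarrow> (real^'n \<Rightarrow> 'b::real_inner) \<Rightarrow> (real^'n \<Rightarrow> 'b) \<Rightarrow> real" where
  "L2_ip \<Omega> f g = (LINT x|lebesgue_on \<Omega>. f x \<bullet> g x)"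

definition L2_fun :: "(real^'n) set \<Rightarrow> (real^'n \<Rightarrow> real^'n) set" where
  "L2_fun \<Omega> = {f. f \<in> borel_measurable (lebesgue_on \<Omega>) \<and>
                   integrable (lebesgue_on \<Omega>) (\<lambda>x. (norm (f x))\<^sup>2)}"

text \<open>
  The \<open>(d-1)\<close>-dimensional surface measure on a face \<open>F\<close> with unit normal \<open>\<nu>\<close>: the Lebesgue measure
  on the prism of height one over \<open>F\<close>, pushed forward along the orthogonal projection onto \<open>F\<close>
  (which on that prism is the closest point map). By Fubini's theorem this is the
  \<open>(d-1)\<close>-dimensional Lebesgue measure in the hyperplane of \<open>F\<close>, and \<open>-\<nu>\<close> gives the same measure.
\<close>

definition face_measure :: "real^'n \<Rightarrow> (real^'n) set \<Rightarrow> (real^'n) measure" where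
  "face_measure \<nu> F =
     distr (lebesgue_on {x + t *\<^sub>R \<nu> | x t. x \<in> F \<and> 0 \<le> t \<and> t \<le> 1})
           (restrict_space borel F) (closest_point F)"

definition face_ip ::
    "real^'n \<Rightarrow> (real^'n) set \<Rightarrow> (real^'n \<Rightarrow> 'b::real_inner) \<Rightarrow> (real^'n \<Rightarrow> 'b) \<Rightarrow> real" where
  "face_ip \<nu> F f g = (LINT x|face_measure \<nu> F. f x \<bullet> g x)"

text \<open>The value at \<open>x \<in> T\<close> of \<open>g|\<^sub>T\<close>, taken from the inside of the element \<open>T\<close>.\<close>

definition elem_trace :: "(real^'n) set \<Rightarrow> (real^'n \<Rightarrow> 'b::t2_space) \<Rightarrow> real^'n \<Rightarrow> 'b" where
  "elem_trace T g x = Lim (at x within interior T) g"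

text \<open>
  The sum has two terms on an interior face and one on a boundary face. In the latter case
  \<open>n F = outer_normal T F\<close>, so that the jump is the trace itself.
\<close>

definition jump ::
    "(real^'n) set set \<Rightarrow> ((real^'n) set \<Rightarrow> real^'n) \<Rightarrow> (real^'n) set
      \<Rightarrow> (real^'n \<Rightarrow> 'b::real_normed_vector) \<Rightarrow> real^'n \<Rightarrow> 'b" where
  "jump \<T> n F g x =
     (\<Sum>T | T \<in> \<T> \<and> F facet_of T. (n F \<bullet> outer_normal T F) *\<^sub>R elem_trace T g x)"

definition elementwise ::
    "(real^'n) set set \<Rightarrow> (real^'n \<Rightarrow> 'b::zero) \<Rightarrow> real^'n \<Rightarrow> 'b" where
  "elementwise \<T> g x = (if x \<in> (\<Union>T\<in>\<T>. interior T) then g x else 0)"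


section \<open>Finite element spaces\<close>

text \<open>
  An \<open>L\<^sup>2\<close> class that is polynomial on every element is represented by the unique function that is
  polynomial on every open element and zero off the open elements. So equality almost everywhere
  is equality of representatives, and the zero class is \<open>\<lambda>_. 0\<close>. Elements of \<open>Sigma_h\<close> lie in
  \<open>H(div)\<close>, so that their weak divergence is the elementwise classical one.
\<close>

definition Sigma_loc :: "(real^'n \<Rightarrow> real^'n^'n^'n) set" where
  "Sigma_loc = {\<lambda>x. \<Psi>0 + tens_outer \<tau> x | \<Psi>0 \<tau>. \<Psi>0 \<in> sym_tens \<and> \<tau> \<in> sym_mat}"

definition P1_vec :: "(real^'n \<Rightarrow> real^'n) set" where
  "P1_vec = {\<lambda>x. A *v x + b | A b. True}"

definition piecewise ::
    "(real^'n) set set \<Rightarrow> (real^'n \<Rightarrow> 'b::zero) set \<Rightarrow> (real^'n \<Rightarrow> 'b) set" where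
  "piecewise \<T> P =
     {g. (\<forall>x. x \<notin> (\<Union>T\<in>\<T>. interior T) \<longrightarrow> g x = 0) \<and>
         (\<forall>T\<in>\<T>. \<exists>p\<in>P. \<forall>x\<in>interior T. g x = p x)}"

definition Sigma_h ::
    "(real^'n) set set \<Rightarrow> ((real^'n) set \<Rightarrow> real^'n) \<Rightarrow> (real^'n \<Rightarrow> real^'n^'n^'n) set" where
  "Sigma_h \<T> n =
     {\<Psi> \<in> piecewise \<T> Sigma_loc.
        \<forall>T\<in>\<T>. \<forall>T'\<in>\<T>. \<forall>F. F facet_of T \<and> F facet_of T' \<longrightarrow>
          (\<forall>q\<in>sym_mat.
             face_ip (n F) F (\<lambda>x. tens_vec (elem_trace T \<Psi> x) (n F)) (\<lambda>_. q) =
             face_ip (n F) F (\<lambda>x. tens_vec (elem_trace T' \<Psi> x) (n F)) (\<lambda>_. q))}"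

definition V_h ::
    "(real^'n) set set \<Rightarrow> ((real^'n) set \<Rightarrow> real^'n) \<Rightarrow> (real^'n \<Rightarrow> real^'n) set" where
  "V_h \<T> n =
     {v \<in> piecewise \<T> P1_vec.
        \<forall>F\<in>mesh_faces \<T>. (LINT x|face_measure (n F) F. jump \<T> n F v x) = 0}"


section \<open>Bilinear forms and norms\<close>

definition form_a ::
    "(real^'n) set \<Rightarrow> real \<Rightarrow> real \<Rightarrow> real
      \<Rightarrow> (real^'n \<Rightarrow> real^'n^'n^'n) \<Rightarrow> (real^'n \<Rightarrow> real^'n^'n^'n) \<Rightarrow> real" where
  "form_a \<Omega> \<mu> lam \<iota> \<Phi> \<Psi> = L2_ip \<Omega> (\<lambda>x. compliance \<mu> lam (\<Phi> x)) \<Psi> / \<iota>\<^sup>2"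

definition form_b ::
    "(real^'n) set \<Rightarrow> (real^'n) set set
      \<Rightarrow> (real^'n \<Rightarrow> real^'n^'n^'n) \<Rightarrow> (real^'n \<Rightarrow> real^'n) \<Rightarrow> real" where
  "form_b \<Omega> \<T> \<Psi> v =
     L2_ip \<Omega> (elementwise \<T> (tens_div \<Psi>)) (elementwise \<T> (sym_grad v))"

definition form_c ::
    "(real^'n) set \<Rightarrow> (real^'n) set set \<Rightarrow> ((real^'n) set \<Rightarrow> real^'n) \<Rightarrow> real \<Rightarrow> real
      \<Rightarrow> (real^'n \<Rightarrow> real^'n) \<Rightarrow> (real^'n \<Rightarrow> real^'n) \<Rightarrow> real" where
  "form_c \<Omega> \<T> n \<mu> lam u v =
     L2_ip \<Omega> (elementwise \<T> (stress \<mu> lam u)) (elementwise \<T> (sym_grad v)) +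
     (\<Sum>F\<in>mesh_faces \<T>. face_ip (n F) F (jump \<T> n F u) (jump \<T> n F v) / diameter F)"

definition norm_A ::
    "(real^'n) set \<Rightarrow> real \<Rightarrow> real \<Rightarrow> (real^'n \<Rightarrow> real^'n^'n^'n) \<Rightarrow> real" where
  "norm_A \<Omega> \<mu> lam \<Psi> = sqrt (L2_ip \<Omega> (\<lambda>x. compliance \<mu> lam (\<Psi> x)) \<Psi>)"

definition norm_1h ::
    "(real^'n) set \<Rightarrow> (real^'n) set set \<Rightarrow> ((real^'n) set \<Rightarrow> real^'n) \<Rightarrow> real \<Rightarrow> real
      \<Rightarrow> (real^'n \<Rightarrow> real^'n) \<Rightarrow> real" where
  "norm_1h \<Omega> \<T> n \<mu> lam v = sqrt (
     2 * \<mu> * L2_ip \<Omega> (elementwise \<T> (sym_grad v)) (elementwise \<T> (sym_grad v)) +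
     lam * L2_ip \<Omega> (elementwise \<T> (vec_div v)) (elementwise \<T> (vec_div v)) +
     (\<Sum>F\<in>mesh_faces \<T>. face_ip (n F) F (jump \<T> n F v) (jump \<T> n F v) / diameter F))"

definition norm_2h ::
    "(real^'n) set set \<Rightarrow> ((real^'n) set \<Rightarrow> real^'n) \<Rightarrow> real \<Rightarrow> real
      \<Rightarrow> (real^'n \<Rightarrow> real^'n) \<Rightarrow> real" where
  "norm_2h \<T> n \<mu> lam v = sqrt (\<Sum>F\<in>mesh_faces \<T>.
     (2 * \<mu> * face_ip (n F) F (jump \<T> n F (elementwise \<T> (sym_grad v)))
                              (jump \<T> n F (elementwise \<T> (sym_grad v))) +
      lam * face_ip (n F) F (jump \<T> n F (elementwise \<T> (vec_div v)))
                            (jump \<T> n F (elementwise \<T> (vec_div v)))) / diameter F)"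

definition norm_ih ::
    "(real^'n) set \<Rightarrow> (real^'n) set set \<Rightarrow> ((real^'n) set \<Rightarrow> real^'n) \<Rightarrow> real \<Rightarrow> real \<Rightarrow> real
      \<Rightarrow> (real^'n \<Rightarrow> real^'n) \<Rightarrow> real" where
  "norm_ih \<Omega> \<T> n \<mu> lam \<iota> v =
     sqrt (\<iota>\<^sup>2 * (norm_2h \<T> n \<mu> lam v)\<^sup>2 + (norm_1h \<Omega> \<T> n \<mu> lam v)\<^sup>2)"

definition mixed_norm ::
    "(real^'n) set \<Rightarrow> (real^'n) set set \<Rightarrow> ((real^'n) set \<Rightarrow> real^'n) \<Rightarrow> real \<Rightarrow> real \<Rightarrow> real
      \<Rightarrow> (real^'n \<Rightarrow> real^'n^'n^'n) \<Rightarrow> (real^'n \<Rightarrow> real^'n) \<Rightarrow> real" where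
  "mixed_norm \<Omega> \<T> n \<mu> lam \<iota> \<Psi> v =
     norm_A \<Omega> \<mu> lam \<Psi> / \<iota> + norm_ih \<Omega> \<T> n \<mu> lam \<iota> v"


section \<open>The mixed method\<close>

definition mixed_solution ::
    "(real^'n) set \<Rightarrow> (real^'n) set set \<Rightarrow> ((real^'n) set \<Rightarrow> real^'n) \<Rightarrow> real \<Rightarrow> real \<Rightarrow> real
      \<Rightarrow> (real^'n \<Rightarrow> real^'n) \<Rightarrow> (real^'n \<Rightarrow> real^'n^'n^'n) \<Rightarrow> (real^'n \<Rightarrow> real^'n) \<Rightarrow> bool" where
  "mixed_solution \<Omega> \<T> n \<mu> lam \<iota> f \<Phi> u \<longleftrightarrow>
     \<Phi> \<in> Sigma_h \<T> n \<and> u \<in> V_h \<T> n \<and>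
     (\<forall>\<Psi>\<in>Sigma_h \<T> n. form_a \<Omega> \<mu> lam \<iota> \<Phi> \<Psi> + form_b \<Omega> \<T> \<Psi> u = 0) \<and>
     (\<forall>v\<in>V_h \<T> n. form_b \<Omega> \<T> \<Phi> v - form_c \<Omega> \<T> n \<mu> lam u v = - L2_ip \<Omega> f v)"

text \<open>
  Well-posedness in the sense of Hadamard: existence, uniqueness, and continuous dependence of the
  solution on the load \<open>f \<in> L\<^sup>2\<close> (the problem being linear, boundedness of the solution operator).
\<close>

definition mixed_well_posed ::
    "(real^'n) set \<Rightarrow> (real^'n) set set \<Rightarrow> ((real^'n) set \<Rightarrow> real^'n) \<Rightarrow> real \<Rightarrow> real \<Rightarrow> real
      \<Rightarrow> bool" where
  "mixed_well_posed \<Omega> \<T> n \<mu> lam \<iota> \<longleftrightarrow>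
     (\<forall>f\<in>L2_fun \<Omega>. \<exists>!p. mixed_solution \<Omega> \<T> n \<mu> lam \<iota> f (fst p) (snd p)) \<and>
     (\<exists>K. \<forall>f\<in>L2_fun \<Omega>. \<forall>\<Phi> u. mixed_solution \<Omega> \<T> n \<mu> lam \<iota> f \<Phi> u \<longrightarrow>
        mixed_norm \<Omega> \<T> n \<mu> lam \<iota> \<Phi> u \<le> K * sqrt (L2_ip \<Omega> f f))"

end

theory Submission imports Defs begin

text \<open>
  The form \<open>c\<^sub>h\<close> contains the full norm \<open>|||u|||\<^sub>1\<^sub>,\<^sub>h\<close>: by definition \<open>c\<^sub>h(u, u)\<close> is its square. Testing the
  saddle point form with \<open>(\<Phi>, - u)\<close> therefore already yields
  \<open>\<iota>\<^sup>-\<^sup>2 \<parallel>\<Phi>\<parallel>\<^sup>2 + |||u|||\<^sup>2\<close> in the norms \<open>\<parallel>\<cdot>\<parallel>\<^sub>A\<close> and \<open>|||\<cdot>|||\<^sub>1\<^sub>,\<^sub>h\<close>, with no constant at all. What is missing is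
  the part \<open>\<iota>\<^sup>2 |||u|||\<^sup>2\<close> in the norm \<open>|||\<cdot>|||\<^sub>2\<^sub>,\<^sub>h\<close>, which is made of the jumps of the piecewise constant
  gradient. These jumps are seen by \<open>b\<^sub>h\<close>: integration by parts on each element turns \<open>(div \<Psi>, \<epsilon>\<^sub>h(u))\<close> into
  the sum over all faces of \<open>\<Psi> n\<^sub>F\<close> against the jump of \<open>\<epsilon>\<^sub>h(u)\<close>. Since \<open>\<Psi> n\<^sub>F\<close> is the degree of freedom of
  \<open>\<Sigma>\<^sub>h\<close>, there is a \<open>\<Psi>\<close> with \<open>\<Psi> n\<^sub>F\<close> equal to the jump of \<open>\<sigma>\<^sub>h(u)\<close> divided by \<open>h\<^sub>F\<close>, and then
  \<open>b\<^sub>h(\<Psi>, u) = |||u|||\<^sup>2\<close> in the second norm. Lemma \<open>flux_recovery\<close> builds \<open>\<Psi>\<close> from the Raviart-Thomas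
  functions \<open>(x - a\<^sub>F) / h\<close>, where \<open>a\<^sub>F\<close> is the vertex opposite to \<open>F\<close> and \<open>h\<close> its height, and bounds its
  compliance norm by \<open>|||u|||\<^sub>2\<^sub>,\<^sub>h\<close>. The Lame parameter \<open>\<lambda>\<close> drops out of that bound because the compliance
  tensor inverts exactly the stress law which defines \<open>\<Psi> n\<^sub>F\<close>; the mesh size drops out by scaling, through
  the two inequalities of \<open>shape_regular_bounds\<close>. Lemma \<open>inf_sup_test_pair\<close> adds a small multiple of \<open>\<Psi>\<close>,
  of size \<open>\<iota>\<^sup>2\<close>, to the test pair \<open>(\<Phi>, - u)\<close>.

  In place of the divergence theorem the proof uses a single geometric fact, \<open>simplex_volume\<close>: the volume
  of a simplex is its height over a facet times the area of the facet times a number that depends on the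
  dimension only. It follows from the determinant formula for linear images.

  Well-posedness is a statement about a finite-dimensional linear system whose form, after a change of
  sign, is positive on the diagonal (\<open>lax_milgram\<close>). Positivity amounts to definiteness of
  \<open>|||\<cdot>|||\<^sub>1\<^sub>,\<^sub>h\<close> on \<open>V\<^sub>h\<close>, which is \<open>form_c_definite\<close>: an elementwise rigid motion without jumps, extended by
  zero, has its component in direction \<open>e\<close> constant along almost every line in direction \<open>e\<close>, and every
  such line leaves the domain. The stability constant of the load-to-solution map comes from the
  comparison of two forms on a finite-dimensional space (\<open>psd_form_bounded\<close>).
\<close>

section \<open>Linear problems on finite-dimensional spaces of functions\<close>

text \<open>
  Closure under \<open>f + c g\<close>, together with \<open>0\<close>, makes \<open>X\<close> a linear space under the pointwise operations, and
  linearity of a functional is tested on the same combinations: one condition covers zero, sums and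
  multiples.
\<close>

definition lin_sub :: "('a \<Rightarrow> 'b::real_vector) set \<Rightarrow> bool" where
  "lin_sub X \<longleftrightarrow> (\<lambda>_. 0) \<in> X \<and> (\<forall>f\<in>X. \<forall>g\<in>X. \<forall>c. (\<lambda>x. f x + c *\<^sub>R g x) \<in> X)"

definition lin_on :: "('a \<Rightarrow> 'b::real_vector) set \<Rightarrow> (('a \<Rightarrow> 'b) \<Rightarrow> real) \<Rightarrow> bool" where
  "lin_on X L \<longleftrightarrow> (\<forall>f\<in>X. \<forall>g\<in>X. \<forall>c. L (\<lambda>x. f x + c *\<^sub>R g x) = L f + c * L g)"

definition psd_form ::
    "('a \<Rightarrow> 'b::real_vector) set \<Rightarrow> (('a \<Rightarrow> 'b) \<Rightarrow> ('a \<Rightarrow> 'b) \<Rightarrow> real) \<Rightarrow> bool" where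
  "psd_form X B \<longleftrightarrow> (\<forall>f\<in>X. lin_on X (B f)) \<and> (\<forall>f\<in>X. \<forall>g\<in>X. B f g = B g f) \<and> (\<forall>f\<in>X. 0 \<le> B f f)"

lemma psd_formD:
  assumes "psd_form X B"
  shows "f \<in> X \<Longrightarrow> lin_on X (B f)" "f \<in> X \<Longrightarrow> g \<in> X \<Longrightarrow> B f g = B g f" "f \<in> X \<Longrightarrow> 0 \<le> B f f"
  using assms by (simp_all add: psd_form_def)

lemma lin_subD:
  assumes "lin_sub X" "f \<in> X" "g \<in> X"
  shows "(\<lambda>x. f x + c *\<^sub>R g x) \<in> X"
  using assms by (auto simp: lin_sub_def)

lemma lin_sub_scale:
  assumes "lin_sub X" "g \<in> X"
  shows "(\<lambda>x. c *\<^sub>R g x) \<in> X"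
  using lin_subD[OF assms(1) _ assms(2), of "\<lambda>_. 0" c] assms(1) by (auto simp: lin_sub_def)

lemma lin_onD: "lin_on X L \<Longrightarrow> f \<in> X \<Longrightarrow> g \<in> X \<Longrightarrow> L (\<lambda>x. f x + c *\<^sub>R g x) = L f + c * L g"
  by (simp add: lin_on_def)

lemma lin_on_zero: assumes "lin_sub X" "lin_on X L" shows "L (\<lambda>_. 0) = 0"
proof -
  have z: "(\<lambda>_. 0) \<in> X" using assms(1) by (simp add: lin_sub_def)
  show ?thesis using lin_onD[OF assms(2) z z, of 1] by simp
qed

lemma lin_on_scale:
  assumes "lin_sub X" "lin_on X L" "g \<in> X" shows "L (\<lambda>x. c *\<^sub>R g x) = c * L g"
proof -
  have z: "(\<lambda>_. 0) \<in> X" using assms(1) by (simp add: lin_sub_def)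
  show ?thesis using lin_onD[OF assms(2) z assms(3), of c] lin_on_zero[OF assms(1,2)] by simp
qed

lemma lin_on_mono: "lin_on X L \<Longrightarrow> Y \<subseteq> X \<Longrightarrow> lin_on Y L"
  by (auto simp: lin_on_def subset_iff)

text \<open>
  That \<open>X\<close> has finite dimension is expressed by a finite set \<open>E\<close> of linear functionals that separates its
  elements. The proof is by induction on \<open>E\<close>. The kernel \<open>X0\<close> of one functional \<open>l\<close> falls under the induction
  hypothesis. If it is not all of \<open>X\<close>, then \<open>X\<close> is spanned by \<open>X0\<close> and one further element \<open>e'\<close>, and the
  induction hypothesis allows to choose \<open>e'\<close> with \<open>B e' g = 0\<close> for all \<open>g\<close> in \<open>X0\<close>. So adding a multiple of \<open>e'\<close>
  to the solution on \<open>X0\<close> respects the equations already solved, and the one that remains, tested with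
  \<open>e'\<close>, is solvable because \<open>B e' e'\<close> is positive.
\<close>

lemma lax_milgram:
  assumes "finite E" "lin_sub X" "\<forall>l\<in>E. lin_on X l"
    and "\<forall>f\<in>X. (\<forall>l\<in>E. l f = 0) \<longrightarrow> f = (\<lambda>_. 0)"
    and "\<forall>f\<in>X. lin_on X (B f)" "\<forall>g\<in>X. lin_on X (\<lambda>f. B f g)"
    and "\<forall>f\<in>X. f \<noteq> (\<lambda>_. 0) \<longrightarrow> 0 < B f f" and "lin_on X L"
  shows "\<exists>f\<in>X. \<forall>g\<in>X. B f g = L g"
  using assms
proof (induction E arbitrary: X L rule: finite_induct)
  case empty
  then have X0: "f = (\<lambda>_. 0)" if "f \<in> X" for f using that by auto
  have z: "(\<lambda>_. 0) \<in> X" using empty by (simp add: lin_sub_def)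
  have "B (\<lambda>_. 0) g = L g" if "g \<in> X" for g
  proof -
    have g: "g = (\<lambda>_. 0)" using X0[OF that] .
    have "B (\<lambda>_. 0) (\<lambda>_. 0) = 0" using lin_on_zero[OF empty.prems(1)] empty.prems(4) z by simp
    then show ?thesis using g lin_on_zero[OF empty.prems(1,7)] by simp
  qed
  then show ?case using z by auto
next
  case (insert l E X L)
  note X = \<open>lin_sub X\<close>
  define X0 where "X0 = {f\<in>X. l f = 0}"
  have sub: "X0 \<subseteq> X" by (auto simp: X0_def)
  have l: "lin_on X l" using insert.prems by auto
  have X0: "lin_sub X0"
    unfolding lin_sub_def X0_def using X lin_on_zero[OF X l] lin_onD[OF l]
    by (auto simp: lin_sub_def)
  have IH: "\<exists>f\<in>X0. \<forall>g\<in>X0. B f g = L' g" if "lin_on X0 L'" for L'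
  proof (rule insert.IH[OF X0 _ _ _ _ _ that])
    show "\<forall>l\<in>E. lin_on X0 l" using insert.prems(2) lin_on_mono[OF _ sub] by simp
    show "\<forall>f\<in>X0. (\<forall>l\<in>E. l f = 0) \<longrightarrow> f = (\<lambda>_. 0)" using insert.prems(3) by (simp add: X0_def)
    show "\<forall>f\<in>X0. lin_on X0 (B f)" using insert.prems(4) lin_on_mono[OF _ sub] by (simp add: X0_def)
    show "\<forall>g\<in>X0. lin_on X0 (\<lambda>f. B f g)" using insert.prems(5) lin_on_mono[OF _ sub] by (simp add: X0_def)
    show "\<forall>f\<in>X0. f \<noteq> (\<lambda>_. 0) \<longrightarrow> 0 < B f f" using insert.prems(6) by (simp add: X0_def)
  qed
  show ?case
  proof (cases "X0 = X")
    case True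
    then show ?thesis using IH[of L] insert.prems(7) by simp
  next
    case False
    then obtain e where e: "e \<in> X" "l e \<noteq> 0" using sub by (auto simp: X0_def)
    have Be: "lin_on X0 (\<lambda>g. - B e g)"
      using insert.prems(4) e(1) by (simp add: lin_on_def X0_def)
    obtain s where s: "s \<in> X0" "\<forall>g\<in>X0. B s g = - B e g" using IH[OF Be] by blast
    have sX: "s \<in> X" "l s = 0" using s(1) by (auto simp: X0_def)
    \<comment> \<open>\<open>s\<close> corrects \<open>e\<close> so that \<open>e'\<close> becomes orthogonal to \<open>X0\<close>; the factor 1 keeps the shape of \<open>lin_subD\<close>.\<close>
    define e' where "e' = (\<lambda>x. s x + 1 *\<^sub>R e x)"
    have e'X: "e' \<in> X" unfolding e'_def using lin_subD[OF X sX(1) e(1)] .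
    have le': "l e' = l e" using lin_onD[OF l sX(1) e(1), of 1] sX(2) by (simp add: e'_def)
    have e'0: "e' \<noteq> (\<lambda>_. 0)" using le' e lin_on_zero[OF X l] by auto
    have pos: "0 < B e' e'" using insert.prems(6) e'X e'0 by simp
    have orth: "B e' g = 0" if "g \<in> X0" for g
    proof -
      have "lin_on X (\<lambda>f. B f g)" using insert.prems(5) that by (simp add: X0_def)
      from lin_onD[OF this sX(1) e(1), of 1] show ?thesis using s(2) that by (simp add: e'_def)
    qed
    have "lin_on X0 L" using lin_on_mono[OF insert.prems(7) sub] .
    from IH[OF this] obtain x0 where x0: "x0 \<in> X0" "\<forall>g\<in>X0. B x0 g = L g" by blast
    define t where "t = (L e' - B x0 e') / B e' e'"
    define x where "x = (\<lambda>y. x0 y + t *\<^sub>R e' y)"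
    have x0X: "x0 \<in> X" using x0(1) by (simp add: X0_def)
    have xX: "x \<in> X" unfolding x_def using lin_subD[OF X x0X e'X] .
    have Bx: "B x g = B x0 g + t * B e' g" if "g \<in> X" for g
    proof -
      have "lin_on X (\<lambda>f. B f g)" using insert.prems(5) that by simp
      from lin_onD[OF this x0X e'X, of t] show ?thesis by (simp add: x_def)
    qed
    have "B x g = L g" if g: "g \<in> X" for g
    proof -
      define r where "r = l g / l e'"
      define g0 where "g0 = (\<lambda>y. g y + (- r) *\<^sub>R e' y)"
      have g0X: "g0 \<in> X" unfolding g0_def using lin_subD[OF X g e'X] .
      have "l g0 = 0" unfolding g0_def lin_onD[OF l g e'X] r_def using le' e by simp
      then have g0: "g0 \<in> X0" using g0X by (simp add: X0_def)
      have geq: "g = (\<lambda>y. g0 y + r *\<^sub>R e' y)" by (simp add: g0_def)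
      have lx: "lin_on X (B x)" using insert.prems(4) xX by simp
      have "B x g = B x g0 + r * B x e'"
        by (subst geq) (rule lin_onD[OF lx g0X e'X])
      also have "B x g0 = L g0" using Bx[OF g0X] orth[OF g0] x0(2) g0 by simp
      also have "B x e' = L e'" using Bx[OF e'X] pos by (simp add: t_def)
      also have "L g0 + r * L e' = L g"
        using lin_onD[OF insert.prems(7) g0X e'X, of r] geq[symmetric] by simp
      finally show ?thesis .
    qed
    then show ?thesis using xX by blast
  qed
qed

lemma psd_expand:
  assumes X: "lin_sub X" and B: "psd_form X B" and "f \<in> X" "g \<in> X"
  shows "B (\<lambda>x. f x + c *\<^sub>R g x) (\<lambda>x. f x + c *\<^sub>R g x) = B f f + 2 * c * B f g + c\<^sup>2 * B g g"
proof -
  let ?h = "\<lambda>x. f x + c *\<^sub>R g x"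
  have h: "?h \<in> X" using lin_subD assms by blast
  have l: "lin_on X (B k)" if "k \<in> X" for k using psd_formD[OF B] that by blast
  have sy: "B a b = B b a" if "a \<in> X" "b \<in> X" for a b using psd_formD[OF B] that by blast
  have "B ?h ?h = B ?h f + c * B ?h g" using lin_onD[OF l[OF h] assms(3,4)] .
  also have "B ?h f = B f f + c * B f g" using sy[OF h assms(3)] lin_onD[OF l[OF assms(3)] assms(3,4)] by simp
  also have "B ?h g = B f g + c * B g g"
    using sy[OF h assms(4)] lin_onD[OF l[OF assms(4)] assms(3,4)] sy[OF assms(3,4)] by simp
  finally show ?thesis by (simp add: algebra_simps power2_eq_square)
qed

text \<open>
  The quadratic polynomial \<open>B (f + c g) (f + c g)\<close> in \<open>c\<close> is nonnegative; the estimate is this fact at its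
  minimum, or, if \<open>B g g = 0\<close>, the fact that a linear polynomial bounded from below is constant.
\<close>

lemma psd_cauchy_schwarz:
  assumes X: "lin_sub X" and B: "psd_form X B" and "f \<in> X" "g \<in> X"
  shows "\<bar>B f g\<bar> \<le> sqrt (B f f) * sqrt (B g g)"
proof -
  have q: "0 \<le> B f f + 2 * c * B f g + c\<^sup>2 * B g g" for c
    unfolding psd_expand[OF assms, of c, symmetric]
    using B lin_subD[OF X assms(3,4), of c] unfolding psd_form_def by blast
  have p: "0 \<le> B f f" "0 \<le> B g g" using psd_formD(3)[OF B assms(3)] psd_formD(3)[OF B assms(4)] by auto
  have "(B f g)\<^sup>2 \<le> B f f * B g g"
  proof (cases "B g g = 0")
    case True
    have "B f g = 0"
    proof (rule ccontr)
      assume n: "B f g \<noteq> 0"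
      show False using q[of "- (B f f + 1) / (2 * B f g)"] True n by (simp add: field_simps)
    qed
    then show ?thesis using p by simp
  next
    case False
    then have "0 < B g g" using p by simp
    then show ?thesis using q[of "- B f g / B g g"]
      by (simp add: field_simps power2_eq_square)
  qed
  then have "sqrt ((B f g)\<^sup>2) \<le> sqrt (B f f * B g g)" by (rule real_sqrt_le_mono)
  then show ?thesis by (simp add: real_sqrt_mult)
qed

lemma psd_triangle:
  assumes X: "lin_sub X" and B: "psd_form X B" and "f \<in> X" "g \<in> X"
  shows "sqrt (B (\<lambda>x. f x + c *\<^sub>R g x) (\<lambda>x. f x + c *\<^sub>R g x)) \<le> sqrt (B f f) + \<bar>c\<bar> * sqrt (B g g)"
proof -
  have p: "0 \<le> B f f" "0 \<le> B g g" using psd_formD(3)[OF B assms(3)] psd_formD(3)[OF B assms(4)] by auto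
  have "c * B f g \<le> \<bar>c\<bar> * (sqrt (B f f) * sqrt (B g g))"
  proof -
    have "c * B f g \<le> \<bar>c\<bar> * \<bar>B f g\<bar>" by (metis abs_ge_self abs_mult)
    also have "\<dots> \<le> \<bar>c\<bar> * (sqrt (B f f) * sqrt (B g g))"
      by (intro mult_left_mono psd_cauchy_schwarz[OF assms]) simp
    finally show ?thesis .
  qed
  then have "B f f + 2 * c * B f g + c\<^sup>2 * B g g \<le> (sqrt (B f f) + \<bar>c\<bar> * sqrt (B g g))\<^sup>2"
    using p by (simp add: power2_sum power_mult_distrib algebra_simps)
  then show ?thesis unfolding psd_expand[OF assms]
    by (intro real_le_lsqrt) (use p in auto)
qed

text \<open>
  On a finite-dimensional space an inner product dominates every semidefinite form. Induction as in
  \<open>lax_milgram\<close>: a \<open>B\<close>-orthogonal complement \<open>e'\<close> of the kernel splits \<open>B\<close> exactly, while \<open>M\<close> splits up to a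
  factor 2.
\<close>

lemma psd_form_bounded:
  assumes "finite E" "lin_sub X" "\<forall>l\<in>E. lin_on X l"
    and "\<forall>f\<in>X. (\<forall>l\<in>E. l f = 0) \<longrightarrow> f = (\<lambda>_. 0)"
    and "psd_form X B" "\<forall>f\<in>X. f \<noteq> (\<lambda>_. 0) \<longrightarrow> 0 < B f f" and "psd_form X M"
  shows "\<exists>K\<ge>0. \<forall>f\<in>X. M f f \<le> K * B f f"
  using assms
proof (induction E arbitrary: X rule: finite_induct)
  case empty
  then have X0: "f = (\<lambda>_. 0)" if "f \<in> X" for f using that by auto
  have z: "(\<lambda>_. 0) \<in> X" using empty by (simp add: lin_sub_def)
  have "lin_on X (M (\<lambda>_. 0))" using psd_formD(1)[OF empty.prems(6) z] .
  then have "M (\<lambda>_. 0) (\<lambda>_. 0) = 0" using lin_on_zero[OF empty.prems(1)] by blast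
  then show ?case using X0 by (intro exI[of _ 0]) auto
next
  case (insert l E X)
  note X = \<open>lin_sub X\<close> and B = \<open>psd_form X B\<close> and M = \<open>psd_form X M\<close>
  define X0 where "X0 = {f\<in>X. l f = 0}"
  have sub: "X0 \<subseteq> X" by (auto simp: X0_def)
  have l: "lin_on X l" using insert.prems by auto
  have X0: "lin_sub X0"
    unfolding lin_sub_def X0_def using X lin_on_zero[OF X l] lin_onD[OF l]
    by (auto simp: lin_sub_def)
  have psub: "psd_form X0 Q" if "psd_form X Q" for Q
    using that sub lin_on_mono[OF _ sub] unfolding psd_form_def by blast
  have E0: "\<forall>l\<in>E. lin_on X0 l" using insert.prems lin_on_mono[OF _ sub] by auto
  have sep0: "\<forall>f\<in>X0. (\<forall>l\<in>E. l f = 0) \<longrightarrow> f = (\<lambda>_. 0)" using insert.prems by (auto simp: X0_def)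
  have pos0: "\<forall>f\<in>X0. f \<noteq> (\<lambda>_. 0) \<longrightarrow> 0 < B f f" using insert.prems sub by blast
  obtain K where K: "K \<ge> 0" "\<forall>f\<in>X0. M f f \<le> K * B f f"
    using insert.IH[OF X0 E0 sep0 psub[OF B] pos0 psub[OF M]] by auto
  show ?case
  proof (cases "X0 = X")
    case True
    then show ?thesis using K by auto
  next
    case False
    then obtain e where e: "e \<in> X" "l e \<noteq> 0" using sub by (auto simp: X0_def)
    have Bl: "lin_on X (B f)" "lin_on X (M f)" if "f \<in> X" for f
      using psd_formD(1)[OF B that] psd_formD(1)[OF M that] by auto
    have sy: "B f g = B g f" if "f \<in> X" "g \<in> X" for f g
      using psd_formD(2)[OF B that] .
    have B2: "lin_on X (\<lambda>f. B f g)" if "g \<in> X" for g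
      using lin_onD[OF Bl(1)[OF that]] sy that lin_subD[OF X] by (auto simp: lin_on_def)
    have Be: "lin_on X0 (\<lambda>g. - B e g)"
      using lin_onD[OF Bl(1)[OF e(1)]] sub by (auto simp: lin_on_def X0_def)
    have l1: "\<forall>f\<in>X0. lin_on X0 (B f)" using Bl(1) sub lin_on_mono[OF _ sub] by (simp add: subset_iff)
    have l2: "\<forall>g\<in>X0. lin_on X0 (\<lambda>f. B f g)" using B2 sub lin_on_mono[OF _ sub] by (simp add: subset_iff)
    have "\<exists>f\<in>X0. \<forall>g\<in>X0. B f g = - B e g"
      by (rule lax_milgram[OF insert.hyps(1) X0 E0 sep0 l1 l2 pos0 Be])
    then obtain s where s: "s \<in> X0" "\<forall>g\<in>X0. B s g = - B e g" by auto
    define e' where "e' = (\<lambda>x. s x + 1 *\<^sub>R e x)"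
    have e'X: "e' \<in> X" unfolding e'_def using lin_subD[OF X] s sub e by blast
    have sX: "s \<in> X" "l s = 0" using s(1) by (auto simp: X0_def)
    have le': "l e' = l e" using lin_onD[OF l sX(1) e(1), of 1] sX(2) by (simp add: e'_def)
    have "e' \<noteq> (\<lambda>_. 0)" using le' e lin_on_zero[OF X l] by auto
    then have pos: "0 < B e' e'" using insert.prems e'X by auto
    have orth: "B g e' = 0" if g: "g \<in> X0" for g
    proof -
      have "lin_on X (B g)" using Bl(1) g sub by auto
      from lin_onD[OF this sX(1) e(1), of 1]
      have "B g e' = B g s + B g e" by (simp add: e'_def)
      then show ?thesis using s(2) g sy[OF _ sX(1), of g] sy[OF _ e(1), of g] sub by auto
    qed
    have Mp: "0 \<le> M f f" if "f \<in> X" for f using psd_formD(3)[OF M that] .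
    define K' where "K' = 2 * K + 2 * M e' e' / B e' e'"
    have K'0: "K' \<ge> 0" using K Mp[OF e'X] pos by (simp add: K'_def)
    have "M g g \<le> K' * B g g" if g: "g \<in> X" for g
    proof -
      define r where "r = l g / l e'"
      define g0 where "g0 = (\<lambda>y. g y + (- r) *\<^sub>R e' y)"
      have g0X: "g0 \<in> X" unfolding g0_def using lin_subD[OF X g e'X] .
      have "l g0 = 0" unfolding g0_def lin_onD[OF l g e'X] r_def using le' e by simp
      then have g0: "g0 \<in> X0" using g0X by (simp add: X0_def)
      have geq: "g = (\<lambda>y. g0 y + r *\<^sub>R e' y)" by (simp add: g0_def)
      have Bg: "B g g = B g0 g0 + r\<^sup>2 * B e' e'"
        using psd_expand[OF X B g0X e'X, of r] orth[OF g0] geq by simp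
      have "0 \<le> M g0 g0 + 2 * (- r) * M g0 e' + (- r)\<^sup>2 * M e' e'"
        using psd_expand[OF X M g0X e'X, of "- r"] Mp[OF lin_subD[OF X g0X e'X, of "-r"]] by simp
      moreover have "M g g = M g0 g0 + 2 * r * M g0 e' + r\<^sup>2 * M e' e'"
        using psd_expand[OF X M g0X e'X, of r] geq by simp
      ultimately have "M g g \<le> 2 * M g0 g0 + 2 * r\<^sup>2 * M e' e'" by (simp add: algebra_simps)
      also have "\<dots> \<le> 2 * (K * B g0 g0) + 2 * r\<^sup>2 * M e' e'" using K(2) g0 by simp
      also have "\<dots> \<le> K' * B g0 g0 + K' * (r\<^sup>2 * B e' e')"
      proof (rule add_mono)
        have b0: "0 \<le> B g0 g0" using psd_formD(3)[OF B g0X] .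
        have "2 * K \<le> K'" using Mp[OF e'X] pos by (simp add: K'_def)
        from mult_right_mono[OF this b0]
        show "2 * (K * B g0 g0) \<le> K' * B g0 g0" by simp
        have "2 * M e' e' / B e' e' \<le> K'" using K by (simp add: K'_def)
        then have "2 * M e' e' \<le> K' * B e' e'" using pos by (simp add: field_simps)
        from mult_left_mono[OF this, of "r\<^sup>2"]
        show "2 * r\<^sup>2 * M e' e' \<le> K' * (r\<^sup>2 * B e' e')" by (simp add: mult_ac)
      qed
      finally show ?thesis unfolding Bg by (simp add: algebra_simps)
    qed
    then show ?thesis using K'0 by blast
  qed
qed

section \<open>Square-integrable functions\<close>

definition sqint :: "'a measure \<Rightarrow> ('a \<Rightarrow> 'b::euclidean_space) set" where
  "sqint M = {f \<in> borel_measurable M. integrable M (\<lambda>x. (norm (f x))\<^sup>2)}"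

definition ip :: "'a measure \<Rightarrow> ('a \<Rightarrow> 'b::euclidean_space) \<Rightarrow> ('a \<Rightarrow> 'b) \<Rightarrow> real" where
  "ip M f g = (LINT x|M. f x \<bullet> g x)"

lemma sqint_integrable:
  assumes "f \<in> sqint M" "g \<in> sqint M" shows "integrable M (\<lambda>x. f x \<bullet> g x)"
proof (rule Bochner_Integration.integrable_bound)
  show "integrable M (\<lambda>x. (norm (f x))\<^sup>2 + (norm (g x))\<^sup>2)" using assms by (auto simp: sqint_def)
  show "(\<lambda>x. f x \<bullet> g x) \<in> borel_measurable M" using assms by (auto simp: sqint_def)
  have "\<bar>f x \<bullet> g x\<bar> \<le> (norm (f x))\<^sup>2 + (norm (g x))\<^sup>2" for x
  proof -
    have "\<bar>f x \<bullet> g x\<bar> \<le> norm (f x) * norm (g x)" by (rule Cauchy_Schwarz_ineq2)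
    also have "\<dots> \<le> (norm (f x))\<^sup>2 + (norm (g x))\<^sup>2"
      using sum_squares_bound[of "norm (f x)" "norm (g x)"]
        mult_nonneg_nonneg[OF norm_ge_zero norm_ge_zero, of "f x" "g x"] by linarith
    finally show ?thesis .
  qed
  then show "AE x in M. norm (f x \<bullet> g x) \<le> norm ((norm (f x))\<^sup>2 + (norm (g x))\<^sup>2)" by auto
qed

lemma sqint_bounded:
  assumes "finite_measure M" "f \<in> borel_measurable M" "\<And>x. x \<in> space M \<Longrightarrow> norm (f x) \<le> K"
  shows "f \<in> sqint M"
proof -
  interpret finite_measure M by fact
  have "integrable M (\<lambda>x. (norm (f x))\<^sup>2)"
  proof (rule integrable_const_bound[where B = "K\<^sup>2"])
    show "AE x in M. norm ((norm (f x))\<^sup>2) \<le> K\<^sup>2"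
      using assms(3) by (intro AE_I2) (simp add: power_mono)
  qed (use assms(2) in measurable)
  then show ?thesis using assms(2) by (simp add: sqint_def)
qed

lemma sqint_imp_integrable:
  assumes "finite_measure M" "f \<in> sqint M" shows "integrable M f"
proof -
  interpret finite_measure M by fact
  show ?thesis
  proof (rule Bochner_Integration.integrable_bound)
    show "integrable M (\<lambda>x. 1 + (norm (f x))\<^sup>2)" using assms(2) by (auto simp: sqint_def)
    show "f \<in> borel_measurable M" using assms(2) by (auto simp: sqint_def)
    have "norm (f x) \<le> norm (1 + (norm (f x))\<^sup>2)" for x
    proof -
      have "2 * norm (f x) \<le> 1 + (norm (f x))\<^sup>2" using sum_squares_bound[of 1 "norm (f x)"] by simp
      then have "norm (f x) \<le> 1 + (norm (f x))\<^sup>2" using norm_ge_zero[of "f x"] by linarith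
      then show ?thesis by simp
    qed
    then show "AE x in M. norm (f x) \<le> norm (1 + (norm (f x))\<^sup>2)" by simp
  qed
qed

lemma lin_sub_sqint: "lin_sub (sqint M)"
proof -
  have "(\<lambda>x. f x + c *\<^sub>R g x) \<in> sqint M" if f: "f \<in> sqint M" and g: "g \<in> sqint M" for f g c
  proof -
    have eq: "(norm (f x + c *\<^sub>R g x))\<^sup>2 = (norm (f x))\<^sup>2 + 2 * c * (f x \<bullet> g x) + c\<^sup>2 * (norm (g x))\<^sup>2" for x
      unfolding power2_norm_eq_inner by (simp add: inner_add_left inner_add_right inner_commute power2_eq_square algebra_simps)
    have m: "(\<lambda>x. f x + c *\<^sub>R g x) \<in> borel_measurable M" using f g by (auto simp: sqint_def)
    have "integrable M (\<lambda>x. (norm (f x + c *\<^sub>R g x))\<^sup>2)"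
      unfolding eq using f g sqint_integrable[OF f g] by (auto simp: sqint_def)
    then show ?thesis using m by (simp add: sqint_def)
  qed
  then show ?thesis by (auto simp: lin_sub_def) (simp add: sqint_def)
qed

text \<open>
  Additivity is required only on the space of \<open>M\<close>, because the traces and jumps to which this is applied
  are meaningful only on the face that carries the measure.
\<close>

definition lin_op ::
    "('a \<Rightarrow> 'b::real_vector) set \<Rightarrow> 'c measure \<Rightarrow> (('a \<Rightarrow> 'b) \<Rightarrow> 'c \<Rightarrow> 'd::euclidean_space) \<Rightarrow> bool" where
  "lin_op X M D \<longleftrightarrow> (\<forall>f\<in>X. D f \<in> sqint M) \<and>
     (\<forall>f\<in>X. \<forall>g\<in>X. \<forall>c. \<forall>x\<in>space M. D (\<lambda>y. f y + c *\<^sub>R g y) x = D f x + c *\<^sub>R D g x)"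

lemma lin_on_ip:
  assumes D: "lin_op X M D" and h: "h \<in> sqint M"
  shows "lin_on X (\<lambda>f. ip M h (D f))" "lin_on X (\<lambda>f. ip M (D f) h)"
proof -
  have *: "ip M h (D (\<lambda>y. f y + c *\<^sub>R g y)) = ip M h (D f) + c * ip M h (D g)"
    if f: "f \<in> X" and g: "g \<in> X" for f g c
  proof -
    have "ip M h (D (\<lambda>y. f y + c *\<^sub>R g y)) = (LINT x|M. h x \<bullet> D f x + c * (h x \<bullet> D g x))"
      unfolding ip_def using D f g
      by (intro Bochner_Integration.integral_cong) (auto simp: lin_op_def inner_add_right)
    also have "\<dots> = ip M h (D f) + c * ip M h (D g)"
      unfolding ip_def using sqint_integrable[OF h] D f g
      by (subst Bochner_Integration.integral_add) (auto simp: lin_op_def)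
    finally show ?thesis .
  qed
  then show "lin_on X (\<lambda>f. ip M h (D f))" by (simp add: lin_on_def)
  have "ip M a b = ip M b a" for a b :: "'c \<Rightarrow> 'd" by (simp add: ip_def inner_commute)
  then show "lin_on X (\<lambda>f. ip M (D f) h)" using * by (simp add: lin_on_def)
qed

lemma ip_nonneg: "0 \<le> ip M f f" by (simp add: ip_def)

lemma psd_form_ip:
  assumes D: "lin_op X M D" shows "psd_form X (\<lambda>f g. ip M (D f) (D g))"
proof -
  have "D f \<in> sqint M" if "f \<in> X" for f using D that by (auto simp: lin_op_def)
  then show ?thesis using lin_on_ip[OF D] ip_nonneg
    by (auto simp: psd_form_def) (simp add: ip_def inner_commute)
qed

lemma psd_form_cong:
  assumes "lin_sub X" "psd_form X A" "\<And>f g. f \<in> X \<Longrightarrow> g \<in> X \<Longrightarrow> B f g = A f g"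
  shows "psd_form X B"
  unfolding psd_form_def lin_on_def
proof (intro conjI ballI allI)
  fix f g h c assume "f \<in> X" "g \<in> X" "h \<in> X"
  then show "B f (\<lambda>x. g x + c *\<^sub>R h x) = B f g + c * B f h"
    using lin_onD[OF psd_formD(1)[OF assms(2)], of f g h c] lin_subD[OF assms(1), of g h c] assms(3) by simp
next
  fix f g assume fg: "f \<in> X" "g \<in> X"
  then show "B f g = B g f" using psd_formD(2)[OF assms(2) fg] assms(3) by simp
next
  fix f assume "f \<in> X" then show "0 \<le> B f f" using psd_formD(3)[OF assms(2)] assms(3) by simp
qed

lemma psd_form_add:
  assumes "psd_form X A" "psd_form X B"
  shows "psd_form X (\<lambda>f g. A f g + B f g)"
  using assms by (auto simp: psd_form_def lin_on_def algebra_simps)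

lemma psd_form_scale:
  assumes "psd_form X A" "0 \<le> c"
  shows "psd_form X (\<lambda>f g. c * A f g)"
  using assms by (auto simp: psd_form_def lin_on_def algebra_simps)

lemma psd_form_sum:
  assumes "\<And>i. i \<in> I \<Longrightarrow> psd_form X (A i)"
  shows "psd_form X (\<lambda>f g. \<Sum>i\<in>I. A i f g)"
  using assms
  by (auto simp: psd_form_def lin_on_def sum.distrib sum_distrib_left intro!: sum_nonneg sum.cong)

lemma ip_cauchy_schwarz:
  assumes "f \<in> sqint M" "g \<in> sqint M" shows "\<bar>ip M f g\<bar> \<le> sqrt (ip M f f) * sqrt (ip M g g)"
proof -
  have "lin_op (sqint M) M (\<lambda>f. f)" by (auto simp: lin_op_def)
  then show ?thesis using psd_cauchy_schwarz[OF lin_sub_sqint psd_form_ip] assms by blast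
qed

section \<open>Simplices and their facets\<close>

text \<open>
  The vertex is chosen by what is needed of it and not from a set of vertices: \<open>T\<close> is the cone over \<open>F\<close> with
  this apex, and the apex lies on every other facet.
\<close>

definition opposite_vertex :: "(real^'n) set \<Rightarrow> (real^'n) set \<Rightarrow> real^'n" where
  "opposite_vertex T F = (SOME a. a \<in> T \<and> a \<notin> affine hull F \<and> T = convex hull (insert a F) \<and>
     (\<forall>G. G facet_of T \<and> G \<noteq> F \<longrightarrow> a \<in> G))"

lemma opposite_vertex:
  fixes T :: "(real^'n) set"
  assumes "int CARD('n) simplex T" "F facet_of T"
  shows "opposite_vertex T F \<in> T" "opposite_vertex T F \<notin> affine hull F"
    "T = convex hull (insert (opposite_vertex T F) F)"
    "G facet_of T \<Longrightarrow> G \<noteq> F \<Longrightarrow> opposite_vertex T F \<in> G"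
proof -
  obtain C where C: "\<not> affine_dependent C" "T = convex hull C"
    using assms(1) by (auto simp: simplex_def)
  then obtain a where a: "a \<in> C" "F = convex hull (C - {a})"
    using assms(2) facet_of_convex_hull_affine_independent by blast
  have "\<exists>a. a \<in> T \<and> a \<notin> affine hull F \<and> T = convex hull (insert a F) \<and>
     (\<forall>G. G facet_of T \<and> G \<noteq> F \<longrightarrow> a \<in> G)"
  proof (intro exI[of _ a] conjI allI impI)
    show "a \<in> T" using a C by (simp add: hull_inc)
    show "a \<notin> affine hull F" using a C by (auto simp: affine_dependent_def)
    show "T = convex hull (insert a F)"
      unfolding a(2) hull_insert[symmetric] using a(1) C(2) by (simp add: insert_absorb)
    fix G assume G: "G facet_of T \<and> G \<noteq> F"
    then obtain b where "b \<in> C" "G = convex hull (C - {b})"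
      using C facet_of_convex_hull_affine_independent by blast
    then show "a \<in> G" using G a by (auto intro!: hull_inc)
  qed
  from someI_ex[OF this]
  show "opposite_vertex T F \<in> T" "opposite_vertex T F \<notin> affine hull F"
    "T = convex hull (insert (opposite_vertex T F) F)"
    "G facet_of T \<Longrightarrow> G \<noteq> F \<Longrightarrow> opposite_vertex T F \<in> G"
    unfolding opposite_vertex_def by blast+
qed

lemma simplex_facets_finite:
  fixes T :: "(real^'n) set"
  assumes "int CARD('n) simplex T"
  shows "finite {F. F facet_of T}" "card {F. F facet_of T} \<le> CARD('n) + 1"
proof -
  obtain C where C: "\<not> affine_dependent C" "T = convex hull C" "int (card C) = int CARD('n) + 1"
    using assms by (auto simp: simplex_def)
  have fin: "finite C" using C(1) by (rule aff_independent_finite)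
  have sub: "{F. F facet_of T} \<subseteq> (\<lambda>a. convex hull (C - {a})) ` C"
    using facet_of_convex_hull_affine_independent[OF C(1)] C(2) by auto
  show "finite {F. F facet_of T}" using finite_subset[OF sub] fin by simp
  have "card {F. F facet_of T} \<le> card ((\<lambda>a. convex hull (C - {a})) ` C)"
    using fin by (intro card_mono sub) simp
  also have "\<dots> \<le> card C" by (rule card_image_le[OF fin])
  finally show "card {F. F facet_of T} \<le> CARD('n) + 1" using C(3) by simp
qed

lemma simplex_props:
  fixes T :: "(real^'n) set"
  assumes "int CARD('n) simplex T"
  shows "convex T" "compact T" "polytope T" "aff_dim T = int CARD('n)" "interior T \<noteq> {}"
    "closure (interior T) = T"
proof -
  obtain C where C: "\<not> affine_dependent C" "T = convex hull C" "finite C"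
    using assms aff_independent_finite by (auto simp: simplex_def)
  show c: "convex T" using C by simp
  show "polytope T" using C by (auto simp: polytope_def)
  then show k: "compact T" by (rule polytope_imp_compact)
  show d: "aff_dim T = int CARD('n)" using aff_dim_simplex[OF assms] .
  show i: "interior T \<noteq> {}"
  proof
    assume "interior T = {}"
    from empty_interior_subset_hyperplane[OF c this] obtain a b where
      "a \<noteq> 0" "T \<subseteq> {x. a \<bullet> x = b}" by blast
    then have "aff_dim T \<le> aff_dim {x. a \<bullet> x = b}" by (intro aff_dim_subset)
    then show False using d \<open>a \<noteq> 0\<close> by (simp add: aff_dim_hyperplane)
  qed
  show "closure (interior T) = T"
    using convex_closure_interior[OF c i] k by (simp add: compact_imp_closed)
qed

lemma facet_props:
  fixes T :: "(real^'n) set"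
  assumes "int CARD('n) simplex T" "F facet_of T"
  shows "convex F" "compact F" "F \<noteq> {}" "F \<subseteq> T" "polytope F" "aff_dim F = int CARD('n) - 1"
proof -
  note T = simplex_props[OF assms(1)]
  have fa: "F face_of T" using assms(2) by (rule facet_of_imp_face_of)
  show "convex F" using fa by (rule face_of_imp_convex)
  show "polytope F" using face_of_polytope_polytope[OF T(3) fa] .
  then show "compact F" by (rule polytope_imp_compact)
  show "F \<noteq> {}" "aff_dim F = int CARD('n) - 1" using assms(2) T(4) by (auto simp: facet_of_def)
  show "F \<subseteq> T" using assms(2) by (rule facet_of_imp_subset)
qed

lemma facet_hyperplane:
  fixes T :: "(real^'n) set"
  assumes "int CARD('n) simplex T" "F facet_of T" and \<nu>: "\<nu> \<noteq> 0" "\<forall>x\<in>F. \<forall>y\<in>F. \<nu> \<bullet> (y - x) = 0"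
    and x0: "x0 \<in> F"
  shows "affine hull F = {x. \<nu> \<bullet> x = \<nu> \<bullet> x0}"
proof (rule affine_dim_equal)
  show "affine hull F \<noteq> {}" using x0 by auto
  have "\<nu> \<bullet> (x - x0) = 0" if "x \<in> F" for x using \<nu>(2) x0 that by blast
  then have "F \<subseteq> {x. \<nu> \<bullet> x = \<nu> \<bullet> x0}" by (auto simp: inner_diff_right)
  then show "affine hull F \<subseteq> {x. \<nu> \<bullet> x = \<nu> \<bullet> x0}"
    by (intro hull_minimal affine_hyperplane)
  show "aff_dim (affine hull F) = aff_dim {x. \<nu> \<bullet> x = \<nu> \<bullet> x0}"
    using facet_props(6)[OF assms(1,2)] \<nu>(1) by (simp add: aff_dim_hyperplane)
qed (auto simp: affine_hyperplane)

lemma facet_unit_normal: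
  fixes T :: "(real^'n) set"
  assumes "int CARD('n) simplex T" "F facet_of T"
  obtains \<nu> where "norm \<nu> = 1" "\<forall>x\<in>F. \<forall>y\<in>F. \<nu> \<bullet> (y - x) = 0"
proof -
  have "aff_dim F = DIM(real^'n) - 1" using facet_props(6)[OF assms] by simp
  then obtain a b where a: "a \<noteq> 0" "affine hull F = {x. a \<bullet> x = b}"
    using aff_dim_eq_hyperplane by blast
  have "a \<bullet> x = b" if "x \<in> F" for x using hull_inc[of x F affine] that a(2) by auto
  then have "\<forall>x\<in>F. \<forall>y\<in>F. (a /\<^sub>R norm a) \<bullet> (y - x) = 0" by (auto simp: inner_diff_right)
  then show ?thesis using that[of "a /\<^sub>R norm a"] a(1) by simp
qed

lemma opposite_vertex_off_facet:
  fixes T :: "(real^'n) set"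
  assumes "int CARD('n) simplex T" "F facet_of T" and \<nu>: "\<nu> \<noteq> 0" "\<forall>x\<in>F. \<forall>y\<in>F. \<nu> \<bullet> (y - x) = 0"
    and x0: "x0 \<in> F"
  shows "\<nu> \<bullet> (opposite_vertex T F - x0) \<noteq> 0"
  using opposite_vertex(2)[OF assms(1,2)] unfolding facet_hyperplane[OF assms]
  by (simp add: inner_diff_right)

text \<open>
  Moving a point of \<open>F\<close> by the part of \<open>\<nu>\<close> orthogonal to \<open>n\<close> does not leave the hyperplane of \<open>F\<close>, to which \<open>\<nu>\<close>
  is normal as well. So this part of \<open>\<nu>\<close> is orthogonal to \<open>\<nu>\<close>, which forces it to vanish.
\<close>

lemma unit_normals_parallel:
  fixes T :: "(real^'n) set"
  assumes "int CARD('n) simplex T" "F facet_of T" and \<nu>: "norm \<nu> = 1" "\<forall>x\<in>F. \<forall>y\<in>F. \<nu> \<bullet> (y - x) = 0"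
    and n: "norm n = 1" "\<forall>x\<in>F. \<forall>y\<in>F. n \<bullet> (y - x) = 0"
  shows "\<nu> = (n \<bullet> \<nu>) *\<^sub>R n" "(n \<bullet> \<nu>)\<^sup>2 = 1"
proof -
  obtain x0 where x0: "x0 \<in> F" using facet_props(3)[OF assms(1,2)] by blast
  have nz: "\<nu> \<noteq> 0" "n \<noteq> 0" using \<nu> n by auto
  define z where "z = x0 + (\<nu> - (n \<bullet> \<nu>) *\<^sub>R n)"
  have nn: "n \<bullet> n = 1" "\<nu> \<bullet> \<nu> = 1" using n \<nu> by (simp_all add: dot_square_norm)
  have "z \<in> {x. n \<bullet> x = n \<bullet> x0}" by (simp add: z_def inner_add_right inner_diff_right nn)
  then have "z \<in> {x. \<nu> \<bullet> x = \<nu> \<bullet> x0}"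
    unfolding facet_hyperplane[OF assms(1,2) nz(1) \<nu>(2) x0, symmetric]
      facet_hyperplane[OF assms(1,2) nz(2) n(2) x0, symmetric] .
  then show sq: "(n \<bullet> \<nu>)\<^sup>2 = 1"
    by (simp add: z_def inner_add_right inner_diff_right nn power2_eq_square inner_commute)
  have "(\<nu> - (n \<bullet> \<nu>) *\<^sub>R n) \<bullet> (\<nu> - (n \<bullet> \<nu>) *\<^sub>R n) = 0"
    using sq by (simp add: inner_diff_right inner_diff_left nn power2_eq_square inner_commute)
  then show "\<nu> = (n \<bullet> \<nu>) *\<^sub>R n" by simp
qed

text \<open>
  Of the two unit normals of \<open>F\<close> exactly one points away from the opposite vertex, and the half-space that
  contains \<open>F\<close> and this vertex contains \<open>T\<close>. Hence the definite description denotes.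
\<close>

lemma outer_normal:
  fixes T :: "(real^'n) set"
  assumes "int CARD('n) simplex T" "F facet_of T"
  shows "norm (outer_normal T F) = 1" "\<forall>x\<in>F. \<forall>y\<in>T. outer_normal T F \<bullet> (y - x) \<le> 0"
    "\<forall>x\<in>F. \<forall>y\<in>F. outer_normal T F \<bullet> (y - x) = 0"
proof -
  note T = opposite_vertex[OF assms] and F = facet_props[OF assms]
  let ?a = "opposite_vertex T F"
  obtain n where n: "norm n = 1" "\<forall>x\<in>F. \<forall>y\<in>F. n \<bullet> (y - x) = 0"
    using facet_unit_normal[OF assms] by blast
  obtain x0 where x0: "x0 \<in> F" using F by blast
  have nz: "n \<noteq> 0" using n by auto
  have a: "n \<bullet> (?a - x0) \<noteq> 0" using opposite_vertex_off_facet[OF assms nz n(2) x0] .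
  define \<nu> where "\<nu> = (- sgn (n \<bullet> (?a - x0))) *\<^sub>R n"
  let ?P = "\<lambda>\<nu>. norm \<nu> = 1 \<and> (\<forall>x\<in>F. \<forall>y\<in>T. \<nu> \<bullet> (y - x) \<le> 0)"
  have orth: "\<forall>x\<in>F. \<forall>y\<in>F. \<nu>' \<bullet> (y - x) = 0" if "?P \<nu>'" for \<nu>'
  proof (intro ballI)
    fix x y assume xy: "x \<in> F" "y \<in> F"
    then have "\<nu>' \<bullet> (y - x) \<le> 0" "\<nu>' \<bullet> (x - y) \<le> 0" using that F(4) by blast+
    then show "\<nu>' \<bullet> (y - x) = 0" by (simp add: inner_diff_right)
  qed
  have P: "?P \<nu>"
  proof (intro conjI ballI)
    show "norm \<nu> = 1" using n a by (simp add: \<nu>_def abs_sgn_eq)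
    fix x y assume x: "x \<in> F" and y: "y \<in> T"
    have o: "\<nu> \<bullet> (z - x) = 0" if "z \<in> F" for z using n(2) that x by (simp add: \<nu>_def)
    have "\<nu> \<bullet> (?a - x) = \<nu> \<bullet> (?a - x0) + \<nu> \<bullet> (x0 - x)" by (simp add: inner_diff_right)
    also have "\<dots> = - \<bar>n \<bullet> (?a - x0)\<bar>" using o[OF x0] by (simp add: \<nu>_def abs_sgn mult.commute)
    finally have ax: "\<nu> \<bullet> ?a \<le> \<nu> \<bullet> x" by (simp add: inner_diff_right)
    have "convex hull (insert ?a F) \<subseteq> {y. \<nu> \<bullet> y \<le> \<nu> \<bullet> x}"
      using ax o by (intro hull_minimal convex_halfspace_le) (auto simp: inner_diff_right)
    then show "\<nu> \<bullet> (y - x) \<le> 0" using y T(3) by (auto simp: inner_diff_right)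
  qed
  have "outer_normal T F = \<nu>" unfolding outer_normal_def
  proof (rule the_equality[where P = ?P, OF P])
    fix \<nu>' assume P': "?P \<nu>'"
    have *: "\<nu>' = (\<nu> \<bullet> \<nu>') *\<^sub>R \<nu>" "(\<nu> \<bullet> \<nu>')\<^sup>2 = 1"
      using unit_normals_parallel[OF assms _ orth[OF P'] _ orth[OF P]] P P' by blast+
    have "\<nu> \<bullet> (?a - x0) \<noteq> 0" using a by (simp add: \<nu>_def sgn_zero_iff)
    then have neg: "\<nu> \<bullet> (?a - x0) < 0" using P x0 T(1) by (metis order_le_less)
    have "(\<nu> \<bullet> \<nu>') * (\<nu> \<bullet> (?a - x0)) = \<nu>' \<bullet> (?a - x0)" by (metis *(1) inner_scaleR_left)
    also have "\<dots> \<le> 0" using P' x0 T(1) by blast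
    finally have "0 \<le> \<nu> \<bullet> \<nu>'" using neg by (simp add: mult_le_0_iff)
    then have "\<nu> \<bullet> \<nu>' = 1" using *(2) by (simp add: power2_eq_1_iff)
    then show "\<nu>' = \<nu>" using *(1) by simp
  qed
  then show "norm (outer_normal T F) = 1" "\<forall>x\<in>F. \<forall>y\<in>T. outer_normal T F \<bullet> (y - x) \<le> 0"
    "\<forall>x\<in>F. \<forall>y\<in>F. outer_normal T F \<bullet> (y - x) = 0"
    using P orth[OF P] by blast+
qed

text \<open>
  The distance of the opposite vertex from the hyperplane of \<open>F\<close>, which the outer normal measures from an
  arbitrary point of \<open>F\<close>.
\<close>

definition facet_height :: "(real^'n) set \<Rightarrow> (real^'n) set \<Rightarrow> real" where
  "facet_height T F = outer_normal T F \<bullet> ((SOME x. x \<in> F) - opposite_vertex T F)"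

lemma facet_height:
  fixes T :: "(real^'n) set"
  assumes "int CARD('n) simplex T" "F facet_of T"
  shows "x \<in> F \<Longrightarrow> outer_normal T F \<bullet> (x - opposite_vertex T F) = facet_height T F"
    "0 < facet_height T F" "facet_height T F \<le> diameter T"
proof -
  note T = opposite_vertex[OF assms] and F = facet_props[OF assms] and N = outer_normal[OF assms]
  obtain x0 where x0: "x0 \<in> F" using F by blast
  have *: "outer_normal T F \<bullet> (x - opposite_vertex T F) = facet_height T F" if "x \<in> F" for x
  proof -
    have "(SOME x. x \<in> F) \<in> F" using x0 by (rule someI)
    then have "outer_normal T F \<bullet> (x - (SOME x. x \<in> F)) = 0" using N(3) that by blast
    then show ?thesis by (simp add: facet_height_def inner_diff_right)
  qed
  then show "x \<in> F \<Longrightarrow> outer_normal T F \<bullet> (x - opposite_vertex T F) = facet_height T F" .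
  have "outer_normal T F \<noteq> 0" using N(1) by auto
  from opposite_vertex_off_facet[OF assms this N(3) x0]
  have "facet_height T F \<noteq> 0" using *[OF x0] by (simp add: inner_diff_right)
  moreover have "0 \<le> facet_height T F"
    using *[OF x0] N(2) x0 T(1) by (force simp: inner_diff_right)
  ultimately show "0 < facet_height T F" by simp
  have "facet_height T F \<le> norm (outer_normal T F) * norm (x0 - opposite_vertex T F)"
    using *[OF x0] norm_cauchy_schwarz by metis
  also have "\<dots> \<le> diameter T"
    using diameter_bounded_bound[of T x0 "opposite_vertex T F"] x0 F(4) T(1) N(1)
      simplex_props(2)[OF assms(1)] by (auto simp: dist_norm compact_imp_bounded)
  finally show "facet_height T F \<le> diameter T" .
qed

lemma inball_diameter_nonneg:
  fixes T :: "(real^'n) set"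
  assumes "compact T" "T \<noteq> {}" shows "0 \<le> inball_diameter T"
  unfolding inball_diameter_def
proof (rule cSup_upper)
  obtain x where "x \<in> T" using assms(2) by blast
  then have "cball x 0 \<subseteq> T" by simp
  then show "0 \<in> {2 * r | r x. 0 \<le> r \<and> cball x r \<subseteq> T}"
    by (intro CollectI exI[of _ 0] exI[of _ x]) simp
  show "bdd_above {2 * r | r x. 0 \<le> r \<and> cball x r \<subseteq> T}"
    unfolding bdd_above_def
  proof (intro exI ballI)
    fix y assume "y \<in> {2 * r | r x. 0 \<le> r \<and> cball x r \<subseteq> T}"
    then obtain r z where y: "y = 2 * r" "0 \<le> r" "cball z r \<subseteq> T" by blast
    have "y = diameter (cball z r)" using y(1,2) by (simp add: diameter_cball)
    also have "\<dots> \<le> diameter T"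
      using y(3) assms(1) by (intro diameter_subset) (auto simp: compact_imp_bounded)
    finally show "y \<le> diameter T" .
  qed
qed

lemma inball_diameter_le:
  fixes T :: "(real^'n) set"
  assumes "T \<noteq> {}" and "\<And>r x. 0 \<le> r \<Longrightarrow> cball x r \<subseteq> T \<Longrightarrow> 2 * r \<le> b"
  shows "inball_diameter T \<le> b"
  unfolding inball_diameter_def
proof (rule cSup_least)
  obtain x where "x \<in> T" using assms(1) by blast
  then have "cball x 0 \<subseteq> T" by simp
  then show "{2 * r | r x. 0 \<le> r \<and> cball x r \<subseteq> T} \<noteq> {}" by blast
next
  fix z assume "z \<in> {2 * r | r x. 0 \<le> r \<and> cball x r \<subseteq> T}"
  then show "z \<le> b" using assms(2) by blast
qed

text \<open>
  Between the hyperplane of \<open>F\<close> and its parallel through the opposite vertex there is no room for a larger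
  ball.
\<close>

lemma inball_diameter_le_height:
  fixes T :: "(real^'n) set"
  assumes "int CARD('n) simplex T" "F facet_of T"
  shows "inball_diameter T \<le> facet_height T F"
proof (rule inball_diameter_le)
  note T = opposite_vertex[OF assms] and F = facet_props[OF assms] and N = outer_normal[OF assms]
  let ?\<nu> = "outer_normal T F" and ?a = "opposite_vertex T F"
  show "T \<noteq> {}" using F by blast
  fix r x assume r: "0 \<le> r" and sub: "cball x r \<subseteq> T"
  obtain x0 where x0: "x0 \<in> F" using F by blast
  have "x + r *\<^sub>R ?\<nu> \<in> T" "x - r *\<^sub>R ?\<nu> \<in> T" using sub r N(1) by (auto simp: subset_iff dist_norm)
  have low: "?\<nu> \<bullet> ?a \<le> ?\<nu> \<bullet> y" if "y \<in> T" for y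
  proof -
    have "?\<nu> \<bullet> ?a \<le> ?\<nu> \<bullet> z" if "z \<in> F" for z
      using facet_height(1,2)[OF assms] that by (smt (verit) inner_diff_right)
    then have "convex hull (insert ?a F) \<subseteq> {y. ?\<nu> \<bullet> y \<ge> ?\<nu> \<bullet> ?a}"
      by (intro hull_minimal convex_halfspace_ge) auto
    then show ?thesis using that T(3) by blast
  qed
  have nn: "?\<nu> \<bullet> ?\<nu> = 1" using N(1) by (simp add: dot_square_norm)
  have "?\<nu> \<bullet> (x + r *\<^sub>R ?\<nu>) \<le> ?\<nu> \<bullet> x0"
    using N(2) x0 \<open>x + r *\<^sub>R ?\<nu> \<in> T\<close> by (force simp: inner_diff_right)
  moreover have "?\<nu> \<bullet> ?a \<le> ?\<nu> \<bullet> (x - r *\<^sub>R ?\<nu>)" by (rule low) fact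
  ultimately show "2 * r \<le> facet_height T F"
    unfolding facet_height(1)[OF assms x0, symmetric]
    by (simp add: inner_diff_right inner_add_right nn)
qed

lemma simplex_as_cone:
  fixes T :: "(real^'n) set"
  assumes "int CARD('n) simplex T" "F facet_of T" "y \<in> T"
  obtains t f where "0 \<le> t" "t \<le> 1" "f \<in> F" "y = (1 - t) *\<^sub>R opposite_vertex T F + t *\<^sub>R f"
proof -
  note F = facet_props[OF assms(1,2)]
  have "y \<in> convex hull (insert (opposite_vertex T F) F)" using opposite_vertex(3)[OF assms(1,2)] assms(3) by simp
  then obtain u v b where "0 \<le> u" "0 \<le> v" "u + v = 1" "b \<in> convex hull F"
      "y = u *\<^sub>R opposite_vertex T F + v *\<^sub>R b"
    unfolding convex_hull_insert[OF F(3)] by blast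
  moreover have "convex hull F = F" using F(1) by (simp add: convex_hull_eq)
  moreover have "u = 1 - v" using \<open>u + v = 1\<close> by simp
  ultimately show ?thesis using that[of v b] by auto
qed

text \<open>
  In dimension at least two, a ball has a diameter parallel to \<open>F\<close>. Its end points have the same height over
  \<open>F\<close>, so the central projection from the opposite vertex maps them to two points of \<open>F\<close> whose distance is
  not smaller.
\<close>

lemma inball_diameter_le_facet_diameter:
  fixes T :: "(real^'n) set"
  assumes "CARD('n) \<ge> 2" "int CARD('n) simplex T" "F facet_of T"
  shows "inball_diameter T \<le> diameter F"
proof (rule inball_diameter_le)
  note T = opposite_vertex[OF assms(2,3)] and F = facet_props[OF assms(2,3)]
    and N = outer_normal[OF assms(2,3)]
  let ?\<nu> = "outer_normal T F" and ?a = "opposite_vertex T F" and ?h = "facet_height T F"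
  show "T \<noteq> {}" using F by blast
  fix r x assume r: "0 \<le> r" and sub: "cball x r \<subseteq> T"
  have "2 \<le> DIM(real^'n)" using assms(1) by simp
  then obtain e0 where e0: "e0 \<noteq> 0" "orthogonal ?\<nu> e0" using orthogonal_to_vector_exists by blast
  define e where "e = e0 /\<^sub>R norm e0"
  have e: "norm e = 1" "?\<nu> \<bullet> e = 0" using e0 by (simp_all add: e_def orthogonal_def)
  have "x + r *\<^sub>R e \<in> T" "x - r *\<^sub>R e \<in> T" using sub r e(1) by (auto simp: subset_iff dist_norm)
  then obtain t f t' f' where
    tf: "0 \<le> t" "t \<le> 1" "f \<in> F" "x + r *\<^sub>R e = (1 - t) *\<^sub>R ?a + t *\<^sub>R f" and
    tf': "0 \<le> t'" "t' \<le> 1" "f' \<in> F" "x - r *\<^sub>R e = (1 - t') *\<^sub>R ?a + t' *\<^sub>R f'"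
    using simplex_as_cone[OF assms(2,3)] by metis
  have lev: "?\<nu> \<bullet> ((1 - t) *\<^sub>R ?a + t *\<^sub>R f) = ?\<nu> \<bullet> ?a + t * ?h" if "f \<in> F" for t f
    unfolding facet_height(1)[OF assms(2,3) that, symmetric]
    by (simp add: inner_add_right inner_diff_right algebra_simps)
  have "?\<nu> \<bullet> (x + r *\<^sub>R e) = ?\<nu> \<bullet> (x - r *\<^sub>R e)" using e(2) by (simp add: inner_add_right inner_diff_right)
  then have "t * ?h = t' * ?h" using lev tf tf' by simp
  then have tt: "t' = t" using facet_height(2)[OF assms(2,3)] by simp
  have "(2 * r) *\<^sub>R e = (x + r *\<^sub>R e) - (x - r *\<^sub>R e)" by (simp add: algebra_simps flip: scaleR_2)
  also have "\<dots> = t *\<^sub>R (f - f')" unfolding tf(4) tf'(4) tt by (simp add: algebra_simps)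
  finally have "norm ((2 * r) *\<^sub>R e) = norm (t *\<^sub>R (f - f'))" by (rule arg_cong)
  then have "2 * r = t * norm (f - f')" using r e(1) tf(1) by simp
  also have "\<dots> \<le> norm (f - f')" using tf(2) by (simp add: mult_left_le_one_le tf(1))
  also have "\<dots> \<le> diameter F"
    using diameter_bounded_bound[of F f f'] tf(3) tf'(3) F(2) by (simp add: dist_norm compact_imp_bounded)
  finally show "2 * r \<le> diameter F" .
qed

text \<open>
  The vector \<open>e\<close> is a positive multiple of the direction to the opposite vertex plus a vector \<open>w\<close> tangential to
  \<open>F\<close>. A short step along \<open>w\<close> from a point of the relative interior remains in \<open>F\<close>, and the step towards the
  vertex is a convex combination.
\<close>

lemma enter_through_facet:
  fixes T :: "(real^'n) set"
  assumes "int CARD('n) simplex T" "F facet_of T" and y: "y \<in> rel_interior F"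
    and e: "e \<bullet> outer_normal T F < 0"
  obtains \<delta> where "0 < \<delta>" "\<And>s. 0 < s \<Longrightarrow> s \<le> \<delta> \<Longrightarrow> y + s *\<^sub>R e \<in> T"
proof -
  note T = opposite_vertex[OF assms(1,2)] and F = facet_props[OF assms(1,2)]
    and N = outer_normal[OF assms(1,2)] and H = facet_height[OF assms(1,2)]
  let ?\<nu> = "outer_normal T F" and ?a = "opposite_vertex T F" and ?h = "facet_height T F"
  have yF: "y \<in> F" using y rel_interior_subset by blast
  define \<alpha> where "\<alpha> = - (e \<bullet> ?\<nu>) / ?h"
  have \<alpha>: "\<alpha> > 0" using e H(2) by (simp add: \<alpha>_def divide_neg_pos)
  \<comment> \<open>The choice of \<open>\<alpha>\<close> makes the remainder \<open>w\<close> tangential to \<open>F\<close>.\<close>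
  define w where "w = e - \<alpha> *\<^sub>R (?a - y)"
  have w: "?\<nu> \<bullet> w = 0"
  proof -
    have "?\<nu> \<bullet> w = e \<bullet> ?\<nu> + \<alpha> * (?\<nu> \<bullet> (y - ?a))"
      by (simp add: w_def inner_diff_right inner_add_right inner_commute algebra_simps)
    then show ?thesis using H(1)[OF yF] H(2) by (simp add: \<alpha>_def)
  qed
  have nz: "?\<nu> \<noteq> 0" using N(1) by auto
  obtain \<epsilon> where \<epsilon>: "\<epsilon> > 0" "ball y \<epsilon> \<inter> affine hull F \<subseteq> F" using y by (auto simp: mem_rel_interior_ball)
  have near: "y + c *\<^sub>R w \<in> F" if "norm (c *\<^sub>R w) < \<epsilon>" for c
  proof -
    have "y + c *\<^sub>R w \<in> affine hull F"
      unfolding facet_hyperplane[OF assms(1,2) nz N(3) yF] using w by (simp add: inner_add_right)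
    then show ?thesis using \<epsilon>(2) that by (auto simp: subset_iff dist_norm)
  qed
  define \<delta> where "\<delta> = min (1 / (2 * \<alpha>)) (\<epsilon> / (4 * (norm w + 1)))"
  have d0: "0 < \<delta>" using \<alpha> \<epsilon>(1) by (simp add: \<delta>_def add_nonneg_pos)
  moreover have "y + s *\<^sub>R e \<in> T" if s: "0 < s" "s \<le> \<delta>" for s
  proof -
    have "s \<le> 1 / (2 * \<alpha>)" using s by (simp add: \<delta>_def)
    then have sa: "s * \<alpha> \<le> 1 / 2" using \<alpha> by (simp add: field_simps)
    define c where "c = s / (1 - s * \<alpha>)"
    have c: "0 \<le> c" "c \<le> 2 * s" using s sa by (auto simp: c_def field_simps)
    have "norm (c *\<^sub>R w) \<le> 2 * s * (norm w + 1)" using c s by (simp add: mult_mono)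
    also have "\<dots> \<le> 2 * (\<epsilon> / (4 * (norm w + 1))) * (norm w + 1)"
      using s by (intro mult_right_mono mult_left_mono) (auto simp: \<delta>_def)
    also have "\<dots> = \<epsilon> / 2" by (simp add: field_simps add_nonneg_eq_0_iff)
    also have "\<dots> < \<epsilon>" using \<epsilon> by simp
    finally have in_T: "y + c *\<^sub>R w \<in> T" using near F(4) by blast
    have "y + s *\<^sub>R e = (1 - s * \<alpha>) *\<^sub>R (y + c *\<^sub>R w) + (s * \<alpha>) *\<^sub>R ?a"
    proof -
      have "(1 - s * \<alpha>) *\<^sub>R (c *\<^sub>R w) = s *\<^sub>R w" using sa by (simp add: c_def)
      then show ?thesis by (simp add: w_def algebra_simps)
    qed
    then show ?thesis
      using convexD[OF simplex_props(1)[OF assms(1)] in_T T(1), of "1 - s * \<alpha>" "s * \<alpha>"] sa s \<alpha> by simp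
  qed
  ultimately show ?thesis using that by blast
qed

lemma triangulation_disjoint_interiors:
  fixes \<T> :: "(real^'n) set set"
  assumes "triangulation \<T>" "T \<in> \<T>" "T' \<in> \<T>" "T \<noteq> T'"
  shows "interior T \<inter> interior T' = {}"
proof -
  have f: "(T \<inter> T') face_of T" "(T \<inter> T') face_of T'"
    using assms unfolding triangulation_def by (blast, metis Int_commute)
  have "interior T \<inter> interior T' \<subseteq> T \<inter> T'" using interior_subset by blast
  moreover consider "T \<inter> T' \<noteq> T" | "T \<inter> T' \<noteq> T'" using assms(4) by blast
  then have "(T \<inter> T') \<inter> interior T = {} \<or> (T \<inter> T') \<inter> interior T' = {}"
    using face_of_disjoint_interior f by metis
  ultimately show ?thesis by blast
qed

text \<open>
  Otherwise both elements lie on the same side of \<open>F\<close>. Then \<open>T \<inter> T'\<close> contains \<open>F\<close> and a point off the hyperplane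
  of \<open>F\<close>, so it has interior points, against \<open>triangulation_disjoint_interiors\<close>.
\<close>

lemma shared_facet_opposite_normals:
  fixes \<T> :: "(real^'n) set set"
  assumes tr: "triangulation \<T>" and T: "T \<in> \<T>" "int CARD('n) simplex T" "F facet_of T"
    and T': "T' \<in> \<T>" "int CARD('n) simplex T'" "F facet_of T'" and "T \<noteq> T'"
  shows "outer_normal T' F = - outer_normal T F"
proof (rule ccontr)
  assume ne: "outer_normal T' F \<noteq> - outer_normal T F"
  note N = outer_normal[OF T(2,3)] and N' = outer_normal[OF T'(2,3)]
  let ?\<nu> = "outer_normal T F"
  have "(?\<nu> \<bullet> outer_normal T' F)\<^sup>2 = 1" "outer_normal T' F = (?\<nu> \<bullet> outer_normal T' F) *\<^sub>R ?\<nu>"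
    using unit_normals_parallel[OF T(2,3) N'(1,3) N(1,3)] by auto
  then have eq: "outer_normal T' F = ?\<nu>" using ne by (auto simp: power2_eq_1_iff)
  have nn: "?\<nu> \<bullet> ?\<nu> = 1" using N(1) by (simp add: dot_square_norm)
  have "rel_interior F \<noteq> {}" using facet_props[OF T(2,3)] rel_interior_eq_empty by blast
  then obtain y where y: "y \<in> rel_interior F" by blast
  have yF: "y \<in> F" using y rel_interior_subset by blast
  obtain d where d: "0 < d" "\<And>s. 0 < s \<Longrightarrow> s \<le> d \<Longrightarrow> y + s *\<^sub>R (- ?\<nu>) \<in> T"
    using enter_through_facet[OF T(2,3) y, of "- ?\<nu>"] nn by auto
  obtain d' where d': "0 < d'" "\<And>s. 0 < s \<Longrightarrow> s \<le> d' \<Longrightarrow> y + s *\<^sub>R (- ?\<nu>) \<in> T'"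
    using enter_through_facet[OF T'(2,3) y, of "- ?\<nu>"] nn eq by auto
  define s where "s = min d d'"
  have s: "0 < s" "y + s *\<^sub>R (- ?\<nu>) \<in> T \<inter> T'" using d d' by (auto simp: s_def)
  have "interior (T \<inter> T') = {}" using triangulation_disjoint_interiors[OF tr T(1) T'(1) \<open>T \<noteq> T'\<close>] by simp
  moreover have "convex (T \<inter> T')" using simplex_props(1) T T' convex_Int by blast
  ultimately obtain a b where ab: "a \<noteq> 0" "T \<inter> T' \<subseteq> {x. a \<bullet> x = b}"
    using empty_interior_subset_hyperplane by blast
  have FT: "F \<subseteq> T \<inter> T'" using facet_of_imp_subset T T' by blast
  have o: "\<forall>x\<in>F. \<forall>y\<in>F. a \<bullet> (y - x) = 0" using ab FT by (auto simp: inner_diff_right subset_iff)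
  have o': "\<forall>x\<in>F. \<forall>y\<in>F. (a /\<^sub>R norm a) \<bullet> (y - x) = 0" using o by simp
  have "(?\<nu> \<bullet> (a /\<^sub>R norm a))\<^sup>2 = 1"
    by (rule unit_normals_parallel[OF T(2,3) _ o' N(1,3)]) (use ab in simp)
  then have "?\<nu> \<bullet> a \<noteq> 0" by auto
  moreover have "a \<bullet> (y + s *\<^sub>R (- ?\<nu>)) = b" "a \<bullet> y = b" using ab s yF FT by blast+
  ultimately show False using s(1) by (simp add: inner_diff_right inner_commute)
qed

section \<open>The volume of a simplex over one of its facets\<close>

definition prism :: "'a::real_vector \<Rightarrow> 'a set \<Rightarrow> 'a set" where
  "prism v F = {x + t *\<^sub>R v | x t. x \<in> F \<and> 0 \<le> t \<and> t \<le> 1}"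

lemma mem_prism: "y \<in> prism v F \<longleftrightarrow> (\<exists>x\<in>F. \<exists>t\<in>{0..1}. y = x + t *\<^sub>R v)"
  by (simp add: prism_def Bex_def) blast

lemma prism_linear_image:
  assumes "linear f" shows "f ` prism v F = prism (f v) (f ` F)"
proof (rule set_eqI)
  fix y
  have "y \<in> f ` prism v F \<longleftrightarrow> (\<exists>x\<in>F. \<exists>t\<in>{0..1}. y = f (x + t *\<^sub>R v))"
    unfolding image_iff Bex_def mem_prism by blast
  also have "\<dots> \<longleftrightarrow> y \<in> prism (f v) (f ` F)"
    unfolding mem_prism linear_add[OF assms] linear_scale[OF assms] by blast
  finally show "y \<in> f ` prism v F \<longleftrightarrow> y \<in> prism (f v) (f ` F)" .
qed

lemma prism_translation: "prism v ((\<lambda>x. x - a) ` F) = (\<lambda>x. x - a) ` prism v F"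
proof (rule set_eqI)
  fix y
  have *: "(x - a) + t *\<^sub>R v = (x + t *\<^sub>R v) - a" for x t by simp
  have "y \<in> prism v ((\<lambda>x. x - a) ` F) \<longleftrightarrow> (\<exists>x\<in>F. \<exists>t\<in>{0..1}. y = (x + t *\<^sub>R v) - a)"
    unfolding mem_prism *[symmetric] by blast
  also have "\<dots> \<longleftrightarrow> y \<in> (\<lambda>x. x - a) ` prism v F" unfolding image_iff Bex_def mem_prism by blast
  finally show "y \<in> prism v ((\<lambda>x. x - a) ` F) \<longleftrightarrow> y \<in> (\<lambda>x. x - a) ` prism v F" .
qed

lemma prism_eq_image: "prism v F = (\<lambda>z. fst z + snd z *\<^sub>R v) ` (F \<times> {0..1})"
  by (rule set_eqI) (simp add: mem_prism image_iff split_paired_Bex_Sigma)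

lemma compact_prism: "compact F \<Longrightarrow> compact (prism v F)" for F :: "'a::real_normed_vector set"
  unfolding prism_eq_image
  by (intro compact_continuous_image compact_Times continuous_intros) auto

lemma convex_prism:
  assumes "convex F" shows "convex (prism v F)"
proof (rule convexI)
  fix p q u w :: real and P Q
  assume a: "P \<in> prism v F" "Q \<in> prism v F" "0 \<le> u" "0 \<le> w" "u + w = 1"
  then obtain x t y s where x: "P = x + t *\<^sub>R v" "x \<in> F" "0 \<le> t" "t \<le> 1"
    and y: "Q = y + s *\<^sub>R v" "y \<in> F" "0 \<le> s" "s \<le> 1" by (auto simp: prism_def)
  have "u *\<^sub>R P + w *\<^sub>R Q = (u *\<^sub>R x + w *\<^sub>R y) + (u * t + w * s) *\<^sub>R v"
    by (simp add: x y algebra_simps)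
  moreover have "u *\<^sub>R x + w *\<^sub>R y \<in> F" using assms x y a by (intro convexD) auto
  moreover have "u * t + w * s \<le> 1" using convex_bound_le[OF x(4) y(4) a(3,4,5)] .
  moreover have "0 \<le> u * t + w * s" using a x y by simp
  ultimately show "u *\<^sub>R P + w *\<^sub>R Q \<in> prism v F" unfolding prism_def by blast
qed

text \<open>
  A copy of the index type with a well-order, as it is assumed in the determinant formula for the volume
  of a linear image. Lemma \<open>measure_reindex\<close> transports volumes between the two index types.
\<close>

typedef ('n::finite) ranked = "{..<CARD('n)}"
  morphisms rank_of of_rank
  by (rule exI[of _ 0]) simp

lemma card_ranked: "CARD('n::finite ranked) = CARD('n)" and finite_ranked: "finite (UNIV :: 'n::finite ranked set)"
proof -
  interpret type_definition "rank_of :: 'n ranked \<Rightarrow> nat" of_rank "{..<CARD('n)}"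
    by (rule type_definition_ranked)
  show "CARD('n ranked) = CARD('n)" using card by simp
  show "finite (UNIV :: 'n ranked set)" unfolding univ by simp
qed

instantiation ranked :: (finite) "{finite, wellorder}"
begin
definition less_eq_ranked :: "'a ranked \<Rightarrow> 'a ranked \<Rightarrow> bool" where "x \<le> y \<longleftrightarrow> rank_of x \<le> rank_of y"
definition less_ranked :: "'a ranked \<Rightarrow> 'a ranked \<Rightarrow> bool" where "x < y \<longleftrightarrow> rank_of x < rank_of y"
instance
proof
  fix P :: "'a ranked \<Rightarrow> bool" and a :: "'a ranked"
  assume *: "\<And>x. (\<And>y. y < x \<Longrightarrow> P y) \<Longrightarrow> P x"
  show "P a" by (rule measure_induct_rule[of rank_of]) (rule *, simp add: less_ranked_def)
qed (auto simp: less_eq_ranked_def less_ranked_def rank_of_inject finite_ranked)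
end

lemma prod_Basis_vec: "(\<Prod>b\<in>Basis. f (b::real^'n)) = (\<Prod>i\<in>UNIV. f (axis i 1))"
proof -
  have b: "(Basis::(real^'n) set) = range (\<lambda>i. axis i 1)" by (auto simp: Basis_vec_def)
  have "inj (\<lambda>i::'n. axis i (1::real))" by (auto simp: inj_on_def axis_eq_axis)
  then show ?thesis unfolding b by (subst prod.reindex) (auto simp: o_def)
qed

lemma measure_reindex:
  fixes j :: "'m::finite \<Rightarrow> 'n::finite" and S :: "(real^'n) set"
  assumes j: "bij j" and S: "S \<in> sets borel"
  shows "measure lborel ((\<lambda>x. \<chi> i. x $ j i) ` S) = measure lborel S"
proof -
  define J where "J = (\<lambda>x::real^'n. (\<chi> i. x $ j i) :: real^'m)"
  define J' where "J' = (\<lambda>x::real^'m. (\<chi> i. x $ inv j i) :: real^'n)"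
  have J'J: "J' (J x) = x" for x using j by (simp add: J_def J'_def vec_eq_iff bij_is_surj surj_f_inv_f)
  have JJ': "J (J' x) = x" for x using j by (simp add: J_def J'_def vec_eq_iff bij_is_inj)
  have meas: "J' \<in> borel_measurable borel" unfolding J'_def
    by (intro borel_measurable_continuous_onI continuous_intros)
  have "lborel = distr (lborel :: (real^'m) measure) borel J'"
  proof (rule lborel_eqI)
    fix l u :: "real^'n" assume lu: "\<And>b. b \<in> Basis \<Longrightarrow> l \<bullet> b \<le> u \<bullet> b"
    have lu': "l $ i \<le> u $ i" for i using lu[of "axis i 1"] by (simp add: inner_axis axis_in_Basis_iff)
    have pre: "J' -` box l u = box (J l) (J u)"
    proof -
      have "(\<forall>i. l $ i < x $ inv j i \<and> x $ inv j i < u $ i) \<longleftrightarrow>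
            (\<forall>i. l $ j i < x $ i \<and> x $ i < u $ j i)" for x :: "real^'m"
        by (metis bij_inv_eq_iff j)
      then show ?thesis by (auto simp: mem_box_cart J_def J'_def)
    qed
    have "emeasure (distr lborel borel J') (box l u) = emeasure lborel (box (J l) (J u))"
      using meas by (subst emeasure_distr) (auto simp: pre)
    also have "\<dots> = (\<Prod>b\<in>Basis. (J u - J l) \<bullet> b)"
      by (rule emeasure_lborel_box) (use lu' in \<open>auto simp: Basis_vec_def inner_axis J_def\<close>)
    also have "(\<Prod>b\<in>Basis. (J u - J l) \<bullet> b) = (\<Prod>i\<in>UNIV. u $ j i - l $ j i)"
      by (simp add: prod_Basis_vec inner_axis J_def)
    also have "\<dots> = (\<Prod>i\<in>UNIV. u $ i - l $ i)"
      by (rule prod.reindex_bij_betw[OF j])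
    also have "\<dots> = (\<Prod>b\<in>Basis. (u - l) \<bullet> b)" by (simp add: prod_Basis_vec inner_axis)
    finally show "emeasure (distr lborel borel J') (box l u) = (\<Prod>b\<in>Basis. (u - l) \<bullet> b)" .
  qed simp
  then have "measure lborel S = measure (distr (lborel :: (real^'m) measure) borel J') S" by simp
  also have "\<dots> = measure lborel (J' -` S)" using meas S by (subst measure_distr) auto
  also have "J' -` S = J ` S" by (auto simp: J'J) (metis JJ' image_eqI)
  finally show ?thesis by (simp add: J_def)
qed

definition std_simplex :: "(real^'m) set" where
  "std_simplex = convex hull (insert 0 (range (\<lambda>i. axis i 1)))"

definition std_prism :: "'m \<Rightarrow> (real^'m) set" where
  "std_prism k = prism (axis k 1) (convex hull (insert 0 ((\<lambda>i. axis i 1) ` (- {k}))))"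

lemma compact_hull_finite: "finite S \<Longrightarrow> compact (convex hull S)" for S :: "'a::euclidean_space set"
  by (simp add: finite_imp_compact compact_convex_hull)

lemma std_volumes_pos:
  fixes k :: "'m::finite"
  shows "0 < measure lebesgue (std_simplex :: (real^'m) set)" "0 < measure lebesgue (std_prism k)"
proof -
  have b: "(Basis::(real^'m) set) = range (\<lambda>i. axis i 1)" by (auto simp: Basis_vec_def)
  have cS: "compact (std_simplex :: (real^'m) set)" unfolding std_simplex_def by (rule compact_hull_finite) simp
  have "measure lebesgue (std_simplex :: (real^'m) set) = measure lborel (convex hull (insert 0 Basis :: (real^'m) set))"
    unfolding b std_simplex_def[symmetric] using cS by (simp add: borel_compact)
  then show p: "0 < measure lebesgue (std_simplex :: (real^'m) set)" unfolding content_std_simplex by simp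
  let ?F = "convex hull (insert 0 ((\<lambda>i. axis i 1) ` (- {k}))) :: (real^'m) set"
  have cP: "compact (std_prism k)" unfolding std_prism_def by (intro compact_prism compact_hull_finite) simp
  have "std_simplex \<subseteq> std_prism k" unfolding std_simplex_def
  proof (rule hull_minimal)
    show "convex (std_prism k)" unfolding std_prism_def by (rule convex_prism) simp
    have F: "0 \<in> ?F" "\<And>i. i \<noteq> k \<Longrightarrow> axis i 1 \<in> ?F" by (auto intro!: hull_inc)
    have *: "x \<in> std_prism k" if "x \<in> ?F" for x
      using that unfolding std_prism_def prism_def by (force intro!: exI[of _ x] exI[of _ "0::real"])
    have "axis k 1 \<in> std_prism k"
      using F(1) unfolding std_prism_def prism_def by (force intro!: exI[of _ 0] exI[of _ "1::real"])
    then have "axis i 1 \<in> std_prism k" for i using * F(2) by (cases "i = k") auto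
    then show "insert 0 (range (\<lambda>i. axis i 1)) \<subseteq> std_prism k" using *[OF F(1)] by auto
  qed
  then have "measure lebesgue (std_simplex :: (real^'m) set) \<le> measure lebesgue (std_prism k)"
    using cS cP by (intro measure_mono_fmeasurable fmeasurableD lmeasurable_compact)
  then show "0 < measure lebesgue (std_prism k)" using p by simp
qed

text \<open>
  Simplex and prism are images of fixed bodies under linear maps whose matrices differ in one column:
  \<open>c k\<close> for the simplex, \<open>\<nu>\<close> for the prism. As \<open>c k - (\<nu> \<bullet> c k) \<nu>\<close> and all other columns are orthogonal to
  \<open>\<nu>\<close>, the determinant is unchanged if \<open>c k\<close> is replaced by \<open>(\<nu> \<bullet> c k) \<nu>\<close>.
\<close>

lemma corner_simplex_volume:
  fixes c :: "'m::{finite,wellorder} \<Rightarrow> (real, 'm) vec"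
  assumes \<nu>: "norm \<nu> = 1" and orth: "\<And>i. i \<noteq> k \<Longrightarrow> \<nu> \<bullet> c i = 0"
  shows "measure lebesgue (convex hull (insert 0 (range c))) * measure lebesgue (std_prism k) =
    \<bar>\<nu> \<bullet> c k\<bar> * measure lebesgue (std_simplex :: ((real, 'm) vec) set) *
      measure lebesgue (prism \<nu> (convex hull (insert 0 (c ` (- {k})))))"
proof -
  define M where "M = (\<lambda>c::'m \<Rightarrow> (real, 'm) vec. \<lambda>y::(real, 'm) vec. \<Sum>i\<in>UNIV. y $ i *\<^sub>R c i)"
  have lin: "linear (M c)" for c
    by (rule linearI) (simp_all add: M_def algebra_simps sum.distrib scaleR_sum_right)
  have Max: "M c (axis i 1) = c i" for c i
  proof -
    have "M c (axis i 1) = (\<Sum>j\<in>UNIV. if j = i then c j else 0)"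
      unfolding M_def by (rule sum.cong) (auto simp: axis_def)
    then show ?thesis by simp
  qed
  have det: "det (matrix (M c)) = det (\<chi> i. c i)" for c
  proof -
    have "matrix (M c) = transpose (\<chi> i. c i)" by (simp add: matrix_def transpose_def Max vec_eq_iff)
    then show ?thesis by simp
  qed
  define c' where "c' = c(k := \<nu>)"
  define w where "w = c k - (\<nu> \<bullet> c k) *\<^sub>R \<nu>"
  have nn: "\<nu> \<bullet> \<nu> = 1" using \<nu> by (simp add: dot_square_norm)
  have "det (\<chi> i. c i) = det (\<chi> i. if i = k then (\<nu> \<bullet> c k) *s \<nu> + w else c i)"
    by (rule arg_cong[of _ _ det]) (auto simp: vec_eq_iff w_def scalar_mult_eq_scaleR)
  also have "\<dots> = (\<nu> \<bullet> c k) * det (\<chi> i. if i = k then \<nu> else c i) + det (\<chi> i. if i = k then w else c i)"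
    by (simp add: det_row_add det_row_mul)
  also have "det (\<chi> i. if i = k then w else c i) = 0"
  proof (rule ccontr)
    let ?A = "\<chi> i. if i = k then w else c i"
    assume "det ?A \<noteq> 0"
    then have "inj ((*v) ?A)" using invertible_det_nz inj_matrix_vector_mult by blast
    moreover have "?A *v \<nu> = 0"
    proof -
      have "(if i = k then w else c i) \<bullet> \<nu> = 0" for i
        using orth by (auto simp: w_def inner_diff_left inner_diff_right nn inner_commute)
      then show ?thesis by (simp add: vec_eq_iff matrix_vector_mult_def inner_vec_def)
    qed
    ultimately have "\<nu> = 0" using injD[of "(*v) ?A" \<nu> 0] by simp
    then show False using \<nu> by simp
  qed
  also have "(\<chi> i. if i = k then \<nu> else c i) = (\<chi> i. c' i)" by (auto simp: vec_eq_iff c'_def)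
  finally have dc: "det (matrix (M c)) = (\<nu> \<bullet> c k) * det (matrix (M c'))" unfolding det by simp
  have cS: "(std_simplex :: ((real, 'm) vec) set) \<in> lmeasurable"
    unfolding std_simplex_def by (intro lmeasurable_compact compact_hull_finite) simp
  have cP: "std_prism k \<in> lmeasurable"
    unfolding std_prism_def by (intro lmeasurable_compact compact_prism compact_hull_finite) simp
  have "M c ` std_simplex = convex hull (insert 0 (range c))"
    unfolding std_simplex_def convex_hull_linear_image[OF lin]
    using linear_0[OF lin[of c]] by (simp add: image_image Max)
  then have 1: "measure lebesgue (convex hull (insert 0 (range c))) =
      \<bar>det (matrix (M c))\<bar> * measure lebesgue (std_simplex :: ((real, 'm) vec) set)"
    using measure_linear_image[OF lin[of c] cS] by simp
  have "M c' ` std_prism k = prism \<nu> (convex hull (insert 0 (c ` (- {k}))))"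
  proof -
    have "(\<lambda>i. M c' (axis i 1)) ` (- {k}) = c ` (- {k})" by (rule image_cong) (auto simp: Max c'_def)
    then show ?thesis
      unfolding std_prism_def prism_linear_image[OF lin] convex_hull_linear_image[OF lin]
      using linear_0[OF lin[of c']] by (simp add: image_image) (simp add: Max c'_def)
  qed
  then have 2: "measure lebesgue (prism \<nu> (convex hull (insert 0 (c ` (- {k}))))) =
      \<bar>det (matrix (M c'))\<bar> * measure lebesgue (std_prism k)"
    using measure_linear_image[OF lin[of c'] cP] by simp
  show ?thesis unfolding 1 2 dc by (simp add: abs_mult)
qed

text \<open>
  The ratio of the volume of a cone to the product of height and area of the base; its value is
  \<open>1 / CARD('n)\<close>.
\<close>

definition cone_ratio :: "'n::finite itself \<Rightarrow> real" where
  "cone_ratio _ = measure lebesgue (std_simplex :: (real^'n ranked) set) /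
     measure lebesgue (std_prism (undefined :: 'n ranked))"

lemma cone_ratio_pos: "0 < cone_ratio TYPE('n::finite)"
  unfolding cone_ratio_def by (intro divide_pos_pos std_volumes_pos)

text \<open>
  The vertices other than a chosen one \<open>x0\<close> in \<open>F\<close> become the columns of \<open>corner_simplex_volume\<close> after the
  translation by \<open>- x0\<close> and the passage to a well-ordered index type. The measure of the prism is the area
  of \<open>F\<close>.
\<close>

lemma simplex_volume:
  fixes T :: "(real^'n) set"
  assumes "int CARD('n) simplex T" "F facet_of T" and n: "norm n = 1" "\<forall>x\<in>F. \<forall>y\<in>F. n \<bullet> (y - x) = 0"
  shows "measure lebesgue T = cone_ratio TYPE('n) * facet_height T F * measure lebesgue (prism n F)"
proof -
  note V = opposite_vertex[OF assms(1,2)] and F = facet_props[OF assms(1,2)]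
    and N = outer_normal[OF assms(1,2)] and H = facet_height[OF assms(1,2)]
  let ?a = "opposite_vertex T F"
  define k :: "'n ranked" where "k = undefined"
  obtain C where C: "\<not> affine_dependent C" "T = convex hull C" "int (card C) = int CARD('n) + 1" "finite C"
    using assms(1) aff_independent_finite by (auto simp: simplex_def)
  obtain a where a: "a \<in> C" "F = convex hull (C - {a})"
    using assms(2) C facet_of_convex_hull_affine_independent by blast
  have "C - {a} \<noteq> {}" using F(3) unfolding a(2) by auto
  then obtain x0 where x0: "x0 \<in> C - {a}" by blast
  have x0F: "x0 \<in> F" using a(2) x0 by (simp add: hull_inc)
  define D where "D = C - {a} - {x0}"
  have "card D = CARD('n) - 1" using C(3,4) a(1) x0 by (simp add: D_def)
  moreover have "card (- {k}) = CARD('n) - 1" by (simp add: Compl_eq_Diff_UNIV card_Diff_singleton card_ranked)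
  ultimately obtain g where "bij_betw g (- {k}) D"
    using finite_same_card_bij[of "- {k}" D] C(4) by (auto simp: D_def)
  then have g: "g ` (- {k}) = D" by (rule bij_betw_imp_surj_on)
  obtain j :: "'n ranked \<Rightarrow> 'n" where j: "bij j"
    using finite_same_card_bij[of "UNIV :: 'n ranked set" "UNIV :: 'n set"] by (auto simp: card_ranked)
  define J where "J = (\<lambda>x::real^'n. (\<chi> i. x $ j i) :: real^'n ranked)"
  have lin: "linear J" by (rule linearI) (simp_all add: J_def vec_eq_iff)
  have inner: "J x \<bullet> J y = x \<bullet> y" for x y
    using sum.reindex_bij_betw[OF j, of "\<lambda>i. x $ i * y $ i"] by (simp add: J_def inner_vec_def)
  have meas: "measure lebesgue ((J \<circ> (\<lambda>x. x - x0)) ` S) = measure lebesgue S" if "compact S" for S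
  proof -
    have c: "compact ((\<lambda>x. x - x0) ` S)" using that by (intro compact_continuous_image continuous_intros)
    have cJ: "compact (J ` (\<lambda>x. x - x0) ` S)"
      using compact_continuous_image[OF linear_continuous_on[OF linear_conv_bounded_linear[THEN iffD1, OF lin]] c] .
    have "measure lborel (J ` (\<lambda>x. x - x0) ` S) = measure lborel ((\<lambda>x. x - x0) ` S)"
      unfolding J_def using c by (intro measure_reindex[OF j]) (simp add: borel_compact)
    moreover have "measure lebesgue ((\<lambda>x. x - x0) ` S) = measure lebesgue S" by (rule measure_translation_subtract)
    ultimately show ?thesis using c cJ unfolding image_comp[symmetric] by (simp add: borel_compact)
  qed
  define c where "c = (\<lambda>i. J ((if i = k then ?a else g i) - x0))"
  have hull: "(J \<circ> (\<lambda>x. x - x0)) ` (convex hull S) = convex hull ((J \<circ> (\<lambda>x. x - x0)) ` S)" for S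
  proof -
    have "(\<lambda>x. x - x0) ` (convex hull S) = convex hull ((\<lambda>x. x - x0) ` S)"
      using convex_hull_translation[of "- x0" S] by (simp cong: image_cong_simp)
    then show ?thesis unfolding image_comp[symmetric] using convex_hull_linear_image[OF lin] by metis
  qed
  have imF: "(J \<circ> (\<lambda>x. x - x0)) ` (C - {a}) = insert 0 (c ` (- {k}))"
  proof -
    have "C - {a} = insert x0 (g ` (- {k}))" unfolding g D_def using x0 by blast
    moreover have "c ` (- {k}) = (\<lambda>i. J (g i - x0)) ` (- {k})" by (rule image_cong) (auto simp: c_def)
    ultimately show ?thesis using linear_0[OF lin] by (simp add: image_image)
  qed
  have Fim: "(J \<circ> (\<lambda>x. x - x0)) ` F = convex hull (insert 0 (c ` (- {k})))"
    unfolding a(2) hull imF ..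
  have "T = convex hull (insert ?a (C - {a}))" using V(3) unfolding a(2) hull_insert[symmetric] .
  then have "(J \<circ> (\<lambda>x. x - x0)) ` T = convex hull ((J \<circ> (\<lambda>x. x - x0)) ` insert ?a (C - {a}))"
    using hull by metis
  also have "(J \<circ> (\<lambda>x. x - x0)) ` insert ?a (C - {a}) = insert 0 (range c)"
  proof -
    have "range c = insert (c k) (c ` (- {k}))" by auto
    then show ?thesis using imF by (auto simp: c_def)
  qed
  finally have Tim: "(J \<circ> (\<lambda>x. x - x0)) ` T = convex hull (insert 0 (range c))" .
  have Pim: "(J \<circ> (\<lambda>x. x - x0)) ` prism n F = prism (J n) (convex hull (insert 0 (c ` (- {k}))))"
    unfolding Fim[symmetric] image_comp[symmetric] prism_translation[symmetric] prism_linear_image[OF lin] ..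
  have J1: "norm (J n) = 1" using inner[of n n] n(1) by (simp add: norm_eq_sqrt_inner)
  have orth: "J n \<bullet> c i = 0" if "i \<noteq> k" for i
  proof -
    have "g i \<in> F" using g that a(2) by (auto simp: D_def intro!: hull_inc)
    then show ?thesis using n(2) x0F that by (simp add: c_def inner)
  qed
  have "(n \<bullet> outer_normal T F)\<^sup>2 = 1" "outer_normal T F = (n \<bullet> outer_normal T F) *\<^sub>R n"
    using unit_normals_parallel[OF assms(1,2) N(1,3) n] by auto
  then have "facet_height T F = \<bar>n \<bullet> (?a - x0)\<bar>"
  proof -
    assume *: "(n \<bullet> outer_normal T F)\<^sup>2 = 1" "outer_normal T F = (n \<bullet> outer_normal T F) *\<^sub>R n"
    have "facet_height T F = (n \<bullet> outer_normal T F) * (n \<bullet> (x0 - ?a))"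
      using H(1)[OF x0F] by (metis *(2) inner_scaleR_left)
    then have "\<bar>facet_height T F\<bar> = \<bar>n \<bullet> (x0 - ?a)\<bar>"
      using *(1) by (auto simp: abs_mult power2_eq_1_iff)
    then show ?thesis using H(2) by (simp add: inner_diff_right abs_minus_commute)
  qed
  then have hk: "\<bar>J n \<bullet> c k\<bar> = facet_height T F" by (simp add: c_def inner)
  have "measure lebesgue T * measure lebesgue (std_prism k) =
     facet_height T F * measure lebesgue (std_simplex :: (real^'n ranked) set) * measure lebesgue (prism n F)"
    using corner_simplex_volume[of "J n" k c, OF J1 orth]
      meas[OF simplex_props(2)[OF assms(1)]] meas[OF compact_prism[OF F(2)], of n]
    unfolding Tim Pim hk by simp
  then show ?thesis using std_volumes_pos(2)[of k] by (simp add: cone_ratio_def k_def field_simps)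
qed

section \<open>Integration over faces\<close>

lemma face_measure_prism:
  "face_measure \<nu> F = distr (lebesgue_on (prism \<nu> F)) (restrict_space borel F) (closest_point F)"
  by (simp add: face_measure_def prism_def)

lemma sets_face_measure: "sets (face_measure \<nu> F) = sets (restrict_space borel F)"
  by (simp add: face_measure_prism)

lemma space_face_measure: "space (face_measure \<nu> F) = F"
  by (simp add: face_measure_prism space_restrict_space)

lemma measurable_closest_point:
  fixes F :: "(real^'n) set"
  assumes "convex F" "compact F" "F \<noteq> {}"
  shows "closest_point F \<in> measurable (lebesgue_on (prism \<nu> F)) (restrict_space borel F)"
proof (rule measurable_restrict_space2)
  show "closest_point F \<in> space (lebesgue_on (prism \<nu> F)) \<rightarrow> F"
    using assms by (auto intro!: closest_point_in_set compact_imp_closed)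
  have "prism \<nu> F \<in> sets lebesgue"
    using lmeasurable_compact[OF compact_prism[OF assms(2)]] by (rule fmeasurableD)
  then show "closest_point F \<in> borel_measurable (lebesgue_on (prism \<nu> F))"
    using assms continuous_on_closest_point[of F "prism \<nu> F"]
    by (intro continuous_imp_measurable_on_sets_lebesgue) (auto simp: compact_imp_closed)
qed

lemma face_measure_total:
  fixes F :: "(real^'n) set"
  assumes "convex F" "compact F" "F \<noteq> {}"
  shows "finite_measure (face_measure \<nu> F)" "measure (face_measure \<nu> F) F = measure lebesgue (prism \<nu> F)"
proof -
  have P: "prism \<nu> F \<in> lmeasurable" by (intro lmeasurable_compact compact_prism assms)
  have f: "finite_measure (lebesgue_on (prism \<nu> F))"
    using P by (rule finite_measure_lebesgue_on)
  show "finite_measure (face_measure \<nu> F)" unfolding face_measure_prism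
    by (rule finite_measure.finite_measure_distr[OF f measurable_closest_point[OF assms]])
  have "F \<in> sets (restrict_space borel F)" by (metis sets.top space_restrict_space2 space_restrict_space inf_top.right_neutral space_borel)
  then have "measure (face_measure \<nu> F) F =
      measure (lebesgue_on (prism \<nu> F)) (closest_point F -` F \<inter> space (lebesgue_on (prism \<nu> F)))"
    unfolding face_measure_prism by (rule measure_distr[OF measurable_closest_point[OF assms]])
  also have "closest_point F -` F \<inter> space (lebesgue_on (prism \<nu> F)) = prism \<nu> F"
    using assms by (auto intro!: closest_point_in_set compact_imp_closed)
  also have "measure (lebesgue_on (prism \<nu> F)) (prism \<nu> F) = measure lebesgue (prism \<nu> F)"
    using P by (intro measure_restrict_space) auto
  finally show "measure (face_measure \<nu> F) F = measure lebesgue (prism \<nu> F)" .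
qed

lemma continuous_in_sqint_face:
  fixes F :: "(real^'n) set" and f :: "real^'n \<Rightarrow> 'b::euclidean_space"
  assumes F: "convex F" "compact F" "F \<noteq> {}" and f: "continuous_on F f"
  shows "f \<in> sqint (face_measure \<nu> F)"
proof -
  have "bounded (f ` F)" using compact_continuous_image[OF f F(2)] compact_imp_bounded by blast
  then obtain K where "\<forall>x\<in>F. norm (f x) \<le> K" by (auto simp: bounded_iff)
  moreover have "f \<in> borel_measurable (face_measure \<nu> F)"
    unfolding measurable_cong_sets[OF sets_face_measure refl]
    by (rule borel_measurable_continuous_on_restrict[OF f])
  ultimately show ?thesis
    using sqint_bounded[OF face_measure_total(1)[OF F]] space_face_measure by metis
qed

lemma face_ip_eq: "face_ip \<nu> F f g = ip (face_measure \<nu> F) f g" and L2_ip_eq: "L2_ip \<Omega> f g = ip (lebesgue_on \<Omega>) f g"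
  for f g :: "real^'n \<Rightarrow> 'b::euclidean_space"
  by (simp_all add: face_ip_def L2_ip_def ip_def)

lemma face_ip_const:
  fixes F :: "(real^'n) set" and a b :: "'b::euclidean_space"
  assumes "convex F" "compact F" "F \<noteq> {}" "\<And>x. x \<in> F \<Longrightarrow> f x = a" "\<And>x. x \<in> F \<Longrightarrow> g x = b"
  shows "face_ip \<nu> F f g = measure lebesgue (prism \<nu> F) * (a \<bullet> b)"
proof -
  interpret finite_measure "face_measure \<nu> F" by (rule face_measure_total[OF assms(1-3)])
  have "face_ip \<nu> F f g = (LINT x|face_measure \<nu> F. a \<bullet> b)"
    unfolding face_ip_def using assms(4,5)
    by (intro Bochner_Integration.integral_cong) (auto simp: space_face_measure)
  then show ?thesis using face_measure_total(2)[OF assms(1-3)] by (simp add: space_face_measure)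
qed

text \<open>
  The face measure charges every relatively open part of \<open>F\<close>: the points in the interior of the prism
  whose closest point \<open>y\<close> in \<open>F\<close> satisfies \<open>f y \<noteq> 0\<close> form a negligible open set, which is empty. By continuity
  \<open>f\<close> vanishes on \<open>F\<close>, as \<open>F\<close> is in the closure of that interior.
\<close>

lemma face_ip_self_zero:
  fixes F :: "(real^'n) set" and f :: "real^'n \<Rightarrow> 'b::euclidean_space"
  assumes F: "convex F" "compact F" "F \<noteq> {}" and f: "continuous_on F f"
    and int: "interior (prism \<nu> F) \<noteq> {}"
    and z: "face_ip \<nu> F f f = 0" and x: "x \<in> F"
  shows "f x = 0"
proof (rule ccontr)
  assume nz: "f x \<noteq> 0"
  let ?P = "prism \<nu> F" and ?M = "face_measure \<nu> F"
  have cF: "closed F" using F compact_imp_closed by blast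
  have "integrable ?M (\<lambda>y. f y \<bullet> f y)"
    using sqint_integrable continuous_in_sqint_face[OF F f] by blast
  then have "AE y in ?M. f y \<bullet> f y = 0"
    using integral_nonneg_eq_0_iff_AE[of ?M "\<lambda>y. f y \<bullet> f y"] z by (simp add: face_ip_def)
  then have "AE y in ?M. f y = 0" by simp
  moreover have "{y \<in> space (restrict_space borel F). f y = 0} \<in> sets (restrict_space borel F)"
    using borel_measurable_continuous_on_restrict[OF f] by measurable
  ultimately have "AE y in lebesgue_on ?P. f (closest_point F y) = 0"
    unfolding face_measure_prism by (subst (asm) AE_distr_iff[OF measurable_closest_point[OF F]]) auto
  then have "AE y in lebesgue. y \<in> ?P \<longrightarrow> f (closest_point F y) = 0"
    using fmeasurableD[OF lmeasurable_compact[OF compact_prism[OF F(2)]]]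
    by (subst (asm) AE_restrict_space_iff) auto
  then have neg: "negligible {y. \<not> (y \<in> ?P \<longrightarrow> f (closest_point F y) = 0)}"
    by (simp add: eventually_ae_filter_negligible) (metis (mono_tags, lifting) mem_Collect_eq negligible_subset subsetI)
  define U where "U = {y \<in> interior ?P. f (closest_point F y) \<in> - {0}}"
  have "continuous_on (interior ?P) (\<lambda>y. f (closest_point F y))"
    by (rule continuous_on_compose2[OF f continuous_on_closest_point])
      (use F cF closest_point_in_set in auto)
  then have "open (interior ?P \<inter> (\<lambda>y. f (closest_point F y)) -` (- {0}))"
    by (rule continuous_open_preimage) auto
  also have "interior ?P \<inter> (\<lambda>y. f (closest_point F y)) -` (- {0}) = U" by (auto simp: U_def)
  finally have "open U" .
  moreover have "negligible U" using neg by (rule negligible_subset) (use interior_subset in \<open>auto simp: U_def\<close>)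
  ultimately have U: "U = {}" using open_not_negligible by blast
  have "x + 0 *\<^sub>R \<nu> \<in> ?P" using x unfolding mem_prism by force
  then have "x \<in> closure (interior ?P)"
    using convex_closure_interior[OF convex_prism[OF F(1)] int] closure_subset by auto
  moreover have "closest_point F x = x" using x by (rule closest_point_self)
  moreover have "continuous_on (closure (interior ?P)) (\<lambda>y. f (closest_point F y))"
    by (rule continuous_on_compose2[OF f continuous_on_closest_point])
      (use F cF closest_point_in_set in auto)
  then have "f (closest_point F y) = 0" if "y \<in> closure (interior ?P)" for y
    by (rule continuous_constant_on_closure) (use U that in \<open>auto simp: U_def\<close>)
  ultimately show False using nz by metis
qed

section \<open>Triangulated domains\<close>

locale mesh =
  fixes \<Omega> :: "(real^'n) set" and \<T> :: "(real^'n) set set" and n :: "(real^'n) set \<Rightarrow> real^'n"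
  assumes dim: "CARD('n) \<ge> 2" and Omega: "polytopal_domain \<Omega>"
    and mesh: "simplicial_mesh \<Omega> \<T>" and normals: "face_normals \<Omega> \<T> n"
begin

lemma triangulation: "triangulation \<T>" and finite_mesh: "finite \<T>"
  and simplex: "T \<in> \<T> \<Longrightarrow> int CARD('n) simplex T"
  and interior_in_Omega: "T \<in> \<T> \<Longrightarrow> interior T \<subseteq> \<Omega>"
  and Omega_lmeasurable: "\<Omega> \<in> lmeasurable" and mesh_nonempty: "\<T> \<noteq> {}"
proof -
  show tr: "triangulation \<T>" "T \<in> \<T> \<Longrightarrow> int CARD('n) simplex T" for T
    using mesh by (auto simp: simplicial_mesh_def)
  then show "finite \<T>" by (simp add: triangulation_def)
  have U: "\<Union>\<T> = closure \<Omega>" "\<Omega> = interior (closure \<Omega>)" "\<Omega> \<noteq> {}" "bounded \<Omega>" "open \<Omega>"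
    using mesh Omega by (auto simp: simplicial_mesh_def polytopal_domain_def)
  show "interior T \<subseteq> \<Omega>" if "T \<in> \<T>" for T
    using that U(1) interior_mono[of T "closure \<Omega>"] U(2) by blast
  show "\<Omega> \<in> lmeasurable" using U by (simp add: lmeasurable_open)
  show "\<T> \<noteq> {}" using U by auto
qed

lemma disjoint_interiors: "T \<in> \<T> \<Longrightarrow> T' \<in> \<T> \<Longrightarrow> x \<in> interior T \<Longrightarrow> x \<in> interior T' \<Longrightarrow> T = T'"
  using triangulation_disjoint_interiors[OF triangulation] by blast

lemma mesh_faces_eq: "mesh_faces \<T> = (\<Union>T\<in>\<T>. {F. F facet_of T})"
  by (auto simp: mesh_faces_def)

lemma finite_faces: "finite (mesh_faces \<T>)"
  unfolding mesh_faces_eq using finite_mesh simplex_facets_finite(1)[OF simplex] by blast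

lemma mesh_faceI: "T \<in> \<T> \<Longrightarrow> F facet_of T \<Longrightarrow> F \<in> mesh_faces \<T>"
  by (auto simp: mesh_faces_def)

lemma mesh_face:
  assumes "F \<in> mesh_faces \<T>"
  shows "convex F" "compact F" "F \<noteq> {}" "norm (n F) = 1" "\<forall>x\<in>F. \<forall>y\<in>F. n F \<bullet> (y - x) = 0"
proof -
  obtain T where T: "T \<in> \<T>" "F facet_of T" using assms by (auto simp: mesh_faces_def)
  show "convex F" "compact F" "F \<noteq> {}" using facet_props(1-3)[OF simplex[OF T(1)] T(2)] .
  show "norm (n F) = 1" "\<forall>x\<in>F. \<forall>y\<in>F. n F \<bullet> (y - x) = 0"
    using normals assms unfolding face_normals_def by blast+
qed

definition face_sign :: "(real^'n) set \<Rightarrow> (real^'n) set \<Rightarrow> real" where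
  "face_sign T F = n F \<bullet> outer_normal T F"

lemma face_sign:
  assumes "T \<in> \<T>" "F facet_of T"
  shows "(face_sign T F)\<^sup>2 = 1" "outer_normal T F = face_sign T F *\<^sub>R n F" "n F = face_sign T F *\<^sub>R outer_normal T F"
proof -
  note f = mesh_face[OF mesh_faceI[OF assms]] and N = outer_normal[OF simplex[OF assms(1)] assms(2)]
  show "(face_sign T F)\<^sup>2 = 1" "outer_normal T F = face_sign T F *\<^sub>R n F"
    using unit_normals_parallel[OF simplex[OF assms(1)] assms(2) N(1,3) f(4,5)] by (auto simp: face_sign_def)
  show "n F = face_sign T F *\<^sub>R outer_normal T F"
    using unit_normals_parallel(1)[OF simplex[OF assms(1)] assms(2) f(4,5) N(1,3)]
    by (simp add: face_sign_def inner_commute)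
qed

definition elems :: "(real^'n) set \<Rightarrow> (real^'n) set set" where
  "elems F = {T. T \<in> \<T> \<and> F facet_of T}"

lemma finite_elems: "finite (elems F)"
  using finite_mesh by (auto simp: elems_def intro: finite_subset[of _ \<T>])

lemma face_sign_inj: "T \<in> elems F \<Longrightarrow> T' \<in> elems F \<Longrightarrow> T \<noteq> T' \<Longrightarrow> face_sign T' F = - face_sign T F"
  using shared_facet_opposite_normals[OF triangulation, of T F T'] simplex[of T] simplex[of T']
  by (simp add: elems_def face_sign_def)

text \<open>
  Two elements with a common facet lie on different sides of it, so they are told apart by the sign of
  their outer normal.
\<close>

lemma card_elems: "card (elems F) \<le> 2"
proof -
  have "inj_on (\<lambda>T. face_sign T F) (elems F)"
  proof (rule inj_onI, rule ccontr)
    fix T T' assume a: "T \<in> elems F" "T' \<in> elems F" "face_sign T F = face_sign T' F" "T \<noteq> T'"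
    then have "(face_sign T F)\<^sup>2 = 1" using face_sign(1) by (auto simp: elems_def)
    moreover have "face_sign T F = 0" using face_sign_inj[OF a(1,2,4)] a(3) by linarith
    ultimately show False by simp
  qed
  then have "card (elems F) = card ((\<lambda>T. face_sign T F) ` elems F)" by (simp add: card_image)
  also have "\<dots> \<le> card {1, - 1 :: real}"
    using face_sign(1) by (intro card_mono) (auto simp: elems_def power2_eq_1_iff)
  also have "\<dots> = 2" by simp
  finally show ?thesis .
qed

lemma prism_volume_pos:
  assumes "F \<in> mesh_faces \<T>"
  shows "0 < measure lebesgue (prism (n F) F)" "interior (prism (n F) F) \<noteq> {}"
proof -
  obtain T where T: "T \<in> \<T>" "F facet_of T" using assms by (auto simp: mesh_faces_def)
  note s = simplex[OF T(1)] and f = mesh_face[OF assms]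
  have "\<not> negligible T" using simplex_props(1,5)[OF s] negligible_convex_interior by blast
  then have "0 < measure lebesgue T"
    using lmeasurable_compact[OF simplex_props(2)[OF s]]
    using negligible_iff_measure[of T] measure_nonneg[of lebesgue T] by linarith
  then show p: "0 < measure lebesgue (prism (n F) F)"
    unfolding simplex_volume[OF s T(2) f(4,5)]
    using cone_ratio_pos[where 'n = 'n] facet_height(2)[OF s T(2)] by (simp add: zero_less_mult_iff)
  then have "\<not> negligible (prism (n F) F)" using negligible_imp_measure0 by force
  then show "interior (prism (n F) F) \<noteq> {}"
    using negligible_convex_interior[OF convex_prism[OF f(1)]] by blast
qed

text \<open>
  Elementwise continuous functions with pieces that are continuous up to the boundary. This class contains
  both finite element spaces and all elementwise derivatives, and its members have traces on facets.
\<close>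

definition pcont :: "(real^'n \<Rightarrow> 'b::euclidean_space) set" where
  "pcont = piecewise \<T> {p. continuous_on UNIV p}"

lemma pcont_pieces:
  assumes "f \<in> pcont"
  obtains p where "\<And>T. T \<in> \<T> \<Longrightarrow> continuous_on UNIV (p T)" "\<And>T y. T \<in> \<T> \<Longrightarrow> y \<in> interior T \<Longrightarrow> f y = p T y"
proof -
  have "\<forall>T\<in>\<T>. \<exists>p. continuous_on UNIV p \<and> (\<forall>x\<in>interior T. f x = p x)"
    using assms by (auto simp: pcont_def piecewise_def)
  then show ?thesis using that by metis
qed

lemma pcont_sqint:
  fixes f :: "real^'n \<Rightarrow> 'b::euclidean_space"
  assumes "f \<in> pcont" shows "f \<in> sqint (lebesgue_on \<Omega>)"
proof -
  obtain p where p: "\<And>T. T \<in> \<T> \<Longrightarrow> continuous_on UNIV (p T)" "\<And>T y. T \<in> \<T> \<Longrightarrow> y \<in> interior T \<Longrightarrow> f y = p T y"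
    using pcont_pieces[OF assms] by blast
  have "\<exists>K\<ge>0. \<forall>x\<in>T. norm (p T x) \<le> K" if "T \<in> \<T>" for T
  proof -
    have "bounded (p T ` T)"
      using compact_continuous_image[OF continuous_on_subset[OF p(1)[OF that]] simplex_props(2)[OF simplex[OF that]]]
      by (simp add: compact_imp_bounded)
    then show ?thesis by (auto simp: bounded_pos) (meson less_imp_le)
  qed
  then obtain K where K: "\<And>T. T \<in> \<T> \<Longrightarrow> K T \<ge> 0" "\<And>T x. T \<in> \<T> \<Longrightarrow> x \<in> T \<Longrightarrow> norm (p T x) \<le> K T"
    by metis
  have f: "f x = (\<Sum>T\<in>\<T>. indicator (interior T) x *\<^sub>R p T x)" for x
  proof (cases "x \<in> (\<Union>T\<in>\<T>. interior T)")
    case True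
    then obtain T where T: "T \<in> \<T>" "x \<in> interior T" by blast
    have "(\<Sum>T'\<in>\<T>. indicator (interior T') x *\<^sub>R p T' x) = (\<Sum>T'\<in>{T}. indicator (interior T') x *\<^sub>R p T' x)"
      using T disjoint_interiors finite_mesh by (intro sum.mono_neutral_right) (auto simp: indicator_def)
    then show ?thesis using T p(2) by simp
  next
    case False
    then have "f x = 0" using assms by (auto simp: pcont_def piecewise_def)
    moreover have "(\<Sum>T\<in>\<T>. indicator (interior T) x *\<^sub>R p T x) = 0"
      using False by (intro sum.neutral) auto
    ultimately show ?thesis by simp
  qed
  show ?thesis
  proof (rule sqint_bounded)
    show "finite_measure (lebesgue_on \<Omega>)" using Omega_lmeasurable by (rule finite_measure_lebesgue_on)
    have "(\<lambda>x. \<Sum>T\<in>\<T>. indicator (interior T) x *\<^sub>R p T x) \<in> borel_measurable borel"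
    proof (rule borel_measurable_sum)
      fix T assume "T \<in> \<T>"
      then have "p T \<in> borel_measurable borel" using p(1) borel_measurable_continuous_onI by blast
      then show "(\<lambda>x. indicator (interior T) x *\<^sub>R p T x) \<in> borel_measurable borel"
        by (intro borel_measurable_scaleR borel_measurable_indicator) auto
    qed
    then have "f \<in> borel_measurable lborel" unfolding f[abs_def] by simp
    then show "f \<in> borel_measurable (lebesgue_on \<Omega>)"
      by (intro measurable_restrict_space1 measurable_completion)
    fix x
    have "norm (f x) \<le> (\<Sum>T\<in>\<T>. norm (indicator (interior T) x *\<^sub>R p T x))" unfolding f by (rule norm_sum)
    also have "\<dots> \<le> (\<Sum>T\<in>\<T>. K T)"
    proof (rule sum_mono)
      fix T assume T: "T \<in> \<T>"
      then show "norm (indicator (interior T) x *\<^sub>R p T x) \<le> K T"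
        using K(1)[OF T] K(2)[OF T, of x] interior_subset[of T] by (cases "x \<in> interior T") auto
    qed
    finally show "norm (f x) \<le> (\<Sum>T\<in>\<T>. K T)" .
  qed
qed

text \<open>
  The boundary of an element is negligible, so that the open elements carry the full volume.
\<close>

lemma integral_piecewise_const:
  fixes K :: "(real^'n) set \<Rightarrow> real"
  shows "integrable (lebesgue_on \<Omega>) (\<lambda>x. \<Sum>T\<in>\<T>. indicator (interior T) x * K T)"
    "(LINT x|lebesgue_on \<Omega>. (\<Sum>T\<in>\<T>. indicator (interior T) x * K T)) = (\<Sum>T\<in>\<T>. measure lebesgue T * K T)"
proof -
  have M: "measure (lebesgue_on \<Omega>) (interior T) = measure lebesgue T" "interior T \<in> sets (lebesgue_on \<Omega>)"
    if "T \<in> \<T>" for T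
  proof -
    note s = simplex_props[OF simplex[OF that]]
    have "measure (lebesgue_on \<Omega>) (interior T) = measure lebesgue (interior T)"
      using interior_in_Omega[OF that] Omega_lmeasurable by (intro measure_restrict_space) (auto simp: fmeasurableD)
    also have "\<dots> = measure lebesgue T"
      using s by (intro measure_interior negligible_convex_frontier compact_imp_bounded)
    finally show "measure (lebesgue_on \<Omega>) (interior T) = measure lebesgue T" .
    show "interior T \<in> sets (lebesgue_on \<Omega>)"
      using interior_in_Omega[OF that] Omega_lmeasurable by (subst sets_restrict_space_iff) (auto simp: fmeasurableD)
  qed
  interpret finite_measure "lebesgue_on \<Omega>" using Omega_lmeasurable by (rule finite_measure_lebesgue_on)
  have i: "integrable (lebesgue_on \<Omega>) (\<lambda>x. indicator (interior T) x * K T)" if "T \<in> \<T>" for T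
    using M(2)[OF that] by (intro integrable_mult_left integrable_real_indicator) (auto simp: emeasure_finite less_top[symmetric])
  then show "integrable (lebesgue_on \<Omega>) (\<lambda>x. \<Sum>T\<in>\<T>. indicator (interior T) x * K T)" by simp
  have "(LINT x|lebesgue_on \<Omega>. (\<Sum>T\<in>\<T>. indicator (interior T) x * K T)) =
      (\<Sum>T\<in>\<T>. LINT x|lebesgue_on \<Omega>. indicator (interior T) x * K T)"
    using i by (rule Bochner_Integration.integral_sum)
  also have "\<dots> = (\<Sum>T\<in>\<T>. measure lebesgue T * K T)"
  proof (rule sum.cong[OF refl])
    fix T assume T: "T \<in> \<T>"
    have "interior T \<inter> space (lebesgue_on \<Omega>) = interior T" using interior_in_Omega[OF T] by auto
    then show "(LINT x|lebesgue_on \<Omega>. indicator (interior T) x * K T) = measure lebesgue T * K T"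
      using M[OF T] by simp
  qed
  finally show "(LINT x|lebesgue_on \<Omega>. (\<Sum>T\<in>\<T>. indicator (interior T) x * K T)) = (\<Sum>T\<in>\<T>. measure lebesgue T * K T)" .
qed

lemma piecewise_sum:
  assumes "\<And>x. x \<notin> (\<Union>T\<in>\<T>. interior T) \<Longrightarrow> h x = 0"
  shows "h x = (\<Sum>T\<in>\<T>. indicator (interior T) x * (h x :: real))"
proof (cases "x \<in> (\<Union>T\<in>\<T>. interior T)")
  case True
  then obtain T where T: "T \<in> \<T>" "x \<in> interior T" by blast
  have "(\<Sum>T'\<in>\<T>. indicator (interior T') x * h x) = (\<Sum>T'\<in>{T}. indicator (interior T') x * h x)"
    using T disjoint_interiors finite_mesh by (intro sum.mono_neutral_right) (auto simp: indicator_def)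
  then show ?thesis using T by simp
qed (use assms in simp)

text \<open>
  As the representatives vanish off the open elements, the integral over the domain is exactly a sum over
  the elements.
\<close>

lemma L2_ip_piecewise_const:
  fixes f g :: "real^'n \<Rightarrow> 'b::euclidean_space"
  assumes "\<And>x. x \<notin> (\<Union>T\<in>\<T>. interior T) \<Longrightarrow> f x = 0"
    and "\<And>T x. T \<in> \<T> \<Longrightarrow> x \<in> interior T \<Longrightarrow> f x \<bullet> g x = K T"
  shows "L2_ip \<Omega> f g = (\<Sum>T\<in>\<T>. measure lebesgue T * K T)"
proof -
  have "f x \<bullet> g x = (\<Sum>T\<in>\<T>. indicator (interior T) x * K T)" for x
  proof -
    have "f x \<bullet> g x = (\<Sum>T\<in>\<T>. indicator (interior T) x * (f x \<bullet> g x))"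
      by (rule piecewise_sum) (use assms(1) in auto)
    also have "\<dots> = (\<Sum>T\<in>\<T>. indicator (interior T) x * K T)"
      using assms(2) by (intro sum.cong) (auto simp: indicator_def)
    finally show ?thesis .
  qed
  then show ?thesis unfolding L2_ip_def using integral_piecewise_const(2) by simp
qed

lemma L2_ip_piecewise_le:
  fixes f g :: "real^'n \<Rightarrow> 'b::euclidean_space"
  assumes "f \<in> pcont" "g \<in> pcont"
    and "\<And>T x. T \<in> \<T> \<Longrightarrow> x \<in> interior T \<Longrightarrow> f x \<bullet> g x \<le> K T"
  shows "L2_ip \<Omega> f g \<le> (\<Sum>T\<in>\<T>. measure lebesgue T * K T)"
proof -
  have "f x \<bullet> g x \<le> (\<Sum>T\<in>\<T>. indicator (interior T) x * K T)" for x
  proof -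
    have "f x \<bullet> g x = (\<Sum>T\<in>\<T>. indicator (interior T) x * (f x \<bullet> g x))"
      by (rule piecewise_sum) (use assms(1) in \<open>auto simp: pcont_def piecewise_def\<close>)
    also have "\<dots> \<le> (\<Sum>T\<in>\<T>. indicator (interior T) x * K T)"
      using assms(3) by (intro sum_mono) (auto simp: indicator_def)
    finally show ?thesis .
  qed
  then have "L2_ip \<Omega> f g \<le> (LINT x|lebesgue_on \<Omega>. (\<Sum>T\<in>\<T>. indicator (interior T) x * K T))"
    unfolding L2_ip_def using sqint_integrable[OF pcont_sqint[OF assms(1)] pcont_sqint[OF assms(2)]]
    by (intro integral_mono integral_piecewise_const(1))
  then show ?thesis using integral_piecewise_const(2) by simp
qed

lemma elem_trace_eq:
  assumes "T \<in> \<T>" "continuous_on UNIV p" "\<And>y. y \<in> interior T \<Longrightarrow> g y = p y" "x \<in> T"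
  shows "elem_trace T g x = p x"
proof -
  have "x \<in> closure (interior T)" using simplex_props(6)[OF simplex[OF assms(1)]] assms(4) by simp
  then have "x islimpt interior T"
    using interior_limit_point[of x "interior T"] by (auto simp: closure_def)
  then have nt: "at x within interior T \<noteq> bot" by (simp add: trivial_limit_within)
  have "(p \<longlongrightarrow> p x) (at x within interior T)"
    using assms(2) by (meson UNIV_I continuous_on tendsto_within_subset top_greatest)
  moreover have "\<forall>\<^sub>F y in at x within interior T. p y = g y"
    using assms(3) by (auto simp: eventually_at_filter)
  ultimately have "(g \<longlongrightarrow> p x) (at x within interior T)" using Lim_transform_eventually by blast
  then show ?thesis unfolding elem_trace_def using tendsto_Lim[OF nt] by blast
qed

lemma jump_eq:
  assumes "\<And>T. T \<in> \<T> \<Longrightarrow> continuous_on UNIV (p T)" "\<And>T y. T \<in> \<T> \<Longrightarrow> y \<in> interior T \<Longrightarrow> g y = p T y" "x \<in> F"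
  shows "jump \<T> n F g x = (\<Sum>T\<in>elems F. face_sign T F *\<^sub>R p T x)"
proof -
  have "elem_trace T g x = p T x" if "T \<in> elems F" for T
    using that assms facet_of_imp_subset[of F T] by (intro elem_trace_eq) (auto simp: elems_def)
  then show ?thesis unfolding jump_def elems_def[symmetric] by (intro sum.cong) (auto simp: face_sign_def)
qed

lemma jump_lin:
  assumes f: "f \<in> pcont" and g: "g \<in> pcont" and x: "x \<in> F"
  shows "jump \<T> n F (\<lambda>y. f y + c *\<^sub>R g y) x = jump \<T> n F f x + c *\<^sub>R jump \<T> n F g x"
proof -
  obtain p where p: "\<And>T. T \<in> \<T> \<Longrightarrow> continuous_on UNIV (p T)" "\<And>T y. T \<in> \<T> \<Longrightarrow> y \<in> interior T \<Longrightarrow> f y = p T y"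
    using pcont_pieces[OF f] by blast
  obtain q where q: "\<And>T. T \<in> \<T> \<Longrightarrow> continuous_on UNIV (q T)" "\<And>T y. T \<in> \<T> \<Longrightarrow> y \<in> interior T \<Longrightarrow> g y = q T y"
    using pcont_pieces[OF g] by blast
  have "jump \<T> n F (\<lambda>y. f y + c *\<^sub>R g y) x = (\<Sum>T\<in>elems F. face_sign T F *\<^sub>R (p T x + c *\<^sub>R q T x))"
    using p q x by (intro jump_eq[where p = "\<lambda>T y. p T y + c *\<^sub>R q T y"]) (auto intro!: continuous_intros)
  also have "\<dots> = (\<Sum>T\<in>elems F. face_sign T F *\<^sub>R p T x) + c *\<^sub>R (\<Sum>T\<in>elems F. face_sign T F *\<^sub>R q T x)"
    by (simp add: scaleR_add_right sum.distrib scaleR_sum_right mult.commute)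
  finally show ?thesis using jump_eq[OF p x] jump_eq[OF q x] by simp
qed

lemma jump_continuous:
  assumes "f \<in> pcont" shows "continuous_on F (jump \<T> n F f)"
proof -
  obtain p where p: "\<And>T. T \<in> \<T> \<Longrightarrow> continuous_on UNIV (p T)" "\<And>T y. T \<in> \<T> \<Longrightarrow> y \<in> interior T \<Longrightarrow> f y = p T y"
    using pcont_pieces[OF assms] by blast
  have "continuous_on F (\<lambda>x. \<Sum>T\<in>elems F. face_sign T F *\<^sub>R p T x)"
    using p(1) by (intro continuous_intros) (auto simp: elems_def intro: continuous_on_subset)
  then show ?thesis by (rule continuous_on_eq) (use jump_eq[OF p] in simp)
qed

lemma jump_sqint:
  assumes "f \<in> pcont" "F \<in> mesh_faces \<T>" shows "jump \<T> n F f \<in> sqint (face_measure (n F) F)"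
  using continuous_in_sqint_face[OF mesh_face(1-3)[OF assms(2)] jump_continuous[OF assms(1)]] .

definition lin_map :: "(real^'n \<Rightarrow> 'b::real_vector) set \<Rightarrow> ((real^'n \<Rightarrow> 'b) \<Rightarrow> real^'n \<Rightarrow> 'c::euclidean_space) \<Rightarrow> bool" where
  "lin_map X D \<longleftrightarrow> (\<forall>f\<in>X. D f \<in> pcont) \<and>
     (\<forall>f\<in>X. \<forall>g\<in>X. \<forall>c. D (\<lambda>y. f y + c *\<^sub>R g y) = (\<lambda>x. D f x + c *\<^sub>R D g x))"

lemma lin_op_L2: "lin_map X D \<Longrightarrow> lin_op X (lebesgue_on \<Omega>) D"
  by (simp add: lin_map_def lin_op_def pcont_sqint)

lemma lin_op_jump:
  assumes "lin_map X D" "F \<in> mesh_faces \<T>"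
  shows "lin_op X (face_measure (n F) F) (\<lambda>f. jump \<T> n F (D f))"
  unfolding lin_op_def space_face_measure
proof (intro conjI ballI allI)
  fix f g c x assume "f \<in> X" "g \<in> X" "x \<in> F"
  then show "jump \<T> n F (D (\<lambda>y. f y + c *\<^sub>R g y)) x = jump \<T> n F (D f) x + c *\<^sub>R jump \<T> n F (D g) x"
    using assms(1) by (simp add: lin_map_def jump_lin)
qed (use assms jump_sqint in \<open>auto simp: lin_map_def\<close>)

end

section \<open>Third-order tensors and derivatives of affine fields\<close>

lemma partial_deriv_eq:
  assumes "(p has_derivative p') (at x)" "open S" "x \<in> S" "\<And>y. y \<in> S \<Longrightarrow> f y = p y"
  shows "partial_deriv k f x = p' (axis k 1)"
proof -
  have "(f has_derivative p') (at x)"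
    using has_derivative_transform_within_open[OF assms(1-3)] assms(4) by metis
  then show ?thesis using frechet_derivative_at unfolding partial_deriv_def by metis
qed

definition sym_part :: "real^'n^'n \<Rightarrow> real^'n^'n" where
  "sym_part A = (\<chi> i j. (A $ i $ j + A $ j $ i) / 2)"

lemma affine_derivatives:
  fixes v :: "real^'n \<Rightarrow> real^'n"
  assumes "open S" "x \<in> S" "\<And>y. y \<in> S \<Longrightarrow> v y = A *v y + b"
  shows "sym_grad v x = sym_part A" "vec_div v x = trace A"
    "stress \<mu> lam v x = (2 * \<mu>) *\<^sub>R sym_part A + (lam * trace A) *\<^sub>R mat 1"
proof -
  have d: "((\<lambda>y. A *v y + b) has_derivative (\<lambda>y. A *v y)) (at x)"
    by (auto intro!: derivative_eq_intros bounded_linear_imp_has_derivative matrix_vector_mul_bounded_linear)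
  have p: "partial_deriv k v x = column k A" for k
    using partial_deriv_eq[OF d assms] matrix_vector_mul_component by (simp add: matrix_vector_mult_basis)
  show s: "sym_grad v x = sym_part A" "vec_div v x = trace A"
    by (simp_all add: sym_grad_def sym_part_def vec_div_def trace_def p column_def)
  show "stress \<mu> lam v x = (2 * \<mu>) *\<^sub>R sym_part A + (lam * trace A) *\<^sub>R mat 1"
    by (simp add: stress_def s)
qed

lemma tens_outer_lin:
  "tens_outer \<tau> (x + y) = tens_outer \<tau> x + tens_outer \<tau> y" "tens_outer \<tau> (c *\<^sub>R x) = c *\<^sub>R tens_outer \<tau> x"
  "tens_outer (\<tau> + \<sigma>) x = tens_outer \<tau> x + tens_outer \<sigma> x" "tens_outer (c *\<^sub>R \<tau>) x = c *\<^sub>R tens_outer \<tau> x"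
  by (simp_all add: tens_outer_def vec_eq_iff algebra_simps)

lemma linear_tens_outer: "linear (tens_outer \<tau>)" "linear (\<lambda>\<tau>. tens_outer \<tau> x)"
  by (auto intro!: linearI simp: tens_outer_lin)

lemma tens_div_affine:
  fixes \<Psi> :: "real^'n \<Rightarrow> real^'n^'n^'n"
  assumes "open S" "x \<in> S" "\<And>y. y \<in> S \<Longrightarrow> \<Psi> y = \<Psi>0 + tens_outer \<tau> y"
  shows "tens_div \<Psi> x = real CARD('n) *\<^sub>R \<tau>"
proof -
  have d: "((\<lambda>y. \<Psi>0 + tens_outer \<tau> y) has_derivative tens_outer \<tau>) (at x)"
    using linear_tens_outer(1)[of \<tau>]
    by (auto intro!: derivative_eq_intros bounded_linear_imp_has_derivative simp: linear_conv_bounded_linear)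
  have "partial_deriv k \<Psi> x $ i $ j $ k = \<tau> $ i $ j" for i j k
    using partial_deriv_eq[OF d assms] by (simp add: tens_outer_def)
  then show ?thesis by (simp add: tens_div_def vec_eq_iff)
qed

lemma linear_sym_part: "linear sym_part"
  by (rule linearI) (simp_all add: sym_part_def vec_eq_iff algebra_simps add_divide_distrib)

lemma linear_trace: "linear (trace :: real^'n^'n \<Rightarrow> real)"
  by (rule linearI) (simp_all add: trace_def sum.distrib sum_distrib_left)

definition dev_tens :: "real^'n^'n^'n \<Rightarrow> real^'n^'n^'n" where
  "dev_tens \<Psi> = \<Psi> - (1 / real CARD('n)) *\<^sub>R tens_outer (mat 1) (tens_tr \<Psi>)"

lemma linear_tens_tr: "linear tens_tr"
  by (rule linearI) (simp_all add: tens_tr_def vec_eq_iff sum.distrib sum_distrib_left)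

lemma linear_dev_tens: "linear dev_tens"
  by (rule linearI)
    (simp_all add: dev_tens_def linear_add[OF linear_tens_tr] linear_scale[OF linear_tens_tr] tens_outer_lin algebra_simps)

lemma linear_compliance: "linear (compliance \<mu> lam)"
  by (rule linearI)
    (simp_all add: compliance_def linear_add[OF linear_tens_tr] linear_scale[OF linear_tens_tr] tens_outer_lin algebra_simps)

lemma tens_outer_inner: "tens_outer \<tau> v \<bullet> \<Psi> = (\<Sum>i\<in>UNIV. \<Sum>j\<in>UNIV. \<tau> $ i $ j * (\<Psi> $ i $ j \<bullet> v))"
  by (simp add: inner_vec_def tens_outer_def sum_distrib_left algebra_simps)

lemma mat1_outer_inner: "tens_outer (mat 1) v \<bullet> \<Psi> = v \<bullet> tens_tr \<Psi>"
proof -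
  have "tens_outer (mat 1) v \<bullet> \<Psi> = (\<Sum>i\<in>UNIV. \<Sum>j\<in>UNIV. if j = i then \<Psi> $ i $ j \<bullet> v else 0)"
    unfolding tens_outer_inner by (intro sum.cong) (auto simp: mat_def)
  also have "\<dots> = (\<Sum>i\<in>UNIV. \<Psi> $ i $ i \<bullet> v)" by simp
  also have "\<dots> = (\<Sum>i\<in>UNIV. \<Sum>k\<in>UNIV. \<Psi> $ i $ i $ k * v $ k)" by (simp add: inner_vec_def)
  also have "\<dots> = (\<Sum>k\<in>UNIV. \<Sum>i\<in>UNIV. \<Psi> $ i $ i $ k * v $ k)" by (rule sum.swap)
  also have "\<dots> = v \<bullet> tens_tr \<Psi>" by (simp add: inner_vec_def tens_tr_def sum_distrib_left mult.commute)
  finally show ?thesis .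
qed

lemma tens_tr_mat1: "tens_tr (tens_outer (mat 1 :: real^'n^'n) v) = real CARD('n) *\<^sub>R v"
  by (simp add: tens_tr_def tens_outer_def mat_def vec_eq_iff)

text \<open>
  The splitting of a tensor into its deviator and its trace part diagonalizes the compliance, with two
  positive weights. This gives semidefiniteness and definiteness at once, for every \<open>lam > 0\<close>.
\<close>

lemma compliance_inner:
  fixes \<Phi> \<Psi> :: "real^'n^'n^'n"
  assumes "\<mu> > 0" "lam > 0"
  shows "compliance \<mu> lam \<Phi> \<bullet> \<Psi> = 1 / (2 * \<mu>) * (dev_tens \<Phi> \<bullet> dev_tens \<Psi>) +
    1 / (real CARD('n) * (2 * \<mu> + real CARD('n) * lam)) * (tens_tr \<Phi> \<bullet> tens_tr \<Psi>)"
proof -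
  let ?d = "real CARD('n)" and ?t = "tens_tr \<Phi> \<bullet> tens_tr \<Psi>"
  have d: "?d > 0" by simp
  have p: "2 * \<mu> + ?d * lam > 0" using assms d by (simp add: add_pos_pos)
  have 1: "compliance \<mu> lam \<Phi> \<bullet> \<Psi> = 1 / (2 * \<mu>) * (\<Phi> \<bullet> \<Psi> - lam / (2 * \<mu> + ?d * lam) * ?t)"
    by (simp add: compliance_def inner_diff_left mat1_outer_inner)
  have "dev_tens \<Phi> \<bullet> dev_tens \<Psi> = \<Phi> \<bullet> \<Psi> - 1 / ?d * ?t - 1 / ?d * ?t + 1 / ?d * (1 / ?d) * (?d * ?t)"
    unfolding dev_tens_def inner_diff_left inner_diff_right inner_scaleR_left inner_scaleR_right
      mat1_outer_inner tens_tr_mat1 inner_commute[of \<Phi> "tens_outer _ _"]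
    by (simp add: inner_commute)
  then have 2: "dev_tens \<Phi> \<bullet> dev_tens \<Psi> = \<Phi> \<bullet> \<Psi> - ?t / ?d" using d by simp
  have "1 / (2 * \<mu>) * (x - lam / (2 * \<mu> + ?d * lam) * t) =
      1 / (2 * \<mu>) * (x - t / ?d) + 1 / (?d * (2 * \<mu> + ?d * lam)) * t" for x t
    using assms p d by (simp add: divide_simps) (simp add: algebra_simps)
  then show ?thesis unfolding 1 2 .
qed

lemma mat1_inner_trace: "(mat 1 :: real^'n^'n) \<bullet> A = trace A"
proof -
  have "(mat 1 :: real^'n^'n) \<bullet> A = (\<Sum>i\<in>UNIV. \<Sum>j\<in>UNIV. if j = i then A $ i $ i else 0)"
    unfolding inner_vec_def by (intro sum.cong) (auto simp: mat_def)
  then show ?thesis by (simp add: trace_def)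
qed

lemma trace_sym_part: "trace (sym_part A) = trace A"
  by (simp add: trace_def sym_part_def)

lemma tens_vec_lin:
  "tens_vec (\<Psi> + c *\<^sub>R \<Phi>) w = tens_vec \<Psi> w + c *\<^sub>R tens_vec \<Phi> w"
  by (simp add: tens_vec_def vec_eq_iff sum.distrib sum_distrib_left algebra_simps)

lemma linear_tens_vec: "linear (\<lambda>\<Psi>. tens_vec \<Psi> w)"
  by (rule linearI) (simp_all add: tens_vec_def vec_eq_iff sum.distrib sum_distrib_left algebra_simps)

section \<open>The finite element spaces\<close>

context mesh
begin

text \<open>
  The fields of \<open>V_h\<close> before the condition on the jumps is imposed; likewise \<open>S_h\<close> for \<open>Sigma_h\<close>. The energy
  forms are semidefinite already on these larger spaces.
\<close>

definition W_h :: "(real^'n \<Rightarrow> real^'n) set" where "W_h = piecewise \<T> P1_vec"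
definition S_h :: "(real^'n \<Rightarrow> real^'n^'n^'n) set" where "S_h = piecewise \<T> Sigma_loc"

lemma W_pieces:
  assumes "v \<in> W_h"
  obtains A b where "\<And>T x. T \<in> \<T> \<Longrightarrow> x \<in> interior T \<Longrightarrow> v x = A T *v x + b T"
proof -
  have "\<exists>A b. \<forall>x\<in>interior T. v x = A *v x + b" if "T \<in> \<T>" for T
    using assms that by (fastforce simp: W_h_def piecewise_def P1_vec_def)
  then show ?thesis using that by metis
qed

lemma S_pieces:
  assumes "\<Psi> \<in> S_h"
  obtains P \<tau> where "\<And>T. T \<in> \<T> \<Longrightarrow> P T \<in> sym_tens" "\<And>T. T \<in> \<T> \<Longrightarrow> \<tau> T \<in> sym_mat"
    "\<And>T x. T \<in> \<T> \<Longrightarrow> x \<in> interior T \<Longrightarrow> \<Psi> x = P T + tens_outer (\<tau> T) x"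
proof -
  have "\<exists>P \<tau>. P \<in> sym_tens \<and> \<tau> \<in> sym_mat \<and> (\<forall>x\<in>interior T. \<Psi> x = P + tens_outer \<tau> x)" if "T \<in> \<T>" for T
    using assms that by (fastforce simp: S_h_def piecewise_def Sigma_loc_def)
  then show ?thesis using that by metis
qed

lemma lin_sub_W: "lin_sub W_h"
  unfolding lin_sub_def
proof (intro conjI ballI allI)
  have "(\<lambda>_. 0) \<in> P1_vec"
    unfolding P1_vec_def by (intro CollectI exI[of _ 0]) (simp add: fun_eq_iff)
  then show "(\<lambda>_. 0) \<in> W_h" unfolding W_h_def piecewise_def by auto
  fix f g c assume fg: "f \<in> W_h" "g \<in> W_h"
  obtain A b where f: "\<And>T x. T \<in> \<T> \<Longrightarrow> x \<in> interior T \<Longrightarrow> f x = A T *v x + b T" using W_pieces[OF fg(1)] by metis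
  obtain A' b' where g: "\<And>T x. T \<in> \<T> \<Longrightarrow> x \<in> interior T \<Longrightarrow> g x = A' T *v x + b' T" using W_pieces[OF fg(2)] by metis
  have "\<exists>p\<in>P1_vec. \<forall>x\<in>interior T. f x + c *\<^sub>R g x = p x" if "T \<in> \<T>" for T
  proof (rule bexI)
    show "\<forall>x\<in>interior T. f x + c *\<^sub>R g x = (A T + c *\<^sub>R A' T) *v x + (b T + c *\<^sub>R b' T)"
      using f[OF that] g[OF that]
      by (simp add: matrix_vector_mult_add_rdistrib scaleR_matrix_vector_assoc algebra_simps)
  qed (unfold P1_vec_def, blast)
  then show "(\<lambda>x. f x + c *\<^sub>R g x) \<in> W_h"
    using fg by (simp add: W_h_def piecewise_def)
qed

lemma lin_sub_S: "lin_sub S_h"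
  unfolding lin_sub_def
proof (intro conjI ballI allI)
  have "(\<lambda>x. 0) = (\<lambda>x. 0 + tens_outer 0 x)" by (simp add: fun_eq_iff tens_outer_def vec_eq_iff)
  moreover have "0 \<in> sym_tens" "0 \<in> sym_mat" by (simp_all add: sym_tens_def sym_mat_def)
  ultimately have "(\<lambda>_. 0) \<in> Sigma_loc" unfolding Sigma_loc_def by blast
  then show "(\<lambda>_. 0) \<in> S_h" unfolding S_h_def piecewise_def by auto
  fix f g c assume fg: "f \<in> S_h" "g \<in> S_h"
  obtain P \<tau> where f: "\<And>T. T \<in> \<T> \<Longrightarrow> P T \<in> sym_tens" "\<And>T. T \<in> \<T> \<Longrightarrow> \<tau> T \<in> sym_mat"
    "\<And>T x. T \<in> \<T> \<Longrightarrow> x \<in> interior T \<Longrightarrow> f x = P T + tens_outer (\<tau> T) x" using S_pieces[OF fg(1)] by metis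
  obtain P' \<tau>' where g: "\<And>T. T \<in> \<T> \<Longrightarrow> P' T \<in> sym_tens" "\<And>T. T \<in> \<T> \<Longrightarrow> \<tau>' T \<in> sym_mat"
    "\<And>T x. T \<in> \<T> \<Longrightarrow> x \<in> interior T \<Longrightarrow> g x = P' T + tens_outer (\<tau>' T) x" using S_pieces[OF fg(2)] by metis
  have "\<exists>p\<in>Sigma_loc. \<forall>x\<in>interior T. f x + c *\<^sub>R g x = p x" if "T \<in> \<T>" for T
  proof (rule bexI)
    show "\<forall>x\<in>interior T. f x + c *\<^sub>R g x = (P T + c *\<^sub>R P' T) + tens_outer (\<tau> T + c *\<^sub>R \<tau>' T) x"
      using f(3)[OF that] g(3)[OF that] by (simp add: tens_outer_lin algebra_simps)
    have "P T + c *\<^sub>R P' T \<in> sym_tens" "\<tau> T + c *\<^sub>R \<tau>' T \<in> sym_mat"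
      using f(1,2)[OF that] g(1,2)[OF that] unfolding sym_tens_def sym_mat_def by simp_all
    then show "(\<lambda>x. (P T + c *\<^sub>R P' T) + tens_outer (\<tau> T + c *\<^sub>R \<tau>' T) x) \<in> Sigma_loc"
      unfolding Sigma_loc_def by blast
  qed
  then show "(\<lambda>x. f x + c *\<^sub>R g x) \<in> S_h"
    using fg by (simp add: S_h_def piecewise_def)
qed

lemma piecewise_pcont: "P \<subseteq> {p. continuous_on UNIV p} \<Longrightarrow> piecewise \<T> P \<subseteq> pcont"
  unfolding pcont_def piecewise_def by blast

lemma W_pcont: "v \<in> W_h \<Longrightarrow> v \<in> pcont"
proof -
  have "continuous_on UNIV (\<lambda>x. A *v x + b)" for A :: "real^'n^'n" and b
    by (intro continuous_intros)
  then have "(P1_vec :: (real^'n \<Rightarrow> real^'n) set) \<subseteq> {p. continuous_on UNIV p}" by (auto simp: P1_vec_def)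
  then show "v \<in> W_h \<Longrightarrow> v \<in> pcont" using piecewise_pcont unfolding W_h_def by blast
qed

lemma S_pcont: "\<Psi> \<in> S_h \<Longrightarrow> \<Psi> \<in> pcont"
proof -
  have "continuous_on UNIV (\<lambda>x. P + tens_outer \<tau> x)" for P and \<tau> :: "real^'n^'n"
    using linear_tens_outer(1) by (intro continuous_intros linear_continuous_on) (simp add: linear_conv_bounded_linear)
  then have "Sigma_loc \<subseteq> {p :: real^'n \<Rightarrow> real^'n^'n^'n. continuous_on UNIV p}" by (auto simp: Sigma_loc_def)
  then show "\<Psi> \<in> S_h \<Longrightarrow> \<Psi> \<in> pcont" using piecewise_pcont unfolding S_h_def by blast
qed

lemma pcont_const_pieces:
  assumes "\<And>T x. T \<in> \<T> \<Longrightarrow> x \<in> interior T \<Longrightarrow> f x = a T"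
    "\<And>x. x \<notin> (\<Union>T\<in>\<T>. interior T) \<Longrightarrow> f x = 0"
  shows "f \<in> pcont"
  unfolding pcont_def piecewise_def
proof (intro CollectI conjI allI impI ballI)
  fix T assume "T \<in> \<T>"
  then show "\<exists>p\<in>{p. continuous_on UNIV p}. \<forall>x\<in>interior T. f x = p x"
    using assms(1) by (intro bexI[of _ "\<lambda>_. a T"]) auto
qed (rule assms(2))

text \<open>
  On an element the field is \<open>A x + b\<close>, so every homogeneous first order differential operator with
  constant coefficients is a linear function \<open>g\<close> of \<open>A\<close>.
\<close>

lemma lin_map_gradient:
  fixes D :: "(real^'n \<Rightarrow> real^'n) \<Rightarrow> real^'n \<Rightarrow> 'c::euclidean_space"
  assumes g: "linear g"
    and D: "\<And>v A b S x. open S \<Longrightarrow> x \<in> S \<Longrightarrow> (\<And>y. y \<in> S \<Longrightarrow> v y = A *v y + b) \<Longrightarrow> D v x = g A"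
  shows "lin_map W_h (\<lambda>v. elementwise \<T> (D v))"
proof -
  have *: "elementwise \<T> (D v) x = g (A T)"
    if "\<And>T x. T \<in> \<T> \<Longrightarrow> x \<in> interior T \<Longrightarrow> v x = A T *v x + b T" "T \<in> \<T>" "x \<in> interior T" for v A b T x
    using that D[of "interior T" x v "A T" "b T"] by (auto simp: elementwise_def)
  show ?thesis unfolding lin_map_def
  proof (intro conjI ballI allI ext)
    fix v assume "v \<in> W_h"
    then obtain A b where f: "\<And>T x. T \<in> \<T> \<Longrightarrow> x \<in> interior T \<Longrightarrow> v x = A T *v x + b T" using W_pieces by metis
    show "elementwise \<T> (D v) \<in> pcont"
      using *[OF f] by (rule pcont_const_pieces) (auto simp: elementwise_def)
  next
    fix v w c x assume vw: "v \<in> W_h" "w \<in> W_h"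
    obtain A b where f: "\<And>T x. T \<in> \<T> \<Longrightarrow> x \<in> interior T \<Longrightarrow> v x = A T *v x + b T" using W_pieces[OF vw(1)] by metis
    obtain A' b' where f': "\<And>T x. T \<in> \<T> \<Longrightarrow> x \<in> interior T \<Longrightarrow> w x = A' T *v x + b' T" using W_pieces[OF vw(2)] by metis
    have s: "v x + c *\<^sub>R w x = (A T + c *\<^sub>R A' T) *v x + (b T + c *\<^sub>R b' T)" if "T \<in> \<T>" "x \<in> interior T" for T x
      using f[OF that] f'[OF that]
      by (simp add: matrix_vector_mult_add_rdistrib scaleR_matrix_vector_assoc algebra_simps)
    show "elementwise \<T> (D (\<lambda>y. v y + c *\<^sub>R w y)) x = elementwise \<T> (D v) x + c *\<^sub>R elementwise \<T> (D w) x"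
    proof (cases "x \<in> (\<Union>T\<in>\<T>. interior T)")
      case True
      then obtain T where T: "T \<in> \<T>" "x \<in> interior T" by blast
      have e: "elementwise \<T> (D v) x = g (A T)" by (rule *[OF f T])
      have e': "elementwise \<T> (D w) x = g (A' T)" by (rule *[OF f' T])
      show ?thesis unfolding e e' using *[of "\<lambda>y. v y + c *\<^sub>R w y" "\<lambda>T. A T + c *\<^sub>R A' T" "\<lambda>T. b T + c *\<^sub>R b' T", OF s T]
        by (simp add: linear_add[OF g] linear_scale[OF g])
    qed (auto simp: elementwise_def)
  qed
qed

lemma lin_map_sym_grad: "lin_map W_h (\<lambda>v. elementwise \<T> (sym_grad v))"
  by (rule lin_map_gradient[OF linear_sym_part], rule affine_derivatives(1), assumption+)

lemma lin_map_vec_div: "lin_map W_h (\<lambda>v. elementwise \<T> (vec_div v))"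
  by (rule lin_map_gradient[OF linear_trace], rule affine_derivatives(2), assumption+)

lemma lin_map_tens_div: "lin_map S_h (\<lambda>\<Psi>. elementwise \<T> (tens_div \<Psi>))"
proof -
  have *: "elementwise \<T> (tens_div \<Psi>) x = real CARD('n) *\<^sub>R \<tau> T"
    if "\<And>T x. T \<in> \<T> \<Longrightarrow> x \<in> interior T \<Longrightarrow> \<Psi> x = P T + tens_outer (\<tau> T) x" "T \<in> \<T>" "x \<in> interior T" for \<Psi> P \<tau> T x
    using that tens_div_affine[of "interior T" x \<Psi> "P T" "\<tau> T"] by (auto simp: elementwise_def)
  show ?thesis unfolding lin_map_def
  proof (intro conjI ballI allI ext)
    fix \<Psi> assume "\<Psi> \<in> S_h"
    then obtain P \<tau> where f: "\<And>T x. T \<in> \<T> \<Longrightarrow> x \<in> interior T \<Longrightarrow> \<Psi> x = P T + tens_outer (\<tau> T) x" using S_pieces by metis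
    show "elementwise \<T> (tens_div \<Psi>) \<in> pcont"
      using *[OF f] by (rule pcont_const_pieces) (auto simp: elementwise_def)
  next
    fix v w c x assume vw: "v \<in> S_h" "w \<in> S_h"
    obtain P \<tau> where f: "\<And>T x. T \<in> \<T> \<Longrightarrow> x \<in> interior T \<Longrightarrow> v x = P T + tens_outer (\<tau> T) x" using S_pieces[OF vw(1)] by metis
    obtain P' \<tau>' where f': "\<And>T x. T \<in> \<T> \<Longrightarrow> x \<in> interior T \<Longrightarrow> w x = P' T + tens_outer (\<tau>' T) x" using S_pieces[OF vw(2)] by metis
    have s: "v x + c *\<^sub>R w x = (P T + c *\<^sub>R P' T) + tens_outer (\<tau> T + c *\<^sub>R \<tau>' T) x" if "T \<in> \<T>" "x \<in> interior T" for T x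
      using f[OF that] f'[OF that] by (simp add: tens_outer_lin algebra_simps)
    show "elementwise \<T> (tens_div (\<lambda>y. v y + c *\<^sub>R w y)) x = elementwise \<T> (tens_div v) x + c *\<^sub>R elementwise \<T> (tens_div w) x"
    proof (cases "x \<in> (\<Union>T\<in>\<T>. interior T)")
      case True
      then obtain T where T: "T \<in> \<T>" "x \<in> interior T" by blast
      have e: "elementwise \<T> (tens_div v) x = real CARD('n) *\<^sub>R \<tau> T" by (rule *[OF f T])
      have e': "elementwise \<T> (tens_div w) x = real CARD('n) *\<^sub>R \<tau>' T" by (rule *[OF f' T])
      show ?thesis unfolding e e'
        using *[of "\<lambda>y. v y + c *\<^sub>R w y" "\<lambda>T. P T + c *\<^sub>R P' T" "\<lambda>T. \<tau> T + c *\<^sub>R \<tau>' T", OF s T]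
        by (simp add: algebra_simps)
    qed (auto simp: elementwise_def)
  qed
qed

lemma lin_map_pointwise:
  assumes X: "X \<subseteq> pcont" and g: "linear g"
  shows "lin_map X (\<lambda>f x. g (f x))"
proof -
  have "(\<lambda>x. g (f x)) \<in> pcont" if "f \<in> X" for f
  proof -
    have "f \<in> pcont" using that X by blast
    have c: "continuous_on UNIV (\<lambda>x. g (p x))" if "continuous_on UNIV p" for p :: "real^'n \<Rightarrow> 'a"
      using linear_continuous_on[of g UNIV] g that
      by (simp add: linear_conv_bounded_linear continuous_on_compose2)
    obtain p where p: "\<And>T. T \<in> \<T> \<Longrightarrow> continuous_on UNIV (p T)" "\<And>T y. T \<in> \<T> \<Longrightarrow> y \<in> interior T \<Longrightarrow> f y = p T y"
      using pcont_pieces[OF \<open>f \<in> pcont\<close>] by blast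
    have "\<exists>q\<in>{p. continuous_on UNIV p}. \<forall>x\<in>interior T. g (f x) = q x" if "T \<in> \<T>" for T
      using c[OF p(1)[OF that]] p(2)[OF that] by (intro bexI[of _ "\<lambda>x. g (p T x)"]) auto
    then show ?thesis
      using \<open>f \<in> pcont\<close> linear_0[OF g] by (simp add: pcont_def piecewise_def)
  qed
  then show ?thesis using linear_add[OF g] linear_scale[OF g] by (simp add: lin_map_def)
qed

lemma lin_map_id: "X \<subseteq> pcont \<Longrightarrow> lin_map X (\<lambda>f. f)"
  by (auto simp: lin_map_def)

lemma V_sub: "V_h \<T> n \<subseteq> W_h" and Sigma_sub: "Sigma_h \<T> n \<subseteq> S_h"
  unfolding V_h_def W_h_def Sigma_h_def S_h_def by (rule Collect_restrict)+

lemma lin_sub_V: "lin_sub (V_h \<T> n)"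
  unfolding lin_sub_def
proof (intro conjI ballI allI)
  have eq: "(LINT x|face_measure (n F) F. jump \<T> n F (\<lambda>x. f x + c *\<^sub>R g x) x) =
      (LINT x|face_measure (n F) F. jump \<T> n F f x) + c *\<^sub>R (LINT x|face_measure (n F) F. jump \<T> n F g x)"
    if F: "F \<in> mesh_faces \<T>" and fg: "f \<in> W_h" "g \<in> W_h" for f g c F
  proof -
    have "finite_measure (face_measure (n F) F)" by (rule face_measure_total[OF mesh_face(1-3)[OF F]])
    then have i: "integrable (face_measure (n F) F) (jump \<T> n F h)" if "h \<in> W_h" for h
      using sqint_imp_integrable jump_sqint[OF W_pcont[OF that] F] by blast
    have "(LINT x|face_measure (n F) F. jump \<T> n F (\<lambda>x. f x + c *\<^sub>R g x) x) =
        (LINT x|face_measure (n F) F. jump \<T> n F f x + c *\<^sub>R jump \<T> n F g x)"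
      using jump_lin[OF W_pcont[OF fg(1)] W_pcont[OF fg(2)]]
      by (intro Bochner_Integration.integral_cong) (auto simp: space_face_measure)
    then show ?thesis using i[OF fg(1)] i[OF fg(2)] by simp
  qed
  have z: "(\<lambda>_. 0) \<in> W_h" using lin_sub_W by (simp add: lin_sub_def)
  have "(LINT x|face_measure (n F) F. jump \<T> n F (\<lambda>_. 0) x) = (0::real^'n)" if "F \<in> mesh_faces \<T>" for F
    using eq[OF that z z, of 1] by simp
  then show "(\<lambda>_. 0) \<in> V_h \<T> n" using z by (simp add: V_h_def W_h_def)
  fix f g c assume "f \<in> V_h \<T> n" "g \<in> V_h \<T> n"
  then show "(\<lambda>x. f x + c *\<^sub>R g x) \<in> V_h \<T> n"
    using eq V_sub lin_subD[OF lin_sub_W, of f g c] by (simp add: V_h_def W_h_def[symmetric])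
qed

lemma elem_trace_lin:
  assumes T: "T \<in> \<T>" and f: "f \<in> pcont" and g: "g \<in> pcont" and x: "x \<in> T"
  shows "elem_trace T (\<lambda>y. f y + c *\<^sub>R g y) x = elem_trace T f x + c *\<^sub>R elem_trace T g x"
proof -
  obtain p where p: "\<And>T. T \<in> \<T> \<Longrightarrow> continuous_on UNIV (p T)" "\<And>T y. T \<in> \<T> \<Longrightarrow> y \<in> interior T \<Longrightarrow> f y = p T y"
    using pcont_pieces[OF f] by blast
  obtain q where q: "\<And>T. T \<in> \<T> \<Longrightarrow> continuous_on UNIV (q T)" "\<And>T y. T \<in> \<T> \<Longrightarrow> y \<in> interior T \<Longrightarrow> g y = q T y"
    using pcont_pieces[OF g] by blast
  have "elem_trace T f x = p T x" by (rule elem_trace_eq[OF T p(1)[OF T] p(2)[OF T] x])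
  moreover have "elem_trace T g x = q T x" by (rule elem_trace_eq[OF T q(1)[OF T] q(2)[OF T] x])
  moreover have "elem_trace T (\<lambda>y. f y + c *\<^sub>R g y) x = p T x + c *\<^sub>R q T x"
    using p[OF T] q[OF T] by (intro elem_trace_eq[OF T _ _ x]) (auto intro!: continuous_intros)
  ultimately show ?thesis by simp
qed

lemma elem_trace_continuous:
  assumes T: "T \<in> \<T>" and f: "f \<in> pcont" shows "continuous_on T (elem_trace T f)"
proof -
  obtain p where p: "\<And>T. T \<in> \<T> \<Longrightarrow> continuous_on UNIV (p T)" "\<And>T y. T \<in> \<T> \<Longrightarrow> y \<in> interior T \<Longrightarrow> f y = p T y"
    using pcont_pieces[OF f] by blast
  have "continuous_on T (p T)" using p(1)[OF T] continuous_on_subset by blast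
  then show ?thesis by (rule continuous_on_eq) (rule elem_trace_eq[OF T p(1)[OF T] p(2)[OF T], symmetric])
qed

lemma normal_trace_lin_op:
  assumes T: "T \<in> \<T>" "F facet_of T"
  shows "lin_op S_h (face_measure (n F) F) (\<lambda>\<Psi> x. tens_vec (elem_trace T \<Psi> x) (n F))"
  unfolding lin_op_def space_face_measure
proof (intro conjI ballI allI)
  fix \<Psi> assume P: "\<Psi> \<in> S_h"
  have "continuous_on UNIV (\<lambda>\<Psi>. tens_vec \<Psi> (n F))"
    by (rule linear_continuous_on) (rule linear_tens_vec[unfolded linear_conv_bounded_linear])
  moreover have "continuous_on F (elem_trace T \<Psi>)"
    by (rule continuous_on_subset[OF elem_trace_continuous[OF T(1) S_pcont[OF P]] facet_of_imp_subset[OF T(2)]])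
  ultimately have "continuous_on F (\<lambda>x. tens_vec (elem_trace T \<Psi> x) (n F))"
    by (rule continuous_on_compose2) simp
  then show "(\<lambda>x. tens_vec (elem_trace T \<Psi> x) (n F)) \<in> sqint (face_measure (n F) F)"
    by (rule continuous_in_sqint_face[OF mesh_face(1-3)[OF mesh_faceI[OF T]]])
next
  fix \<Psi> \<Phi> c x assume P: "\<Psi> \<in> S_h" "\<Phi> \<in> S_h" and x: "x \<in> F"
  have "x \<in> T" using subsetD[OF facet_of_imp_subset[OF T(2)] x] .
  then show "tens_vec (elem_trace T (\<lambda>y. \<Psi> y + c *\<^sub>R \<Phi> y) x) (n F) =
       tens_vec (elem_trace T \<Psi> x) (n F) + c *\<^sub>R tens_vec (elem_trace T \<Phi> x) (n F)"
    using elem_trace_lin[OF T(1) S_pcont[OF P(1)] S_pcont[OF P(2)]] by (simp add: tens_vec_lin)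
qed

text \<open>
  The interelement condition compares two values of functionals \<open>l T F q\<close> that are linear in the tensor
  field.
\<close>

lemma lin_sub_Sigma: "lin_sub (Sigma_h \<T> n)"
proof -
  define l where "l = (\<lambda>T F q \<Psi>. face_ip (n F) F (\<lambda>x. tens_vec (elem_trace T \<Psi> x) (n F)) (\<lambda>_. q))"
  have lin: "lin_on S_h (l T F q)" if "T \<in> \<T>" "F facet_of T" for T F q
    unfolding l_def face_ip_eq
    by (rule lin_on_ip(2)[OF normal_trace_lin_op[OF that]])
       (rule continuous_in_sqint_face[OF mesh_face(1-3)[OF mesh_faceI[OF that]]], simp)
  have S: "Sigma_h \<T> n = {\<Psi> \<in> S_h. \<forall>T\<in>\<T>. \<forall>T'\<in>\<T>. \<forall>F. F facet_of T \<and> F facet_of T' \<longrightarrow>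
      (\<forall>q\<in>sym_mat. l T F q \<Psi> = l T' F q \<Psi>)}"
    unfolding Sigma_h_def S_h_def l_def ..
  show ?thesis unfolding lin_sub_def
  proof (intro conjI ballI allI)
    show "(\<lambda>_. 0) \<in> Sigma_h \<T> n"
      using lin_on_zero[OF lin_sub_S lin] lin_sub_S unfolding S lin_sub_def by simp
    fix f g c assume fg: "f \<in> Sigma_h \<T> n" "g \<in> Sigma_h \<T> n"
    then have fS: "f \<in> S_h" "g \<in> S_h" by (simp_all add: S)
    have e: "l T F q (\<lambda>x. f x + c *\<^sub>R g x) = l T' F q (\<lambda>x. f x + c *\<^sub>R g x)"
      if "T \<in> \<T>" "T' \<in> \<T>" "F facet_of T" "F facet_of T'" "q \<in> sym_mat" for T T' F q
    proof -
      have "l T F q f = l T' F q f" "l T F q g = l T' F q g" using fg that unfolding S by blast+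
      then show ?thesis using lin_onD[OF lin[OF that(1,3)] fS] lin_onD[OF lin[OF that(2,4)] fS] by simp
    qed
    then show "(\<lambda>x. f x + c *\<^sub>R g x) \<in> Sigma_h \<T> n"
      unfolding S using lin_subD[OF lin_sub_S fS] by blast
  qed
qed

end

section \<open>The forms and norms of the mixed problem\<close>

context mesh
begin

text \<open>
  Vanishing almost everywhere means vanishing on the open elements, by continuity of the pieces, and off
  the open elements the function is zero anyway.
\<close>

lemma pcont_ip_zero:
  fixes f :: "real^'n \<Rightarrow> 'b::euclidean_space"
  assumes f: "f \<in> pcont" and z: "L2_ip \<Omega> f f = 0"
  shows "f x = 0"
proof (cases "x \<in> (\<Union>T\<in>\<T>. interior T)")
  case False
  then show ?thesis using f by (simp add: pcont_def piecewise_def)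
next
  case True
  then obtain T where T: "T \<in> \<T>" "x \<in> interior T" by blast
  obtain p where p: "\<And>T. T \<in> \<T> \<Longrightarrow> continuous_on UNIV (p T)" "\<And>T y. T \<in> \<T> \<Longrightarrow> y \<in> interior T \<Longrightarrow> f y = p T y"
    using pcont_pieces[OF f] by blast
  have "integrable (lebesgue_on \<Omega>) (\<lambda>y. f y \<bullet> f y)"
    using sqint_integrable pcont_sqint[OF f] by blast
  then have "AE y in lebesgue_on \<Omega>. f y \<bullet> f y = 0"
    using integral_nonneg_eq_0_iff_AE[of "lebesgue_on \<Omega>" "\<lambda>y. f y \<bullet> f y"] z by (simp add: L2_ip_def)
  then have "AE y in lebesgue_on \<Omega>. f y = 0" by simp
  then have "AE y in lebesgue. y \<in> \<Omega> \<longrightarrow> f y = 0"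
    using fmeasurableD[OF Omega_lmeasurable] by (subst (asm) AE_restrict_space_iff) auto
  then obtain N where N: "negligible N" "{y. \<not> (y \<in> \<Omega> \<longrightarrow> f y = 0)} \<subseteq> N"
    unfolding eventually_ae_filter_negligible by blast
  define U where "U = interior T \<inter> p T -` (- {0})"
  have "open U" unfolding U_def
    by (rule continuous_open_preimage[OF continuous_on_subset[OF p(1)[OF T(1)]]]) auto
  moreover have "U \<subseteq> N" using N(2) p(2)[OF T(1)] interior_in_Omega[OF T(1)] by (auto simp: U_def)
  then have "negligible U" using N(1) negligible_subset by blast
  ultimately have "U = {}" using open_not_negligible by blast
  then show ?thesis using T(2) p(2)[OF T] by (auto simp: U_def)
qed

text \<open>
  In dimension at least two a face is not a single point.
\<close>

lemma diameter_face_pos: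
  assumes "F \<in> mesh_faces \<T>" shows "0 < diameter F"
proof (rule ccontr)
  assume "\<not> 0 < diameter F"
  obtain T where T: "T \<in> \<T>" "F facet_of T" using assms by (auto simp: mesh_faces_def)
  note f = facet_props[OF simplex[OF T(1)] T(2)]
  obtain x where x: "x \<in> F" using f(3) by blast
  have "y = x" if "y \<in> F" for y
    using diameter_bounded_bound[OF compact_imp_bounded[OF f(2)] that x] \<open>\<not> 0 < diameter F\<close>
      zero_le_dist[of y x] by (metis dist_le_zero_iff linorder_not_less order_le_less_trans)
  then have "F = {x}" using x by blast
  then have "aff_dim F = 0" by simp
  then show False using f(6) dim by simp
qed

lemma gradient_pieces:
  assumes "v \<in> W_h"
  obtains A b where "\<And>T x. T \<in> \<T> \<Longrightarrow> x \<in> interior T \<Longrightarrow> v x = A T *v x + b T"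
    "\<And>T x. T \<in> \<T> \<Longrightarrow> x \<in> interior T \<Longrightarrow> elementwise \<T> (sym_grad v) x = sym_part (A T)"
    "\<And>T x. T \<in> \<T> \<Longrightarrow> x \<in> interior T \<Longrightarrow> elementwise \<T> (vec_div v) x = trace (A T)"
    "\<And>\<mu> lam T x. T \<in> \<T> \<Longrightarrow> x \<in> interior T \<Longrightarrow>
       elementwise \<T> (stress \<mu> lam v) x = (2 * \<mu>) *\<^sub>R sym_part (A T) + (lam * trace (A T)) *\<^sub>R mat 1"
proof -
  obtain A b where f: "\<And>T x. T \<in> \<T> \<Longrightarrow> x \<in> interior T \<Longrightarrow> v x = A T *v x + b T"
    using W_pieces[OF assms] by metis
  have g: "elementwise \<T> (sym_grad v) x = sym_part (A T)" "elementwise \<T> (vec_div v) x = trace (A T)"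
     "elementwise \<T> (stress \<mu> lam v) x = (2 * \<mu>) *\<^sub>R sym_part (A T) + (lam * trace (A T)) *\<^sub>R mat 1"
    if T: "T \<in> \<T>" "x \<in> interior T" for T x \<mu> lam
  proof -
    have *: "y \<in> interior T \<Longrightarrow> v y = A T *v y + b T" for y by (rule f[OF T(1)])
    note d = affine_derivatives[OF open_interior T(2) *]
    show "elementwise \<T> (sym_grad v) x = sym_part (A T)" "elementwise \<T> (vec_div v) x = trace (A T)"
     "elementwise \<T> (stress \<mu> lam v) x = (2 * \<mu>) *\<^sub>R sym_part (A T) + (lam * trace (A T)) *\<^sub>R mat 1"
      using T d by (auto simp: elementwise_def)
  qed
  show ?thesis by (rule that[of A b]; rule f g; assumption)
qed

lemma elementwise_zero: "x \<notin> (\<Union>T\<in>\<T>. interior T) \<Longrightarrow> elementwise \<T> g x = 0"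
  by (simp add: elementwise_def)

abbreviation eps :: "(real^'n \<Rightarrow> real^'n) \<Rightarrow> real^'n \<Rightarrow> real^'n^'n" where
  "eps v \<equiv> elementwise \<T> (sym_grad v)"

abbreviation ediv :: "(real^'n \<Rightarrow> real^'n) \<Rightarrow> real^'n \<Rightarrow> real" where
  "ediv v \<equiv> elementwise \<T> (vec_div v)"

lemma eps_sqint: "v \<in> W_h \<Longrightarrow> eps v \<in> sqint (lebesgue_on \<Omega>)"
  and ediv_sqint: "v \<in> W_h \<Longrightarrow> ediv v \<in> sqint (lebesgue_on \<Omega>)"
  using lin_op_L2[OF lin_map_sym_grad] lin_op_L2[OF lin_map_vec_div] by (simp_all add: lin_op_def)


definition jump_form ::
    "((real^'n \<Rightarrow> real^'n) \<Rightarrow> real^'n \<Rightarrow> 'c::euclidean_space) \<Rightarrow> (real^'n \<Rightarrow> real^'n) \<Rightarrow> (real^'n \<Rightarrow> real^'n) \<Rightarrow> real" where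
  "jump_form D u v = (\<Sum>F\<in>mesh_faces \<T>. 1 / diameter F * face_ip (n F) F (jump \<T> n F (D u)) (jump \<T> n F (D v)))"

lemma psd_jump_form:
  assumes "lin_map W_h D" shows "psd_form W_h (jump_form D)"
  unfolding jump_form_def[abs_def] face_ip_eq
proof (rule psd_form_sum)
  fix F assume F: "F \<in> mesh_faces \<T>"
  show "psd_form W_h (\<lambda>f g. 1 / diameter F *
      ip (face_measure (n F) F) (jump \<T> n F (D f)) (jump \<T> n F (D g)))"
    by (rule psd_form_scale[OF psd_form_ip[OF lin_op_jump[OF assms F]]])
      (use diameter_face_pos[OF F] in simp)
qed

lemma W_sub_pcont: "W_h \<subseteq> pcont" and S_sub_pcont: "S_h \<subseteq> pcont"
  using W_pcont S_pcont by blast+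

text \<open>
  The product of \<open>mat 1\<close> with the symmetric gradient is the divergence. In this form \<open>c\<^sub>h(u, u)\<close> is visibly the
  square of \<open>|||u|||\<^sub>1\<^sub>,\<^sub>h\<close>.
\<close>

lemma form_c_eq:
  assumes u: "u \<in> W_h" and v: "v \<in> W_h"
  shows "form_c \<Omega> \<T> n \<mu> lam u v =
    2 * \<mu> * L2_ip \<Omega> (eps u) (eps v) + lam * L2_ip \<Omega> (ediv u) (ediv v) + jump_form (\<lambda>v. v) u v"
proof -
  obtain A b where A: "\<And>T x. T \<in> \<T> \<Longrightarrow> x \<in> interior T \<Longrightarrow> eps u x = sym_part (A T)"
    "\<And>T x. T \<in> \<T> \<Longrightarrow> x \<in> interior T \<Longrightarrow> ediv u x = trace (A T)"
    "\<And>T x. T \<in> \<T> \<Longrightarrow> x \<in> interior T \<Longrightarrow>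
       elementwise \<T> (stress \<mu> lam u) x = (2 * \<mu>) *\<^sub>R sym_part (A T) + (lam * trace (A T)) *\<^sub>R mat 1"
    using gradient_pieces[OF u] by metis
  obtain A' b' where A': "\<And>T x. T \<in> \<T> \<Longrightarrow> x \<in> interior T \<Longrightarrow> eps v x = sym_part (A' T)"
    "\<And>T x. T \<in> \<T> \<Longrightarrow> x \<in> interior T \<Longrightarrow> ediv v x = trace (A' T)"
    using gradient_pieces[OF v] by metis
  have "elementwise \<T> (stress \<mu> lam u) x \<bullet> eps v x = 2 * \<mu> * (eps u x \<bullet> eps v x) + lam * (ediv u x \<bullet> ediv v x)" for x
  proof (cases "x \<in> (\<Union>T\<in>\<T>. interior T)")
    case True
    then obtain T where T: "T \<in> \<T>" "x \<in> interior T" by blast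
    then show ?thesis using A[OF T] A'[OF T] by (simp add: inner_add_left mat1_inner_trace trace_sym_part)
  qed (simp add: elementwise_zero)
  then have "L2_ip \<Omega> (elementwise \<T> (stress \<mu> lam u)) (eps v) =
      2 * \<mu> * L2_ip \<Omega> (eps u) (eps v) + lam * L2_ip \<Omega> (ediv u) (ediv v)"
    unfolding L2_ip_def
    using sqint_integrable[OF eps_sqint[OF u] eps_sqint[OF v]] sqint_integrable[OF ediv_sqint[OF u] ediv_sqint[OF v]]
    by simp
  then show ?thesis by (simp add: form_c_def jump_form_def)
qed

lemma psd_L2:
  assumes "lin_map X D" shows "psd_form X (\<lambda>f g. L2_ip \<Omega> (D f) (D g))"
  unfolding L2_ip_eq by (rule psd_form_ip[OF lin_op_L2[OF assms]])

lemma psd_form_c: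
  assumes "\<mu> > 0" "lam > 0" shows "psd_form W_h (form_c \<Omega> \<T> n \<mu> lam)"
  by (rule psd_form_cong[OF lin_sub_W _ form_c_eq])
    (use assms in \<open>intro psd_form_add psd_form_scale psd_L2 psd_jump_form lin_map_sym_grad
      lin_map_vec_div lin_map_id W_sub_pcont; simp\<close>)

lemma norm_1h_eq: "v \<in> W_h \<Longrightarrow> norm_1h \<Omega> \<T> n \<mu> lam v = sqrt (form_c \<Omega> \<T> n \<mu> lam v v)"
  by (simp add: form_c_eq norm_1h_def jump_form_def)

text \<open>
  The bilinear form of the squared norm \<open>|||\<cdot>|||\<^sub>2\<^sub>,\<^sub>h\<close>.
\<close>

definition gradient_jump_form :: "real \<Rightarrow> real \<Rightarrow> (real^'n \<Rightarrow> real^'n) \<Rightarrow> (real^'n \<Rightarrow> real^'n) \<Rightarrow> real" where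
  "gradient_jump_form \<mu> lam u v = 2 * \<mu> * jump_form eps u v + lam * jump_form ediv u v"

lemma psd_gradient_jump_form:
  assumes "\<mu> > 0" "lam > 0" shows "psd_form W_h (gradient_jump_form \<mu> lam)"
  unfolding gradient_jump_form_def[abs_def]
  using assms by (intro psd_form_add psd_form_scale psd_jump_form lin_map_sym_grad lin_map_vec_div) simp_all

lemma norm_2h_eq: "norm_2h \<T> n \<mu> lam v = sqrt (gradient_jump_form \<mu> lam v v)"
  unfolding norm_2h_def gradient_jump_form_def jump_form_def
  by (rule arg_cong[of _ _ sqrt])
    (simp add: sum_distrib_left sum.distrib[symmetric] add_divide_distrib mult.assoc)

text \<open>
  The bilinear form of the squared norm \<open>|||\<cdot>|||\<^sub>\<iota>\<^sub>,\<^sub>h\<close>.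
\<close>

definition ih_form :: "real \<Rightarrow> real \<Rightarrow> real \<Rightarrow> (real^'n \<Rightarrow> real^'n) \<Rightarrow> (real^'n \<Rightarrow> real^'n) \<Rightarrow> real" where
  "ih_form \<mu> lam \<iota> u v = \<iota>\<^sup>2 * gradient_jump_form \<mu> lam u v + form_c \<Omega> \<T> n \<mu> lam u v"

lemma norm_ih_eq:
  assumes "\<mu> > 0" "lam > 0" "v \<in> W_h"
  shows "norm_ih \<Omega> \<T> n \<mu> lam \<iota> v = sqrt (ih_form \<mu> lam \<iota> v v)"
  using psd_formD(3)[OF psd_gradient_jump_form[OF assms(1,2)] assms(3)] psd_formD(3)[OF psd_form_c[OF assms(1,2)] assms(3)]
  by (simp add: norm_ih_def norm_1h_eq[OF assms(3)] norm_2h_eq ih_form_def)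

definition compliance_form :: "real \<Rightarrow> real \<Rightarrow> (real^'n \<Rightarrow> real^'n^'n^'n) \<Rightarrow> (real^'n \<Rightarrow> real^'n^'n^'n) \<Rightarrow> real" where
  "compliance_form \<mu> lam \<Phi> \<Psi> = L2_ip \<Omega> (\<lambda>x. compliance \<mu> lam (\<Phi> x)) \<Psi>"

lemma compliance_form_eq:
  assumes "\<mu> > 0" "lam > 0" "\<Phi> \<in> S_h" "\<Psi> \<in> S_h"
  shows "compliance_form \<mu> lam \<Phi> \<Psi> = 1 / (2 * \<mu>) * L2_ip \<Omega> (\<lambda>x. dev_tens (\<Phi> x)) (\<lambda>x. dev_tens (\<Psi> x)) +
    1 / (real CARD('n) * (2 * \<mu> + real CARD('n) * lam)) * L2_ip \<Omega> (\<lambda>x. tens_tr (\<Phi> x)) (\<lambda>x. tens_tr (\<Psi> x))"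
proof -
  have "lin_op S_h (lebesgue_on \<Omega>) (\<lambda>\<Psi> x. dev_tens (\<Psi> x))" "lin_op S_h (lebesgue_on \<Omega>) (\<lambda>\<Psi> x. tens_tr (\<Psi> x))"
    by (rule lin_op_L2[OF lin_map_pointwise[OF S_sub_pcont linear_dev_tens]],
        rule lin_op_L2[OF lin_map_pointwise[OF S_sub_pcont linear_tens_tr]])
  then have "(\<lambda>x. dev_tens (\<Psi> x)) \<in> sqint (lebesgue_on \<Omega>)" "(\<lambda>x. tens_tr (\<Psi> x)) \<in> sqint (lebesgue_on \<Omega>)"
    "(\<lambda>x. dev_tens (\<Phi> x)) \<in> sqint (lebesgue_on \<Omega>)" "(\<lambda>x. tens_tr (\<Phi> x)) \<in> sqint (lebesgue_on \<Omega>)"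
    using assms(3,4) by (auto simp: lin_op_def)
  then have "integrable (lebesgue_on \<Omega>) (\<lambda>x. dev_tens (\<Phi> x) \<bullet> dev_tens (\<Psi> x))"
    "integrable (lebesgue_on \<Omega>) (\<lambda>x. tens_tr (\<Phi> x) \<bullet> tens_tr (\<Psi> x))"
    using sqint_integrable by blast+
  then show ?thesis unfolding compliance_form_def L2_ip_def compliance_inner[OF assms(1,2)] by simp
qed

lemma psd_compliance_form:
  assumes "\<mu> > 0" "lam > 0" shows "psd_form S_h (compliance_form \<mu> lam)"
  by (rule psd_form_cong[OF lin_sub_S _ compliance_form_eq[OF assms]])
    (use assms in \<open>intro psd_form_add psd_form_scale psd_L2 lin_map_pointwise S_sub_pcont
      linear_dev_tens linear_tens_tr; simp\<close>)

lemma compliance_form_definite: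
  assumes "\<mu> > 0" "lam > 0" "\<Psi> \<in> S_h" "compliance_form \<mu> lam \<Psi> \<Psi> = 0"
  shows "\<Psi> = (\<lambda>_. 0)"
proof
  fix x
  let ?c = "1 / (2 * \<mu>)" and ?c' = "1 / (real CARD('n) * (2 * \<mu> + real CARD('n) * lam))"
  let ?D = "L2_ip \<Omega> (\<lambda>x. dev_tens (\<Psi> x)) (\<lambda>x. dev_tens (\<Psi> x))"
    and ?E = "L2_ip \<Omega> (\<lambda>x. tens_tr (\<Psi> x)) (\<lambda>x. tens_tr (\<Psi> x))"
  have p: "?c > 0" "?c' > 0" using assms by (auto intro!: divide_pos_pos mult_pos_pos add_pos_pos)
  have nn: "0 \<le> ?D" "0 \<le> ?E" unfolding L2_ip_eq by (rule ip_nonneg)+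
  have "0 \<le> ?c * ?D" "0 \<le> ?c' * ?E" using p nn by (intro mult_nonneg_nonneg; simp)+
  moreover have "?c * ?D + ?c' * ?E = 0" using compliance_form_eq[OF assms(1,2,3,3)] assms(4) by simp
  ultimately have "?c * ?D = 0" "?c' * ?E = 0" by linarith+
  then have "?D = 0" "?E = 0" using p by (metis less_irrefl mult_eq_0_iff)+
  moreover have "(\<lambda>x. dev_tens (\<Psi> x)) \<in> pcont" "(\<lambda>x. tens_tr (\<Psi> x)) \<in> pcont"
    using lin_map_pointwise[OF S_sub_pcont linear_dev_tens] lin_map_pointwise[OF S_sub_pcont linear_tens_tr] assms(3)
    by (auto simp: lin_map_def)
  ultimately have "dev_tens (\<Psi> x) = 0" "tens_tr (\<Psi> x) = 0" using pcont_ip_zero by blast+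
  then show "\<Psi> x = 0" by (simp add: dev_tens_def tens_outer_def vec_eq_iff)
qed

end

section \<open>Definiteness of the discrete energy\<close>

text \<open>
  If \<open>G\<close> has codimension at least two, then \<open>G\<close> together with the direction \<open>e\<close> fits into a hyperplane, and
  this hyperplane contains every line in direction \<open>e\<close> that meets the affine hull of \<open>G\<close>.
\<close>

lemma negligible_lines_through:
  fixes G :: "(real^'n) set"
  assumes "aff_dim G + 1 < int CARD('n)"
  shows "negligible {x. \<exists>t. x + t *\<^sub>R e \<in> affine hull G}"
proof (cases "G = {}")
  case False
  then obtain g where g: "g \<in> G" by blast
  have "aff_dim (insert (g + e) G) \<le> aff_dim G + 1" by (simp add: aff_dim_insert)
  then obtain h c where h: "h \<noteq> 0" "insert (g + e) G \<subseteq> {z. h \<bullet> z = c}"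
    using aff_lowdim_subset_hyperplane[of "insert (g + e) G"] assms by auto
  have he: "h \<bullet> e = 0" using h(2) g by (auto simp: inner_add_right)
  have sub: "affine hull G \<subseteq> {z. h \<bullet> z = c}" using h(2) by (intro hull_minimal affine_hyperplane) auto
  have "{x. \<exists>t. x + t *\<^sub>R e \<in> affine hull G} \<subseteq> {z. h \<bullet> z = c}"
  proof clarify
    fix x t assume "x + t *\<^sub>R e \<in> affine hull G"
    then have "h \<bullet> (x + t *\<^sub>R e) = c" using sub by blast
    then show "h \<bullet> x = c" by (simp add: inner_add_right he)
  qed
  then show ?thesis using negligible_hyperplane[of h c] h(1) negligible_subset by blast
qed simp

context mesh
begin

text \<open>
  The points whose line in direction \<open>e\<close> may fail to cross faces properly: it meets a face of codimension
  two, or it runs in the hyperplane of a face parallel to \<open>e\<close>.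
\<close>

definition bad_points :: "real^'n \<Rightarrow> (real^'n) set" where
  "bad_points e =
     (\<Union>F\<in>mesh_faces \<T>. (\<Union>G\<in>{G. G facet_of F}. {x. \<exists>t. x + t *\<^sub>R e \<in> affine hull G})) \<union>
     (\<Union>F\<in>{F \<in> mesh_faces \<T>. n F \<bullet> e = 0}. {x. n F \<bullet> x = n F \<bullet> (SOME y. y \<in> F)})"

lemma negligible_bad_points: "negligible (bad_points e)"
  unfolding bad_points_def
proof (rule negligible_Un)
  have "negligible (\<Union>G\<in>{G. G facet_of F}. {x. \<exists>t. x + t *\<^sub>R e \<in> affine hull G})"
    if F: "F \<in> mesh_faces \<T>" for F
  proof -
    obtain T where T: "T \<in> \<T>" "F facet_of T" using F by (auto simp: mesh_faces_def)
    note f = facet_props[OF simplex[OF T(1)] T(2)]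
    have "finite {G. G facet_of F}" using f(5) by (rule finite_polytope_facets)
    moreover have "negligible {x. \<exists>t. x + t *\<^sub>R e \<in> affine hull G}" if "G facet_of F" for G
      using that f(6) by (intro negligible_lines_through) (simp add: facet_of_def)
    ultimately show ?thesis by (intro negligible_Union) auto
  qed
  then show "negligible (\<Union>F\<in>mesh_faces \<T>. (\<Union>G\<in>{G. G facet_of F}. {x. \<exists>t. x + t *\<^sub>R e \<in> affine hull G}))"
    using finite_faces by (intro negligible_Union) auto
  have "negligible {x. n F \<bullet> x = c}" if "F \<in> mesh_faces \<T>" for F c
    using mesh_face(4)[OF that] by (intro negligible_hyperplane) auto
  then show "negligible (\<Union>F\<in>{F \<in> mesh_faces \<T>. n F \<bullet> e = 0}. {x. n F \<bullet> x = n F \<bullet> (SOME y. y \<in> F)})"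
    using finite_faces by (intro negligible_Union) auto
qed

lemma good_line_crosses_facet:
  assumes x: "x \<notin> bad_points e" and F: "F \<in> mesh_faces \<T>" and y: "x + t *\<^sub>R e \<in> F"
  shows "n F \<bullet> e \<noteq> 0" "x + t *\<^sub>R e \<in> rel_interior F"
proof -
  obtain T where T: "T \<in> \<T>" "F facet_of T" using F by (auto simp: mesh_faces_def)
  note f = facet_props[OF simplex[OF T(1)] T(2)]
  show "n F \<bullet> e \<noteq> 0"
  proof
    assume z: "n F \<bullet> e = 0"
    have "(SOME y. y \<in> F) \<in> F" using y by (rule someI)
    then have "n F \<bullet> (x + t *\<^sub>R e - (SOME y. y \<in> F)) = 0" using mesh_face(5)[OF F] y by blast
    then have "n F \<bullet> x = n F \<bullet> (SOME y. y \<in> F)" by (simp add: inner_diff_right inner_add_right z)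
    then show False using x F z by (auto simp: bad_points_def)
  qed
  show "x + t *\<^sub>R e \<in> rel_interior F"
  proof (rule ccontr)
    assume "x + t *\<^sub>R e \<notin> rel_interior F"
    then have "x + t *\<^sub>R e \<in> rel_frontier F" using y closure_subset by (auto simp: rel_frontier_def)
    then obtain G where "G facet_of F" "x + t *\<^sub>R e \<in> G"
      using rel_frontier_of_polyhedron[OF polytope_imp_polyhedron[OF f(5)]] by auto
    then have "x + t *\<^sub>R e \<in> affine hull G" by (simp add: hull_inc)
    then show False using x F \<open>G facet_of F\<close> by (auto simp: bad_points_def)
  qed
qed

text \<open>
  Let \<open>e\<close> be a coordinate direction. On each element the component of \<open>u\<close> along \<open>e\<close> is constant on lines in
  direction \<open>e\<close>, because the gradient is skew. Assume that it has a value \<open>c \<noteq> 0\<close> at a point \<open>x\<close> and follow the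
  line of \<open>x\<close> to the last parameter \<open>s\<close> at which it lies in an element on which this component has the
  value \<open>c\<close>. For generic \<open>x\<close> the line leaves that element through the relative interior of a facet and
  transversally. If no other element has this facet, then the jump there is the trace and \<open>c = 0\<close>. If there
  is a second element, the line enters it, and the vanishing jump passes the value \<open>c\<close> on; this contradicts
  the choice of \<open>s\<close>.
\<close>

lemma rigid_zero:
  assumes u: "u \<in> W_h" and eps0: "\<And>x. eps u x = 0"
    and jump0: "\<And>F x. F \<in> mesh_faces \<T> \<Longrightarrow> x \<in> F \<Longrightarrow> jump \<T> n F u x = 0"
  shows "u = (\<lambda>_. 0)"
proof -
  obtain A b where A: "\<And>T x. T \<in> \<T> \<Longrightarrow> x \<in> interior T \<Longrightarrow> u x = A T *v x + b T"
    "\<And>T x. T \<in> \<T> \<Longrightarrow> x \<in> interior T \<Longrightarrow> eps u x = sym_part (A T)"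
    using gradient_pieces[OF u] by metis
  define p where "p = (\<lambda>T x. A T *v x + b T)"
  have pc: "continuous_on UNIV (p T)" for T unfolding p_def by (intro continuous_intros)
  have skew: "A T $ i $ i = 0" if T: "T \<in> \<T>" for T i
  proof -
    obtain x where "x \<in> interior T" using simplex_props(5)[OF simplex[OF T]] by blast
    then have "sym_part (A T) = 0" using A(2)[OF T] eps0 by metis
    then have "sym_part (A T) $ i $ i = 0" by simp
    then show ?thesis by (simp add: sym_part_def)
  qed
  have jump_p: "(\<Sum>T\<in>elems F. face_sign T F *\<^sub>R p T x) = 0" if "F \<in> mesh_faces \<T>" "x \<in> F" for F x
    using jump0[OF that] jump_eq[of p u x F, OF pc _ that(2)] A(1) by (simp add: p_def)
  have main: False if T0: "T0 \<in> \<T>" and x: "x \<in> T0" "x \<notin> bad_points (axis i 1)" and c: "p T0 x $ i \<noteq> 0" for T0 x i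
  proof -
    let ?e = "axis i 1 :: real^'n"
    define l where "l = (\<lambda>t. x + t *\<^sub>R ?e)"
    have const: "p T (l t) $ i = p T x $ i" if "T \<in> \<T>" for T t
      using skew[OF that, of i]
      by (simp add: p_def l_def matrix_vector_right_distrib matrix_vector_mult_scaleR matrix_vector_mult_basis column_def)
    \<comment> \<open>\<open>\<C>\<close> collects the elements whose piece carries the value at \<open>x\<close> along the whole line.\<close>
    define \<C> where "\<C> = {T \<in> \<T>. p T x $ i = p T0 x $ i}"
    define K where "K = (\<Union>T\<in>\<C>. {t. 0 \<le> t \<and> l t \<in> T})"
    have cl: "continuous_on UNIV l" unfolding l_def by (intro continuous_intros)
    have "compact {t. 0 \<le> t \<and> l t \<in> T}" if "T \<in> \<T>" for T
    proof -
      note s = simplex_props[OF simplex[OF that]]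
      have "closed ({0..} \<inter> l -` T)"
        using continuous_closed_preimage[OF continuous_on_subset[OF cl], of "{0..}" T] s(2)
        by (simp add: compact_imp_closed)
      moreover have "bounded ({0..} \<inter> l -` T)"
      proof -
        obtain B where B: "\<forall>z\<in>T. norm z \<le> B" using compact_imp_bounded[OF s(2)] by (auto simp: bounded_iff)
        have "norm t \<le> B + norm x" if "t \<in> {0..} \<inter> l -` T" for t
        proof -
          have "norm (l t) \<le> B" using B that by auto
          have "norm t = norm (l t - x)" by (simp add: l_def)
          also have "\<dots> \<le> norm (l t) + norm x" by (rule norm_triangle_ineq4)
          finally show ?thesis using \<open>norm (l t) \<le> B\<close> by linarith
        qed
        then show ?thesis unfolding bounded_iff by blast
      qed
      ultimately have "compact ({0..} \<inter> l -` T)" by (simp add: compact_eq_bounded_closed)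
      moreover have "{0..} \<inter> l -` T = {t. 0 \<le> t \<and> l t \<in> T}" by auto
      ultimately show ?thesis by simp
    qed
    then have "compact K" unfolding K_def \<C>_def using finite_mesh by (intro compact_UN) auto
    moreover have K0: "0 \<in> K" using T0 x by (auto simp: K_def \<C>_def l_def)
    ultimately obtain s where s: "s \<in> K" "\<And>t. t \<in> K \<Longrightarrow> t \<le> s" using compact_attains_sup[of K] by blast
    then obtain T where T: "T \<in> \<C>" "0 \<le> s" "l s \<in> T" by (auto simp: K_def)
    then have TT: "T \<in> \<T>" and Tc: "p T x $ i = p T0 x $ i" by (auto simp: \<C>_def)
    note sp = simplex_props[OF simplex[OF TT]]
    have beyond: False if "T' \<in> \<C>" "r > 0" "l s + r *\<^sub>R ?e \<in> T'" for T' r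
    proof -
      have "l (s + r) \<in> T'" using that(3) by (simp add: l_def algebra_simps)
      then have "s + r \<in> K" using that(1,2) T(2) by (auto simp: K_def)
      then show False using s(2) that(2) by force
    qed
    have "l s \<notin> interior T"
    proof
      assume "l s \<in> interior T"
      then obtain r where r: "r > 0" "cball (l s) r \<subseteq> T" using mem_interior_cball by blast
      have "l s + r *\<^sub>R ?e \<in> T" using r by (auto simp: subset_iff dist_norm)
      then show False using beyond[OF T(1) r(1)] by blast
    qed
    then have "l s \<notin> rel_interior T" using sp(5) interior_rel_interior_gen interior_rel_interior[of T] sp(4) by (auto simp: aff_dim_eq_full)
    then have "l s \<in> rel_frontier T" using T(3) closure_subset by (auto simp: rel_frontier_def)
    then obtain F where F: "F facet_of T" "l s \<in> F"
      using rel_frontier_of_polyhedron[OF polytope_imp_polyhedron[OF sp(3)]] by auto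
    have Fm: "F \<in> mesh_faces \<T>" using mesh_faceI[OF TT F(1)] .
    have cross: "n F \<bullet> ?e \<noteq> 0" "l s \<in> rel_interior F"
      using good_line_crosses_facet[OF x(2) Fm, of s] F(2) by (simp_all add: l_def)
    have TF: "T \<in> elems F" using TT F(1) by (simp add: elems_def)
    have "\<not> ?e \<bullet> outer_normal T F < 0"
      using enter_through_facet[OF simplex[OF TT] F(1) cross(2), of ?e] beyond[OF T(1)] by (metis order_refl)
    moreover have "?e \<bullet> outer_normal T F \<noteq> 0"
      using face_sign(1,3)[OF TT F(1)] cross(1) by (metis inner_commute inner_scaleR_left mult_zero_right)
    ultimately have out: "0 < ?e \<bullet> outer_normal T F" by simp
    have sg: "face_sign T F \<noteq> 0" using face_sign(1)[OF TT F(1)] by auto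
    show False
    proof (cases "elems F = {T}")
      case True
      then have "p T (l s) = 0" using jump_p[OF Fm F(2)] sg by simp
      then show False using const[OF TT, of s] Tc c by simp
    next
      case False
      then obtain T' where T': "T' \<in> elems F" "T' \<noteq> T" using TF by blast
      have "elems F = {T, T'}"
      proof (rule card_seteq[symmetric])
        show "finite (elems F)" by (rule finite_elems)
        show "{T, T'} \<subseteq> elems F" using T' TF by blast
        show "card (elems F) \<le> card {T, T'}" using card_elems[of F] T'(2) by simp
      qed
      then have "face_sign T F *\<^sub>R p T (l s) + face_sign T' F *\<^sub>R p T' (l s) = 0"
        using jump_p[OF Fm F(2)] T'(2) by auto
      moreover have sg': "face_sign T' F = - face_sign T F" using face_sign_inj[OF TF T'(1)] T'(2) by blast
      ultimately have "p T' (l s) = p T (l s)" using sg by (simp add: scaleR_diff_right[symmetric])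
      moreover have TT': "T' \<in> \<T>" "F facet_of T'" using T'(1) by (auto simp: elems_def)
      ultimately have "T' \<in> \<C>" using const[OF TT, of s] const[OF TT'(1), of s] Tc by (simp add: \<C>_def)
      moreover have "outer_normal T' F = - outer_normal T F"
        using face_sign(2)[OF TT'] face_sign(2)[OF TT F(1)] sg' by simp
      then have "?e \<bullet> outer_normal T' F < 0" using out by simp
      ultimately show False
        using enter_through_facet[OF simplex[OF TT'(1)] TT'(2) cross(2), of ?e] beyond by (metis order_refl)
    qed
  qed
  have "u x $ i = 0" for x i
  proof (cases "x \<in> (\<Union>T\<in>\<T>. interior T)")
    case False
    then show ?thesis using u by (simp add: W_h_def piecewise_def)
  next
    case True
    then obtain T where T: "T \<in> \<T>" "x \<in> interior T" by blast
    define U where "U = interior T \<inter> (\<lambda>x. p T x $ i) -` (- {0})"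
    have "continuous_on (interior T) (\<lambda>x. p T x $ i)"
      using continuous_on_subset[OF pc, of "interior T" T] by (intro continuous_intros) auto
    then have "open U" unfolding U_def by (intro continuous_open_preimage) auto
    moreover have "U \<subseteq> bad_points (axis i 1)"
      using main[OF T(1), of _ i] interior_subset by (auto simp: U_def)
    then have "negligible U" using negligible_bad_points negligible_subset by blast
    ultimately have "U = {}" using open_not_negligible by blast
    then show ?thesis using T A(1)[OF T] by (auto simp: U_def p_def)
  qed
  then show ?thesis by (simp add: fun_eq_iff vec_eq_iff)
qed

text \<open>
  The three nonnegative parts of \<open>c\<^sub>h(u, u)\<close> vanish separately; the first and the last are the hypotheses of
  \<open>rigid_zero\<close>.
\<close>

lemma form_c_definite:
  assumes "\<mu> > 0" "lam > 0" and u: "u \<in> W_h" and z: "form_c \<Omega> \<T> n \<mu> lam u u = 0"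
  shows "u = (\<lambda>_. 0)"
proof -
  have "0 \<le> 2 * \<mu> * L2_ip \<Omega> (eps u) (eps u)" "0 \<le> lam * L2_ip \<Omega> (ediv u) (ediv u)"
    using assms(1,2) by (auto simp: L2_ip_eq intro!: mult_nonneg_nonneg ip_nonneg)
  moreover have J: "0 \<le> 1 / diameter F * face_ip (n F) F (jump \<T> n F u) (jump \<T> n F u)"
    if "F \<in> mesh_faces \<T>" for F
    unfolding face_ip_eq using diameter_face_pos[OF that] by (intro mult_nonneg_nonneg ip_nonneg) simp
  then have J0: "0 \<le> jump_form (\<lambda>v. v) u u" unfolding jump_form_def by (rule sum_nonneg)
  ultimately have *: "2 * \<mu> * L2_ip \<Omega> (eps u) (eps u) = 0" "jump_form (\<lambda>v. v) u u = 0"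
    using form_c_eq[OF u u, of \<mu> lam] z by linarith+
  have "L2_ip \<Omega> (eps u) (eps u) = 0" using *(1) assms(1) by simp
  moreover have "eps u \<in> pcont" using lin_map_sym_grad u by (simp add: lin_map_def)
  ultimately have "eps u x = 0" for x using pcont_ip_zero by blast
  moreover have "jump \<T> n F u x = 0" if F: "F \<in> mesh_faces \<T>" "x \<in> F" for F x
  proof (rule face_ip_self_zero[OF mesh_face(1-3)[OF F(1)] jump_continuous[OF W_pcont[OF u]]
        prism_volume_pos(2)[OF F(1)] _ F(2)])
    have "1 / diameter F * face_ip (n F) F (jump \<T> n F u) (jump \<T> n F u) = 0"
      using sum_nonneg_0[where f = "\<lambda>F. 1 / diameter F * face_ip (n F) F (jump \<T> n F u) (jump \<T> n F u)",
          OF finite_faces J _ F(1)] *(2) unfolding jump_form_def by simp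
    then show "face_ip (n F) F (jump \<T> n F u) (jump \<T> n F u) = 0" using diameter_face_pos[OF F(1)] by simp
  qed
  ultimately show ?thesis by (rule rigid_zero[OF u])
qed

text \<open>
  A point in the open element and its shifts along the coordinate axes. An affine field is determined by
  its values there, so that point evaluations separate both finite element spaces.
\<close>

definition nodes :: "(real^'n) set \<Rightarrow> (real^'n) set" where
  "nodes T = (SOME N. finite N \<and> (\<exists>x r. r > 0 \<and> N = insert x (range (\<lambda>i. x + r *\<^sub>R axis i 1)) \<and> N \<subseteq> interior T))"

lemma nodes:
  assumes "T \<in> \<T>"
  obtains x r where "r > 0" "nodes T = insert x (range (\<lambda>i. x + r *\<^sub>R axis i 1))" "nodes T \<subseteq> interior T" "finite (nodes T)"
proof -
  obtain x where "x \<in> interior T" using simplex_props(5)[OF simplex[OF assms]] by blast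
  then obtain r where r: "r > 0" "cball x r \<subseteq> interior T" using open_contains_cball[of "interior T"] by auto
  have "insert x (range (\<lambda>i. x + r *\<^sub>R axis i 1)) \<subseteq> interior T"
    using r by (auto simp: subset_iff dist_norm)
  then have "\<exists>N. finite N \<and> (\<exists>x r. r > 0 \<and> N = insert x (range (\<lambda>i. x + r *\<^sub>R axis i 1)) \<and> N \<subseteq> interior T)"
    using r(1) by (intro exI[of _ "insert x (range (\<lambda>i. x + r *\<^sub>R axis i 1))"]) auto
  from someI_ex[OF this, folded nodes_def] show ?thesis using that by blast
qed

lemma nodes_unisolvent_W:
  assumes u: "u \<in> W_h" and z: "\<And>T x. T \<in> \<T> \<Longrightarrow> x \<in> nodes T \<Longrightarrow> u x = 0"
  shows "u = (\<lambda>_. 0)"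
proof
  fix y
  obtain A b where A: "\<And>T x. T \<in> \<T> \<Longrightarrow> x \<in> interior T \<Longrightarrow> u x = A T *v x + b T" using W_pieces[OF u] by metis
  show "u y = 0"
  proof (cases "y \<in> (\<Union>T\<in>\<T>. interior T)")
    case True
    then obtain T where T: "T \<in> \<T>" "y \<in> interior T" by blast
    obtain x r where N: "r > 0" "nodes T = insert x (range (\<lambda>i. x + r *\<^sub>R axis i 1))" "nodes T \<subseteq> interior T"
      using nodes[OF T(1)] by metis
    have v: "A T *v w + b T = 0" if "w \<in> nodes T" for w using A[OF T(1)] z[OF T(1) that] N(3) that by force
    have x0: "A T *v x + b T = 0" using v N(2) by simp
    have "column i (A T) = 0" for i
    proof -
      have "A T *v (x + r *\<^sub>R axis i 1) + b T = 0" by (rule v) (unfold N(2), blast)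
      then have "r *\<^sub>R column i (A T) + (A T *v x + b T) = 0"
        by (simp add: matrix_vector_right_distrib matrix_vector_mult_scaleR matrix_vector_mult_basis algebra_simps)
      then show ?thesis using x0 N(1) by simp
    qed
    then have "A T = 0" by (simp add: column_def vec_eq_iff)
    then show ?thesis using A[OF T] x0 by simp
  qed (use u in \<open>simp add: W_h_def piecewise_def\<close>)
qed

lemma nodes_unisolvent_S:
  assumes u: "\<Psi> \<in> S_h" and z: "\<And>T x. T \<in> \<T> \<Longrightarrow> x \<in> nodes T \<Longrightarrow> \<Psi> x = 0"
  shows "\<Psi> = (\<lambda>_. 0)"
proof
  fix y
  obtain P \<tau> where A: "\<And>T x. T \<in> \<T> \<Longrightarrow> x \<in> interior T \<Longrightarrow> \<Psi> x = P T + tens_outer (\<tau> T) x" using S_pieces[OF u] by metis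
  show "\<Psi> y = 0"
  proof (cases "y \<in> (\<Union>T\<in>\<T>. interior T)")
    case True
    then obtain T where T: "T \<in> \<T>" "y \<in> interior T" by blast
    obtain x r where N: "r > 0" "nodes T = insert x (range (\<lambda>i. x + r *\<^sub>R axis i 1))" "nodes T \<subseteq> interior T"
      using nodes[OF T(1)] by metis
    have v: "P T + tens_outer (\<tau> T) w = 0" if "w \<in> nodes T" for w using A[OF T(1)] z[OF T(1) that] N(3) that by force
    have x0: "P T + tens_outer (\<tau> T) x = 0" using v N(2) by simp
    have "P T + tens_outer (\<tau> T) (x + r *\<^sub>R axis i 1) = 0" for i by (rule v) (unfold N(2), blast)
    then have "(P T + tens_outer (\<tau> T) x) + r *\<^sub>R tens_outer (\<tau> T) (axis i 1) = 0" for i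
      by (simp add: tens_outer_lin algebra_simps)
    then have "tens_outer (\<tau> T) (axis i 1) = 0" for i using x0 N(1) by simp
    then have "tens_outer (\<tau> T) (axis i 1) $ j $ k $ i = 0" for i j k by simp
    then have "\<tau> T = 0" by (simp add: tens_outer_def vec_eq_iff)
    then show ?thesis using A[OF T] x0 by (simp add: tens_outer_def vec_eq_iff)
  qed (use u in \<open>simp add: S_h_def piecewise_def\<close>)
qed

lemma finite_nodes: "finite (\<Union>T\<in>\<T>. nodes T)"
  using finite_mesh nodes by (metis finite_UN)

end

section \<open>Recovering the gradient jumps by a tensor field\<close>

definition elasticity :: "real \<Rightarrow> real \<Rightarrow> real^'n^'n \<Rightarrow> real^'n^'n" where
  "elasticity \<mu> lam e = (2 * \<mu>) *\<^sub>R e + (lam * trace e) *\<^sub>R mat 1"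

lemma sym_part_in: "sym_part A \<in> sym_mat"
  by (simp add: sym_part_def sym_mat_def add.commute)

lemma tens_tr_outer: "tens_tr (tens_outer \<tau> v) = trace \<tau> *\<^sub>R v"
  by (simp add: tens_tr_def tens_outer_def trace_def vec_eq_iff sum_distrib_right)

text \<open>
  The compliance tensor inverts Hooke's law in the first two indices. It is here that the dependence on
  \<open>lam\<close> cancels.
\<close>

lemma compliance_elasticity:
  fixes e :: "real^'n^'n"
  assumes "\<mu> > 0" "lam > 0"
  shows "compliance \<mu> lam (tens_outer (elasticity \<mu> lam e) v) = tens_outer e v"
proof -
  let ?d = "real CARD('n)"
  have p: "2 * \<mu> + ?d * lam > 0" using assms by (simp add: add_pos_pos)
  have t: "trace (elasticity \<mu> lam e) = (2 * \<mu> + ?d * lam) * trace e"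
    by (simp add: elasticity_def linear_add[OF linear_trace] linear_scale[OF linear_trace] trace_I algebra_simps)
  have "compliance \<mu> lam (tens_outer (elasticity \<mu> lam e) v) =
      (1 / (2 * \<mu>)) *\<^sub>R (tens_outer (elasticity \<mu> lam e) v - (lam * trace e) *\<^sub>R tens_outer (mat 1) v)"
    unfolding compliance_def tens_tr_outer t tens_outer_lin using p by simp
  also have "\<dots> = tens_outer e v"
    using assms by (simp add: elasticity_def tens_outer_lin)
  finally show ?thesis .
qed

lemma tens_outer_inner_outer: "tens_outer \<tau> v \<bullet> tens_outer \<sigma> w = (\<tau> \<bullet> \<sigma>) * (v \<bullet> w)"
  by (simp add: inner_vec_def tens_outer_def sum_distrib_left sum_distrib_right algebra_simps)

lemma tens_vec_outer: "tens_vec (tens_outer \<tau> v) w = (v \<bullet> w) *\<^sub>R \<tau>"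
  by (simp add: tens_vec_def tens_outer_def vec_eq_iff inner_vec_def sum_distrib_right sum_distrib_left algebra_simps)

lemma norm_sum_square:
  fixes f :: "'i \<Rightarrow> 'b::real_normed_vector"
  shows "(norm (sum f I))\<^sup>2 \<le> real (card I) * (\<Sum>i\<in>I. (norm (f i))\<^sup>2)"
proof -
  have "(norm (sum f I))\<^sup>2 \<le> (\<Sum>i\<in>I. norm (f i))\<^sup>2" by (intro power_mono norm_sum) simp
  also have "\<dots> \<le> (\<Sum>i\<in>I. (norm (f i))\<^sup>2) * real (card I)" by (rule sum_squared_le_sum_of_squares)
  finally show ?thesis by (simp add: mult.commute)
qed

text \<open>
  The compliance form is a weighted sum of two squared norms of linear images, for each of which the
  square of a sum of \<open>m\<close> terms is at most \<open>m\<close> times the sum of squares.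
\<close>

lemma compliance_sum_le:
  fixes X :: "'i \<Rightarrow> real^'n^'n^'n"
  assumes "\<mu> > 0" "lam > 0"
  shows "compliance \<mu> lam (sum X I) \<bullet> sum X I \<le> real (card I) * (\<Sum>i\<in>I. compliance \<mu> lam (X i) \<bullet> X i)"
proof -
  define c where "c = 1 / (2 * \<mu>)"
  define c' where "c' = 1 / (real CARD('n) * (2 * \<mu> + real CARD('n) * lam))"
  have p: "0 \<le> c" "0 \<le> c'" unfolding c_def c'_def
    using assms by (auto intro!: divide_nonneg_nonneg mult_nonneg_nonneg add_nonneg_nonneg)
  have q: "compliance \<mu> lam Y \<bullet> Y = c * (norm (dev_tens Y))\<^sup>2 + c' * (norm (tens_tr Y))\<^sup>2" for Y :: "real^'n^'n^'n"
    unfolding compliance_inner[OF assms] c_def c'_def by (simp add: power2_norm_eq_inner)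
  have "compliance \<mu> lam (sum X I) \<bullet> sum X I =
      c * (norm (\<Sum>i\<in>I. dev_tens (X i)))\<^sup>2 + c' * (norm (\<Sum>i\<in>I. tens_tr (X i)))\<^sup>2"
    unfolding q by (simp add: linear_sum[OF linear_dev_tens] linear_sum[OF linear_tens_tr])
  also have "\<dots> \<le> c * (real (card I) * (\<Sum>i\<in>I. (norm (dev_tens (X i)))\<^sup>2)) +
      c' * (real (card I) * (\<Sum>i\<in>I. (norm (tens_tr (X i)))\<^sup>2))"
    using p by (intro add_mono mult_left_mono norm_sum_square)
  also have "\<dots> = real (card I) * (\<Sum>i\<in>I. compliance \<mu> lam (X i) \<bullet> X i)"
    unfolding q by (simp add: sum.distrib sum_distrib_left algebra_simps)
  finally show ?thesis .
qed

context mesh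
begin

lemma facets_of_elem: "T \<in> \<T> \<Longrightarrow> {F. F facet_of T} = {F \<in> mesh_faces \<T>. F facet_of T}"
  by (auto simp: mesh_faces_def)

lemma sum_facets_swap:
  fixes g :: "(real^'n) set \<Rightarrow> (real^'n) set \<Rightarrow> real"
  shows "(\<Sum>T\<in>\<T>. \<Sum>F | F facet_of T. g T F) = (\<Sum>F\<in>mesh_faces \<T>. \<Sum>T\<in>elems F. g T F)"
proof -
  have "(\<Sum>T\<in>\<T>. \<Sum>F | F facet_of T. g T F) = (\<Sum>T\<in>\<T>. \<Sum>F\<in>{F \<in> mesh_faces \<T>. F facet_of T}. g T F)"
    by (intro sum.cong refl) (simp add: facets_of_elem)
  also have "\<dots> = (\<Sum>F\<in>mesh_faces \<T>. \<Sum>T\<in>{T \<in> \<T>. F facet_of T}. g T F)"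
    by (rule sum.swap_restrict[OF finite_mesh finite_faces])
  finally show ?thesis by (simp add: elems_def)
qed

abbreviation area :: "(real^'n) set \<Rightarrow> real" where
  "area F \<equiv> measure lebesgue (prism (n F) F)"

text \<open>
  The sum over the elements that contain \<open>x\<close> has a single term. On an element, \<open>(x - a\<^sub>F) / h\<close> is the lowest
  order Raviart-Thomas function of the facet \<open>F\<close>, with apex \<open>a\<^sub>F\<close> and height \<open>h\<close>: its normal component is 1 on \<open>F\<close>
  and 0 on the other facets. The sign refers it to the fixed normal \<open>n F\<close>.
\<close>

definition flux_field :: "((real^'n) set \<Rightarrow> real^'n^'n) \<Rightarrow> real^'n \<Rightarrow> real^'n^'n^'n" where
  "flux_field q = elementwise \<T> (\<lambda>x. \<Sum>T\<in>{T \<in> \<T>. x \<in> interior T}. \<Sum>F | F facet_of T.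
     (face_sign T F / facet_height T F) *\<^sub>R tens_outer (q F) (x - opposite_vertex T F))"

lemma flux_field_eq:
  assumes "T \<in> \<T>" "x \<in> interior T"
  shows "flux_field q x =
    (\<Sum>F | F facet_of T. (face_sign T F / facet_height T F) *\<^sub>R tens_outer (q F) (x - opposite_vertex T F))"
proof -
  have "{T \<in> \<T>. x \<in> interior T} = {T}" using assms disjoint_interiors by blast
  then show ?thesis using assms by (auto simp: flux_field_def elementwise_def)
qed

text \<open>
  Together with \<open>flux_const\<close>, the coefficients of the affine piece of \<open>flux_field q\<close> on \<open>T\<close>.
\<close>

definition flux_slope :: "((real^'n) set \<Rightarrow> real^'n^'n) \<Rightarrow> (real^'n) set \<Rightarrow> real^'n^'n" where
  "flux_slope q T = (\<Sum>F | F facet_of T. (face_sign T F / facet_height T F) *\<^sub>R q F)"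

definition flux_const :: "((real^'n) set \<Rightarrow> real^'n^'n) \<Rightarrow> (real^'n) set \<Rightarrow> real^'n^'n^'n" where
  "flux_const q T = (\<Sum>F | F facet_of T. - ((face_sign T F / facet_height T F) *\<^sub>R tens_outer (q F) (opposite_vertex T F)))"

lemma flux_piece:
  "(\<Sum>F | F facet_of T. (face_sign T F / facet_height T F) *\<^sub>R tens_outer (q F) (x - opposite_vertex T F)) =
   flux_const q T + tens_outer (flux_slope q T) x"
proof -
  have "tens_outer (flux_slope q T) x = (\<Sum>F | F facet_of T. (face_sign T F / facet_height T F) *\<^sub>R tens_outer (q F) x)"
    unfolding flux_slope_def linear_sum[OF linear_tens_outer(2)] by (simp add: tens_outer_lin)
  moreover have "tens_outer a (x - y) = tens_outer a x - tens_outer a y" for a y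
    by (rule linear_diff[OF linear_tens_outer(1)])
  ultimately show ?thesis
    unfolding flux_const_def by (simp add: sum.distrib[symmetric] scaleR_diff_right)
qed

lemma flux_field_affine:
  "T \<in> \<T> \<Longrightarrow> x \<in> interior T \<Longrightarrow> flux_field q x = flux_const q T + tens_outer (flux_slope q T) x"
  using flux_field_eq flux_piece by simp

lemma sym_mat_scale: "\<tau> \<in> sym_mat \<Longrightarrow> c *\<^sub>R \<tau> \<in> sym_mat"
  unfolding sym_mat_def by simp

lemma sym_mat_sum: "(\<And>i. i \<in> I \<Longrightarrow> f i \<in> sym_mat) \<Longrightarrow> sum f I \<in> sym_mat"
  unfolding sym_mat_def by (auto intro!: sum.cong)

lemma sym_tens_sum: "(\<And>i. i \<in> I \<Longrightarrow> f i \<in> sym_tens) \<Longrightarrow> sum f I \<in> sym_tens"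
  unfolding sym_tens_def by (auto intro!: sum.cong)

lemma flux_field_S:
  assumes q: "\<And>F. F \<in> mesh_faces \<T> \<Longrightarrow> q F \<in> sym_mat"
  shows "flux_field q \<in> S_h"
  unfolding S_h_def piecewise_def
proof (intro CollectI conjI allI impI ballI)
  fix x assume "x \<notin> (\<Union>T\<in>\<T>. interior T)"
  then show "flux_field q x = 0" by (simp add: flux_field_def elementwise_def)
next
  fix T assume T: "T \<in> \<T>"
  have qs: "q F \<in> sym_mat" if "F facet_of T" for F using q mesh_faceI[OF T that] .
  have "flux_slope q T \<in> sym_mat" unfolding flux_slope_def by (rule sym_mat_sum) (use qs sym_mat_scale in blast)
  moreover have "- (c *\<^sub>R tens_outer (q F) a) \<in> sym_tens" if "F facet_of T" for F a c
    using qs[OF that] unfolding sym_mat_def sym_tens_def tens_outer_def by simp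
  then have "flux_const q T \<in> sym_tens" unfolding flux_const_def by (rule sym_tens_sum) blast
  ultimately have "(\<lambda>x. flux_const q T + tens_outer (flux_slope q T) x) \<in> Sigma_loc"
    unfolding Sigma_loc_def by blast
  then show "\<exists>p\<in>Sigma_loc. \<forall>x\<in>interior T. flux_field q x = p x"
    using flux_field_affine[OF T] by (intro bexI[of _ "\<lambda>x. flux_const q T + tens_outer (flux_slope q T) x"]) auto
qed

text \<open>
  On \<open>F\<close> the functions of all other facets \<open>G\<close> are tangential, because their apex lies on \<open>F\<close>; that of \<open>F\<close>
  itself has normal component \<open>(face_sign T F)\<^sup>2 = 1\<close>. So the normal trace is the same from both sides.
\<close>

lemma flux_field_normal_trace:
  assumes T: "T \<in> \<T>" and F: "F facet_of T" and x: "x \<in> F"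
  shows "tens_vec (elem_trace T (flux_field q) x) (n F) = q F"
proof -
  note s = simplex[OF T] and m = mesh_face[OF mesh_faceI[OF T F]]
  let ?p = "\<lambda>x. flux_const q T + tens_outer (flux_slope q T) x"
  have "continuous_on UNIV ?p"
    using linear_tens_outer(1)[of "flux_slope q T"]
    by (intro continuous_intros linear_continuous_on) (simp add: linear_conv_bounded_linear)
  then have tr: "elem_trace T (flux_field q) x = ?p x"
    using flux_field_affine[OF T] subsetD[OF facet_of_imp_subset[OF F] x] by (intro elem_trace_eq[OF T])
  have tv: "tens_vec (?p x) (n F) = (\<Sum>G | G facet_of T.
      ((face_sign T G / facet_height T G) * ((x - opposite_vertex T G) \<bullet> n F)) *\<^sub>R q G)"
    unfolding flux_piece[symmetric] linear_sum[OF linear_tens_vec] linear_scale[OF linear_tens_vec] tens_vec_outer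
    by simp
  have zero: "(x - opposite_vertex T G) \<bullet> n F = 0" if "G facet_of T" "G \<noteq> F" for G
    using opposite_vertex(4)[OF s that(1) F] that(2) m(5) x by (metis inner_commute)
  have "(x - opposite_vertex T F) \<bullet> n F = face_sign T F * facet_height T F"
    using face_sign(3)[OF T F] facet_height(1)[OF s F x] by (metis inner_commute inner_scaleR_left)
  then have "(face_sign T F / facet_height T F) * ((x - opposite_vertex T F) \<bullet> n F) =
      (face_sign T F / facet_height T F) * (face_sign T F * facet_height T F)" by (simp only:)
  also have "\<dots> = (face_sign T F)\<^sup>2"
    using facet_height(2)[OF s F] by (simp add: power2_eq_square)
  also note face_sign(1)[OF T F]
  finally have one: "(face_sign T F / facet_height T F) * ((x - opposite_vertex T F) \<bullet> n F) = 1" .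
  have single: "sum f {F} = f F" for f :: "(real^'n) set \<Rightarrow> real^'n^'n" by simp
  have "(\<Sum>G | G facet_of T. ((face_sign T G / facet_height T G) * ((x - opposite_vertex T G) \<bullet> n F)) *\<^sub>R q G) =
      (\<Sum>G\<in>{F}. ((face_sign T G / facet_height T G) * ((x - opposite_vertex T G) \<bullet> n F)) *\<^sub>R q G)"
    using simplex_facets_finite(1)[OF s] F zero by (intro sum.mono_neutral_right) auto
  also have "\<dots> = q F" unfolding single one by simp
  finally show ?thesis unfolding tr tv .
qed

lemma flux_field_Sigma:
  assumes "\<And>F. F \<in> mesh_faces \<T> \<Longrightarrow> q F \<in> sym_mat"
  shows "flux_field q \<in> Sigma_h \<T> n"
proof -
  have "face_ip (n F) F (\<lambda>x. tens_vec (elem_trace T (flux_field q) x) (n F)) (\<lambda>_. r) = face_ip (n F) F (\<lambda>_. q F) (\<lambda>_. r)"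
    if "T \<in> \<T>" "F facet_of T" for T F r
    unfolding face_ip_def using flux_field_normal_trace[OF that]
    by (intro Bochner_Integration.integral_cong) (auto simp: space_face_measure)
  then show ?thesis using flux_field_S[OF assms] by (simp add: Sigma_h_def S_h_def)
qed

abbreviation jump_grad :: "((real^'n) set \<Rightarrow> real^'n^'n) \<Rightarrow> (real^'n) set \<Rightarrow> real^'n^'n" where
  "jump_grad A F \<equiv> \<Sum>T\<in>elems F. face_sign T F *\<^sub>R sym_part (A T)"

lemma jump_grad_sym: "jump_grad A F \<in> sym_mat"
  by (rule sym_mat_sum) (rule sym_mat_scale[OF sym_part_in])

lemma elasticity_inner: "elasticity \<mu> lam e \<bullet> e' = 2 * \<mu> * (e \<bullet> e') + lam * (trace e * trace e')"
  by (simp add: elasticity_def inner_add_left mat1_inner_trace)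

lemma gradient_jump_form_eq:
  assumes A: "\<And>T x. T \<in> \<T> \<Longrightarrow> x \<in> interior T \<Longrightarrow> eps u x = sym_part (A T)"
    "\<And>T x. T \<in> \<T> \<Longrightarrow> x \<in> interior T \<Longrightarrow> ediv u x = trace (A T)"
  shows "gradient_jump_form \<mu> lam u u = (\<Sum>F\<in>mesh_faces \<T>. area F / diameter F * (elasticity \<mu> lam (jump_grad A F) \<bullet> jump_grad A F))"
proof -
  have je: "jump \<T> n F (eps u) x = jump_grad A F" if "x \<in> F" for x F
    using A(1) that by (intro jump_eq[where p = "\<lambda>T _. sym_part (A T)"]) auto
  have jd: "jump \<T> n F (ediv u) x = trace (jump_grad A F)" if "x \<in> F" for x F
  proof -
    have "jump \<T> n F (ediv u) x = (\<Sum>T\<in>elems F. face_sign T F *\<^sub>R trace (A T))"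
      using A(2) that by (intro jump_eq[where p = "\<lambda>T _. trace (A T)"]) auto
    also have "\<dots> = trace (jump_grad A F)"
      by (simp add: linear_sum[OF linear_trace] linear_scale[OF linear_trace] trace_sym_part)
    finally show ?thesis .
  qed
  have "face_ip (n F) F (jump \<T> n F (eps u)) (jump \<T> n F (eps u)) = area F * (jump_grad A F \<bullet> jump_grad A F)"
    "face_ip (n F) F (jump \<T> n F (ediv u)) (jump \<T> n F (ediv u)) = area F * (trace (jump_grad A F) \<bullet> trace (jump_grad A F))"
    if "F \<in> mesh_faces \<T>" for F
    using je jd by (intro face_ip_const mesh_face[OF that]; simp)+
  then show ?thesis
    unfolding gradient_jump_form_def jump_form_def sum_distrib_left sum.distrib[symmetric] elasticity_inner
    by (intro sum.cong) (simp_all add: algebra_simps)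
qed

text \<open>
  Diameter of the element, height, and diameter of the facet are all comparable to the diameter of an
  inscribed ball.
\<close>

lemma shape_regular_bounds:
  assumes reg: "shape_regular \<kappa> \<T>" and T: "T \<in> \<T>" and F: "F facet_of T"
  shows "diameter T \<le> \<kappa> * facet_height T F" "facet_height T F \<le> \<kappa> * diameter F" "0 < \<kappa>"
proof -
  note s = simplex[OF T]
  have d: "diameter T \<le> \<kappa> * inball_diameter T" using reg T by (simp add: shape_regular_def)
  have h: "0 < facet_height T F" "facet_height T F \<le> diameter T" using facet_height[OF s F] by auto
  have i: "inball_diameter T \<le> facet_height T F" "inball_diameter T \<le> diameter F"
    using inball_diameter_le_height[OF s F] inball_diameter_le_facet_diameter[OF dim s F] by auto
  have "0 \<le> inball_diameter T" using inball_diameter_nonneg[OF simplex_props(2)[OF s]] facet_props(3,4)[OF s F] by blast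
  then show k: "0 < \<kappa>" using d h mult_nonpos_nonneg[of \<kappa> "inball_diameter T"] by linarith
  show "diameter T \<le> \<kappa> * facet_height T F" using d mult_left_mono[OF i(1), of \<kappa>] k by linarith
  show "facet_height T F \<le> \<kappa> * diameter F" using h(2) d mult_left_mono[OF i(2), of \<kappa>] k by linarith
qed

text \<open>
  It depends on the dimension and on \<open>\<kappa>\<close> only; the inf-sup constant inherits its uniformity from here.
\<close>

definition recovery_constant :: "real \<Rightarrow> real" where
  "recovery_constant \<kappa> = 2 * (real CARD('n) + 1) * \<kappa> ^ 3 / ((real CARD('n))\<^sup>2 * cone_ratio TYPE('n))"

text \<open>
  Take \<open>q F\<close> proportional to the stress of the gradient jump \<open>?e F\<close> divided by the diameter of \<open>F\<close>. The
  divergence on \<open>T\<close> is then a sum over its facets, and by \<open>simplex_volume\<close> the volume of \<open>T\<close> divided by a height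
  becomes an area. Collecting the terms by faces, the two sides of a face combine into the jump of the
  gradient. For the norm, \<open>|x - a\<^sub>F| / h \<le> \<kappa>\<close> bounds the Raviart-Thomas functions pointwise, and the volume
  of \<open>T\<close> is at most a multiple of the area of \<open>F\<close> times its diameter. Each element has at most \<open>d + 1\<close> facets
  and each face belongs to at most two elements.
\<close>

lemma flux_recovery:
  assumes reg: "shape_regular \<kappa> \<T>" and par: "\<mu> > 0" "lam > 0" and u: "u \<in> W_h"
  obtains \<Psi> where "\<Psi> \<in> Sigma_h \<T> n" "form_b \<Omega> \<T> \<Psi> u = gradient_jump_form \<mu> lam u u"
    "compliance_form \<mu> lam \<Psi> \<Psi> \<le> recovery_constant \<kappa> * gradient_jump_form \<mu> lam u u"
proof -
  let ?d = "real CARD('n)" and ?\<theta> = "cone_ratio TYPE('n)"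
  have dpos: "?d > 0" "?\<theta> > 0" using cone_ratio_pos by auto
  obtain A b where A: "\<And>T x. T \<in> \<T> \<Longrightarrow> x \<in> interior T \<Longrightarrow> eps u x = sym_part (A T)"
    "\<And>T x. T \<in> \<T> \<Longrightarrow> x \<in> interior T \<Longrightarrow> ediv u x = trace (A T)"
    using gradient_pieces[OF u] by metis
  let ?e = "jump_grad A" and ?C = "elasticity \<mu> lam"
  \<comment> \<open>The factor \<open>1 / (?d * ?\<theta>)\<close> compensates the divergence \<open>?d\<close> of \<open>x\<close> and the ratio in \<open>simplex_volume\<close>.\<close>
  define k where "k = (\<lambda>F::(real^'n) set. 1 / (?d * ?\<theta> * diameter F))"
  define q where "q = (\<lambda>F. k F *\<^sub>R ?C (?e F))"
  define w where "w = (\<lambda>F. ?C (?e F) \<bullet> ?e F)"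
  have gradient_jump_form: "gradient_jump_form \<mu> lam u u = (\<Sum>F\<in>mesh_faces \<T>. area F / diameter F * w F)"
    unfolding w_def by (rule gradient_jump_form_eq[OF A])
  have w0: "0 \<le> w F" for F
    unfolding w_def elasticity_inner using par by (intro add_nonneg_nonneg) (auto simp: zero_le_mult_iff)
  have qs: "q F \<in> sym_mat" if "F \<in> mesh_faces \<T>" for F
  proof -
    have "?C (?e F) \<in> sym_mat"
      using jump_grad_sym[where A = A and F = F] unfolding elasticity_def sym_mat_def by (simp add: mat_def)
    then show ?thesis unfolding q_def by (rule sym_mat_scale)
  qed
  define \<Psi> where "\<Psi> = flux_field q"
  have Sig: "\<Psi> \<in> Sigma_h \<T> n" unfolding \<Psi>_def by (rule flux_field_Sigma[OF qs])
  have S: "\<Psi> \<in> S_h" unfolding \<Psi>_def by (rule flux_field_S[OF qs])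
  have vol: "measure lebesgue T = ?\<theta> * facet_height T F * area F" if "T \<in> \<T>" "F facet_of T" for T F
    using simplex_volume[OF simplex[OF that(1)] that(2)] mesh_face[OF mesh_faceI[OF that]] by blast
  have div: "elementwise \<T> (tens_div \<Psi>) x = ?d *\<^sub>R flux_slope q T" if T: "T \<in> \<T>" "x \<in> interior T" for T x
  proof -
    have "tens_div \<Psi> x = ?d *\<^sub>R flux_slope q T"
      unfolding \<Psi>_def by (rule tens_div_affine[OF open_interior T(2) flux_field_affine[OF T(1)]])
    then show ?thesis using T by (auto simp: elementwise_def)
  qed
  have "form_b \<Omega> \<T> \<Psi> u = (\<Sum>T\<in>\<T>. measure lebesgue T * ((?d *\<^sub>R flux_slope q T) \<bullet> sym_part (A T)))"
    unfolding form_b_def using div A(1) by (intro L2_ip_piecewise_const) (auto simp: elementwise_def)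
  also have "\<dots> = (\<Sum>T\<in>\<T>. \<Sum>F | F facet_of T. area F / diameter F * (?C (?e F) \<bullet> (face_sign T F *\<^sub>R sym_part (A T))))"
  proof (rule sum.cong[OF refl])
    fix T assume T: "T \<in> \<T>"
    have "measure lebesgue T * ((?d *\<^sub>R flux_slope q T) \<bullet> sym_part (A T)) =
        (\<Sum>F | F facet_of T. measure lebesgue T * ?d * (face_sign T F / facet_height T F) * (q F \<bullet> sym_part (A T)))"
      unfolding flux_slope_def by (simp add: inner_sum_left sum_distrib_left mult.assoc)
    also have "\<dots> = (\<Sum>F | F facet_of T. area F / diameter F * (?C (?e F) \<bullet> (face_sign T F *\<^sub>R sym_part (A T))))"
    proof (rule sum.cong[OF refl])
      fix F assume "F \<in> {F. F facet_of T}"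
      then have F: "F facet_of T" by simp
      have h: "facet_height T F \<noteq> 0" using facet_height(2)[OF simplex[OF T] F] by simp
      have "measure lebesgue T * ?d * (face_sign T F / facet_height T F) * k F = area F / diameter F * face_sign T F"
        unfolding vol[OF T F] k_def using h dpos by (simp add: field_simps)
      then show "measure lebesgue T * ?d * (face_sign T F / facet_height T F) * (q F \<bullet> sym_part (A T)) =
          area F / diameter F * (?C (?e F) \<bullet> (face_sign T F *\<^sub>R sym_part (A T)))"
        unfolding q_def inner_scaleR_left inner_scaleR_right by (simp add: mult.assoc[symmetric])
    qed
    finally show "measure lebesgue T * ((?d *\<^sub>R flux_slope q T) \<bullet> sym_part (A T)) =
       (\<Sum>F | F facet_of T. area F / diameter F * (?C (?e F) \<bullet> (face_sign T F *\<^sub>R sym_part (A T))))" .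
  qed
  also have "\<dots> = (\<Sum>F\<in>mesh_faces \<T>. \<Sum>T\<in>elems F. area F / diameter F * (?C (?e F) \<bullet> (face_sign T F *\<^sub>R sym_part (A T))))"
    by (rule sum_facets_swap)
  also have "\<dots> = gradient_jump_form \<mu> lam u u"
    unfolding gradient_jump_form w_def by (intro sum.cong refl) (simp add: inner_sum_right sum_distrib_left)
  finally have b: "form_b \<Omega> \<T> \<Psi> u = gradient_jump_form \<mu> lam u u" .
  define K where "K = (\<lambda>T. (?d + 1) * (\<Sum>F | F facet_of T. (k F)\<^sup>2 * \<kappa>\<^sup>2 * w F))"
  have ptw: "compliance \<mu> lam (\<Psi> x) \<bullet> \<Psi> x \<le> K T" if T: "T \<in> \<T>" "x \<in> interior T" for T x
  proof -
    note s = simplex[OF T(1)]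
    let ?X = "\<lambda>F. (face_sign T F / facet_height T F) *\<^sub>R tens_outer (q F) (x - opposite_vertex T F)"
    have xT: "x \<in> T" using T(2) interior_subset by blast
    have X: "compliance \<mu> lam (?X F) \<bullet> ?X F \<le> (k F)\<^sup>2 * \<kappa>\<^sup>2 * w F" and X0: "0 \<le> (k F)\<^sup>2 * \<kappa>\<^sup>2 * w F" if F: "F facet_of T" for F
    proof -
      let ?a = "opposite_vertex T F" and ?h = "facet_height T F"
      let ?c = "face_sign T F / ?h * k F"
      have h: "?h > 0" using facet_height(2)[OF s F] .
      have Xe: "?X F = ?c *\<^sub>R tens_outer (?C (?e F)) (x - ?a)" by (simp add: q_def tens_outer_lin)
      have "compliance \<mu> lam (?X F) = ?c *\<^sub>R tens_outer (?e F) (x - ?a)"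
        unfolding Xe linear_scale[OF linear_compliance] compliance_elasticity[OF par] ..
      then have "compliance \<mu> lam (?X F) \<bullet> ?X F = ?c\<^sup>2 * (w F * (norm (x - ?a))\<^sup>2)"
        unfolding Xe by (simp add: tens_outer_inner_outer w_def power2_eq_square power2_norm_eq_inner inner_commute
            flip: power2_norm_eq_inner)
      also have "?c\<^sup>2 = (k F)\<^sup>2 / ?h\<^sup>2" using face_sign(1)[OF T(1) F] by (simp add: power_mult_distrib power_divide)
      also have "(norm (x - ?a))\<^sup>2 \<le> (\<kappa> * ?h)\<^sup>2"
      proof (rule power_mono)
        have "norm (x - ?a) \<le> diameter T"
          using diameter_bounded_bound[OF compact_imp_bounded[OF simplex_props(2)[OF s]] xT opposite_vertex(1)[OF s F]]
          by (simp add: dist_norm)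
        then show "norm (x - ?a) \<le> \<kappa> * ?h" using shape_regular_bounds(1)[OF reg T(1) F] by linarith
      qed simp
      then have "(k F)\<^sup>2 / ?h\<^sup>2 * (w F * (norm (x - ?a))\<^sup>2) \<le> (k F)\<^sup>2 / ?h\<^sup>2 * (w F * (\<kappa> * ?h)\<^sup>2)"
        using w0 by (intro mult_left_mono) auto
      also have "\<dots> = (k F)\<^sup>2 * \<kappa>\<^sup>2 * w F" using h by (simp add: power_mult_distrib)
      finally show "compliance \<mu> lam (?X F) \<bullet> ?X F \<le> (k F)\<^sup>2 * \<kappa>\<^sup>2 * w F" .
      show "0 \<le> (k F)\<^sup>2 * \<kappa>\<^sup>2 * w F" using w0 by simp
    qed
    have "compliance \<mu> lam (\<Psi> x) \<bullet> \<Psi> x \<le>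
        real (card {F. F facet_of T}) * (\<Sum>F | F facet_of T. compliance \<mu> lam (?X F) \<bullet> ?X F)"
      unfolding \<Psi>_def flux_field_eq[OF T] by (rule compliance_sum_le[OF par])
    also have "\<dots> \<le> real (card {F. F facet_of T}) * (\<Sum>F | F facet_of T. (k F)\<^sup>2 * \<kappa>\<^sup>2 * w F)"
      using X by (intro mult_left_mono sum_mono) auto
    also have "\<dots> \<le> K T" unfolding K_def
    proof (rule mult_right_mono)
      show "real (card {F. F facet_of T}) \<le> ?d + 1" using simplex_facets_finite(2)[OF s] by simp
      show "0 \<le> (\<Sum>F | F facet_of T. (k F)\<^sup>2 * \<kappa>\<^sup>2 * w F)" using X0 by (intro sum_nonneg) auto
    qed
    finally show ?thesis .
  qed
  have "(\<lambda>x. compliance \<mu> lam (\<Psi> x)) \<in> pcont"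
    using lin_map_pointwise[OF S_sub_pcont linear_compliance] S by (simp add: lin_map_def)
  then have "compliance_form \<mu> lam \<Psi> \<Psi> \<le> (\<Sum>T\<in>\<T>. measure lebesgue T * K T)"
    unfolding compliance_form_def using S_pcont[OF S] ptw by (rule L2_ip_piecewise_le)
  also have "\<dots> \<le> (\<Sum>T\<in>\<T>. \<Sum>F | F facet_of T. recovery_constant \<kappa> / 2 * (area F / diameter F * w F))"
  proof (rule sum_mono)
    fix T assume T: "T \<in> \<T>"
    have "measure lebesgue T * K T = (\<Sum>F | F facet_of T. measure lebesgue T * ((?d + 1) * ((k F)\<^sup>2 * \<kappa>\<^sup>2 * w F)))"
      by (simp add: K_def sum_distrib_left)
    also have "\<dots> \<le> (\<Sum>F | F facet_of T. recovery_constant \<kappa> / 2 * (area F / diameter F * w F))"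
    proof (rule sum_mono)
      fix F assume "F \<in> {F. F facet_of T}"
      then have F: "F facet_of T" by simp
      have D: "diameter F > 0" using diameter_face_pos[OF mesh_faceI[OF T F]] .
      have "measure lebesgue T \<le> ?\<theta> * (\<kappa> * diameter F) * area F"
        unfolding vol[OF T F] using shape_regular_bounds(2)[OF reg T F] dpos
        by (intro mult_right_mono mult_left_mono) auto
      then have "measure lebesgue T * ((?d + 1) * ((k F)\<^sup>2 * \<kappa>\<^sup>2 * w F)) \<le>
          ?\<theta> * (\<kappa> * diameter F) * area F * ((?d + 1) * ((k F)\<^sup>2 * \<kappa>\<^sup>2 * w F))"
        using w0 by (intro mult_right_mono mult_nonneg_nonneg) auto
      also have "\<dots> = recovery_constant \<kappa> / 2 * (area F / diameter F * w F)"
        unfolding recovery_constant_def k_def using dpos D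
        by (simp add: field_simps power2_eq_square power3_eq_cube)
      finally show "measure lebesgue T * ((?d + 1) * ((k F)\<^sup>2 * \<kappa>\<^sup>2 * w F)) \<le>
         recovery_constant \<kappa> / 2 * (area F / diameter F * w F)" .
    qed
    finally show "measure lebesgue T * K T \<le>
       (\<Sum>F | F facet_of T. recovery_constant \<kappa> / 2 * (area F / diameter F * w F))" .
  qed
  also have "\<dots> = (\<Sum>F\<in>mesh_faces \<T>. \<Sum>T\<in>elems F. recovery_constant \<kappa> / 2 * (area F / diameter F * w F))"
    by (rule sum_facets_swap)
  also have "\<dots> \<le> (\<Sum>F\<in>mesh_faces \<T>. recovery_constant \<kappa> * (area F / diameter F * w F))"
  proof (rule sum_mono)
    fix F assume Fm: "F \<in> mesh_faces \<T>"
    then obtain T where T: "T \<in> \<T>" "F facet_of T" by (auto simp: mesh_faces_def)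
    have "0 < \<kappa>" using shape_regular_bounds(3)[OF reg T] .
    then have r: "0 \<le> recovery_constant \<kappa>" using dpos by (simp add: recovery_constant_def)
    have "0 \<le> recovery_constant \<kappa> / 2 * (area F / diameter F * w F)"
      using r w0 diameter_face_pos[OF Fm] by (intro mult_nonneg_nonneg divide_nonneg_nonneg) auto
    then have "real (card (elems F)) * (recovery_constant \<kappa> / 2 * (area F / diameter F * w F)) \<le>
        2 * (recovery_constant \<kappa> / 2 * (area F / diameter F * w F))"
      using card_elems[of F] by (intro mult_right_mono) auto
    then show "(\<Sum>T\<in>elems F. recovery_constant \<kappa> / 2 * (area F / diameter F * w F)) \<le>
        recovery_constant \<kappa> * (area F / diameter F * w F)" by simp
  qed
  also have "\<dots> = recovery_constant \<kappa> * gradient_jump_form \<mu> lam u u" unfolding gradient_jump_form by (simp add: sum_distrib_left)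
  finally show ?thesis using that[OF Sig b] by blast
qed

end

section \<open>Inf-sup stability and well-posedness\<close>

context mesh
begin

lemma form_b_lin:
  shows "u \<in> W_h \<Longrightarrow> lin_on S_h (\<lambda>\<Psi>. form_b \<Omega> \<T> \<Psi> u)" "\<Psi> \<in> S_h \<Longrightarrow> lin_on W_h (form_b \<Omega> \<T> \<Psi>)"
  unfolding form_b_def L2_ip_eq
  using lin_on_ip(2)[OF lin_op_L2[OF lin_map_tens_div]] lin_on_ip(1)[OF lin_op_L2[OF lin_map_sym_grad]]
    eps_sqint lin_op_L2[OF lin_map_tens_div] by (auto simp: lin_op_def)

lemma form_a_eq: "form_a \<Omega> \<mu> lam \<iota> \<Phi> \<Psi> = compliance_form \<mu> lam \<Phi> \<Psi> / \<iota>\<^sup>2"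
  by (simp add: form_a_def compliance_form_def)

lemma norm_A_eq: "norm_A \<Omega> \<mu> lam \<Psi> = sqrt (compliance_form \<mu> lam \<Psi> \<Psi>)"
  by (simp add: norm_A_def compliance_form_def)

lemma Sigma_S: "\<Psi> \<in> Sigma_h \<T> n \<Longrightarrow> \<Psi> \<in> S_h" and V_W: "v \<in> V_h \<T> n \<Longrightarrow> v \<in> W_h"
  using Sigma_sub V_sub by blast+

lemma zero_Sigma: "(\<lambda>_. 0) \<in> Sigma_h \<T> n" and zero_V: "(\<lambda>_. 0) \<in> V_h \<T> n"
  using lin_sub_Sigma lin_sub_V by (simp_all add: lin_sub_def)

abbreviation total_form :: "real \<Rightarrow> real \<Rightarrow> real \<Rightarrow> (real^'n \<Rightarrow> real^'n^'n^'n) \<Rightarrow> (real^'n \<Rightarrow> real^'n)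
    \<Rightarrow> (real^'n \<Rightarrow> real^'n^'n^'n) \<Rightarrow> (real^'n \<Rightarrow> real^'n) \<Rightarrow> real" where
  "total_form \<mu> lam \<iota> \<Phi> u \<Psi> v \<equiv> form_a \<Omega> \<mu> lam \<iota> \<Phi> \<Psi> + form_b \<Omega> \<T> \<Psi> u
     + form_b \<Omega> \<T> \<Phi> v - form_c \<Omega> \<T> n \<mu> lam u v"

abbreviation pair_norm :: "real \<Rightarrow> real \<Rightarrow> real \<Rightarrow> (real^'n \<Rightarrow> real^'n^'n^'n) \<Rightarrow> (real^'n \<Rightarrow> real^'n) \<Rightarrow> real" where
  "pair_norm \<mu> lam \<iota> \<Psi> v \<equiv> norm_A \<Omega> \<mu> lam \<Psi> / \<iota> + norm_ih \<Omega> \<T> n \<mu> lam \<iota> v"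

lemma pair_norm_pos:
  assumes par: "\<mu> > 0" "lam > 0" "\<iota> > 0" and \<Psi>: "\<Psi> \<in> S_h" and v: "v \<in> W_h"
    and nz: "(\<Psi>, v) \<noteq> (\<lambda>_. 0, \<lambda>_. 0)"
  shows "0 < pair_norm \<mu> lam \<iota> \<Psi> v"
proof -
  have a: "0 \<le> compliance_form \<mu> lam \<Psi> \<Psi>" using psd_formD(3)[OF psd_compliance_form[OF par(1,2)] \<Psi>] .
  have q: "0 \<le> gradient_jump_form \<mu> lam v v" using psd_formD(3)[OF psd_gradient_jump_form[OF par(1,2)] v] .
  have c: "0 \<le> form_c \<Omega> \<T> n \<mu> lam v v" using psd_formD(3)[OF psd_form_c[OF par(1,2)] v] .
  have "compliance_form \<mu> lam \<Psi> \<Psi> \<noteq> 0 \<or> form_c \<Omega> \<T> n \<mu> lam v v \<noteq> 0"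
    using nz compliance_form_definite[OF par(1,2) \<Psi>] form_c_definite[OF par(1,2) v] by auto
  then have "0 < compliance_form \<mu> lam \<Psi> \<Psi> \<or> 0 < ih_form \<mu> lam \<iota> v v"
    using a c q by (auto simp: ih_form_def add_nonneg_pos)
  moreover have "0 \<le> ih_form \<mu> lam \<iota> v v" using q c by (simp add: ih_form_def)
  ultimately show ?thesis
    unfolding norm_A_eq norm_ih_eq[OF par(1,2) v] using a par(3)
    by (auto intro: add_pos_nonneg add_nonneg_pos)
qed

text \<open>
  A nonzero element of \<open>Sigma_h\<close>. It keeps the supremum nonnegative when \<open>(\<Phi>, u) = 0\<close>.
\<close>

definition const_tensor :: "real^'n \<Rightarrow> real^'n^'n^'n" where
  "const_tensor = elementwise \<T> (\<lambda>_. tens_outer (mat 1) (axis (SOME k. True) 1))"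

lemma const_tensor: "const_tensor \<in> Sigma_h \<T> n" "const_tensor \<noteq> (\<lambda>_. 0)"
proof -
  define E :: "real^'n^'n^'n" where "E = tens_outer (mat 1) (axis (SOME k. True) 1)"
  have E: "const_tensor x = E" if "T \<in> \<T>" "x \<in> interior T" for T x
    using that by (auto simp: const_tensor_def elementwise_def E_def)
  have "E \<in> sym_tens" by (simp add: E_def sym_tens_def tens_outer_def mat_def)
  moreover have "0 \<in> sym_mat" by (simp add: sym_mat_def)
  ultimately have loc: "(\<lambda>x. E + tens_outer 0 x) \<in> Sigma_loc" unfolding Sigma_loc_def by blast
  have e0: "E + tens_outer 0 x = E" for x by (simp add: tens_outer_def vec_eq_iff)
  have "const_tensor \<in> piecewise \<T> Sigma_loc"
    unfolding piecewise_def
    using loc E e0 by (auto simp: const_tensor_def elementwise_def intro!: bexI[of _ "\<lambda>x. E + tens_outer 0 x"])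
  moreover have tr: "elem_trace T const_tensor x = E" if "T \<in> \<T>" "x \<in> T" for T x
    using that E by (intro elem_trace_eq[where p = "\<lambda>_. E"]) auto
  have "face_ip (n F) F (\<lambda>x. tens_vec (elem_trace T const_tensor x) (n F)) (\<lambda>_. r) = face_ip (n F) F (\<lambda>_. tens_vec E (n F)) (\<lambda>_. r)"
    if "T \<in> \<T>" "F facet_of T" for T F r
    unfolding face_ip_def using tr[OF that(1)] subsetD[OF facet_of_imp_subset[OF that(2)]]
    by (intro Bochner_Integration.integral_cong) (auto simp: space_face_measure)
  ultimately show "const_tensor \<in> Sigma_h \<T> n" by (simp add: Sigma_h_def)
  obtain T x where T: "T \<in> \<T>" "x \<in> interior T"
    using mesh_nonempty simplex_props(5)[OF simplex] by (metis all_not_in_conv)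
  have "E \<noteq> 0"
  proof
    assume "E = 0"
    then have "E $ undefined $ undefined $ (SOME k. True) = 0" by simp
    then show False by (simp add: E_def tens_outer_def mat_def)
  qed
  then show "const_tensor \<noteq> (\<lambda>_. 0)" using E[OF T] by metis
qed

text \<open>
  The test pair is \<open>(\<Phi> + \<theta> R, - u)\<close> with the field \<open>R\<close> of \<open>flux_recovery\<close> and \<open>\<theta> = \<iota>\<^sup>2 / M\<close>. The two
  occurrences of \<open>b\<^sub>h(\<Phi>, u)\<close> cancel, \<open>\<theta> b\<^sub>h(R, u)\<close> supplies the missing part \<open>Y\<^sup>2 / M\<close>, and the only term without sign,
  \<open>\<theta> a(\<Phi>, R)\<close>, is at most \<open>X Y\<close> divided by the root of \<open>M\<close>. Young's inequality absorbs it into half of \<open>X\<^sup>2\<close> and half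
  of \<open>Y\<^sup>2 / M\<close>.
\<close>

lemma inf_sup_test_pair:
  assumes reg: "shape_regular \<kappa> \<T>" and par: "\<mu> > 0" "lam > 0" "\<iota> > 0"
    and M: "M \<ge> 1" "M \<ge> recovery_constant \<kappa>"
    and \<Phi>: "\<Phi> \<in> Sigma_h \<T> n" and u: "u \<in> V_h \<T> n"
  obtains \<Psi> v where "\<Psi> \<in> Sigma_h \<T> n" "v \<in> V_h \<T> n"
    "pair_norm \<mu> lam \<iota> \<Psi> v \<le> 2 * pair_norm \<mu> lam \<iota> \<Phi> u"
    "(pair_norm \<mu> lam \<iota> \<Phi> u)\<^sup>2 \<le> 4 * M * total_form \<mu> lam \<iota> \<Phi> u \<Psi> v"
proof -
  let ?c = "form_c \<Omega> \<T> n \<mu> lam" and ?b = "form_b \<Omega> \<T>" and ?a = "compliance_form \<mu> lam"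
  note S = Sigma_S[OF \<Phi>] and W = V_W[OF u]
  note pa = psd_compliance_form[OF par(1,2)] and pq = psd_gradient_jump_form[OF par(1,2)] and pc = psd_form_c[OF par(1,2)]
  obtain R where R: "R \<in> Sigma_h \<T> n" "?b R u = gradient_jump_form \<mu> lam u u" "?a R R \<le> recovery_constant \<kappa> * gradient_jump_form \<mu> lam u u"
    using flux_recovery[OF reg par(1,2) W] by metis
  note SR = Sigma_S[OF R(1)]
  define \<theta> where "\<theta> = \<iota>\<^sup>2 / M"
  define \<Psi> where "\<Psi> = (\<lambda>x. \<Phi> x + \<theta> *\<^sub>R R x)"
  define v where "v = (\<lambda>x. (- 1) *\<^sub>R u x)"
  have \<Psi>: "\<Psi> \<in> Sigma_h \<T> n" unfolding \<Psi>_def by (rule lin_subD[OF lin_sub_Sigma \<Phi> R(1)])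
  have v: "v \<in> V_h \<T> n" unfolding v_def by (rule lin_sub_scale[OF lin_sub_V u])
  have scale: "l v = - l u" if "lin_on W_h l" for l
    using lin_on_scale[OF lin_sub_W that W, of "- 1"] by (simp add: v_def)
  have neg: "B v v = B u u" if "psd_form W_h B" for B
    using scale[OF psd_formD(1)[OF that V_W[OF v]]] scale[OF psd_formD(1)[OF that W]]
      psd_formD(2)[OF that V_W[OF v] W] by simp
  define X where "X = sqrt (?a \<Phi> \<Phi>) / \<iota>"
  define Y where "Y = \<iota> * sqrt (gradient_jump_form \<mu> lam u u)"
  define Z where "Z = sqrt (ih_form \<mu> lam \<iota> u u)"
  have a0: "0 \<le> ?a \<Phi> \<Phi>" and q0: "0 \<le> gradient_jump_form \<mu> lam u u" and c0: "0 \<le> ?c u u"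
    using psd_formD(3)[OF pa S] psd_formD(3)[OF pq W] psd_formD(3)[OF pc W] by auto
  have X0: "0 \<le> X" and Y0: "0 \<le> Y" and Z0: "0 \<le> Z"
    using par a0 q0 c0 by (auto simp: X_def Y_def Z_def ih_form_def)
  have X2: "X\<^sup>2 = ?a \<Phi> \<Phi> / \<iota>\<^sup>2" using a0 by (simp add: X_def power_divide)
  have Y2: "Y\<^sup>2 = \<iota>\<^sup>2 * gradient_jump_form \<mu> lam u u" using q0 by (simp add: Y_def power_mult_distrib)
  have Z2: "Z\<^sup>2 = Y\<^sup>2 + ?c u u" using q0 c0 unfolding Y2 by (simp add: Z_def ih_form_def)
  have YZ: "Y \<le> Z" by (rule power2_le_imp_le) (use Z2 c0 Z0 in auto)
  have sM: "1 \<le> sqrt M" "sqrt M * sqrt M = M" using M(1) by auto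
  have nR: "sqrt (?a R R) \<le> sqrt M * sqrt (gradient_jump_form \<mu> lam u u)"
  proof -
    have "?a R R \<le> M * gradient_jump_form \<mu> lam u u" using R(3) mult_right_mono[OF M(2) q0] by linarith
    then show ?thesis by (metis real_sqrt_le_mono real_sqrt_mult)
  qed
  have N: "pair_norm \<mu> lam \<iota> \<Phi> u = X + Z"
    by (simp add: norm_A_eq norm_ih_eq[OF par(1,2) W] X_def Z_def)
  have "norm_ih \<Omega> \<T> n \<mu> lam \<iota> v = Z"
    unfolding norm_ih_eq[OF par(1,2) V_W[OF v]] Z_def ih_form_def neg[OF pq] neg[OF pc] ..
  moreover have "norm_A \<Omega> \<mu> lam \<Psi> / \<iota> \<le> X + Y"
  proof -
    have "norm_A \<Omega> \<mu> lam \<Psi> \<le> sqrt (?a \<Phi> \<Phi>) + \<bar>\<theta>\<bar> * sqrt (?a R R)"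
      unfolding norm_A_eq \<Psi>_def by (rule psd_triangle[OF lin_sub_S pa S SR])
    also have "\<bar>\<theta>\<bar> * sqrt (?a R R) \<le> (\<iota>\<^sup>2 / M) * (sqrt M * sqrt (gradient_jump_form \<mu> lam u u))"
      using nR M(1) by (simp add: \<theta>_def mult_left_mono divide_right_mono)
    also have "\<dots> = \<iota> * (Y / sqrt M)" using sM by (simp add: Y_def field_simps power2_eq_square)
    also have "\<dots> \<le> \<iota> * Y"
    proof (rule mult_left_mono)
      have "Y * 1 \<le> Y * sqrt M" using Y0 sM(1) by (intro mult_left_mono) auto
      then show "Y / sqrt M \<le> Y" using sM(1) by (simp add: divide_le_eq)
    qed (use par(3) in simp)
    finally have "norm_A \<Omega> \<mu> lam \<Psi> \<le> sqrt (?a \<Phi> \<Phi>) + \<iota> * Y" by simp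
    then have "norm_A \<Omega> \<mu> lam \<Psi> / \<iota> \<le> (sqrt (?a \<Phi> \<Phi>) + \<iota> * Y) / \<iota>" using par(3) by (simp add: divide_right_mono)
    also have "\<dots> = X + Y" using par(3) by (simp add: X_def field_simps)
    finally show ?thesis .
  qed
  ultimately have "pair_norm \<mu> lam \<iota> \<Psi> v \<le> (X + Y) + Z" by (simp only: add_right_mono)
  also have "\<dots> \<le> 2 * (X + Z)" using X0 YZ by simp
  finally have size: "pair_norm \<mu> lam \<iota> \<Psi> v \<le> 2 * pair_norm \<mu> lam \<iota> \<Phi> u" unfolding N .
  have A: "?a \<Phi> \<Psi> = ?a \<Phi> \<Phi> + \<theta> * ?a \<Phi> R"
    unfolding \<Psi>_def by (rule lin_onD[OF psd_formD(1)[OF pa S] S SR])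
  have B: "?b \<Psi> u = ?b \<Phi> u + \<theta> * gradient_jump_form \<mu> lam u u"
    unfolding \<Psi>_def R(2)[symmetric] by (rule lin_onD[OF form_b_lin(1)[OF W] S SR])
  have t: "total_form \<mu> lam \<iota> \<Phi> u \<Psi> v = X\<^sup>2 + ?a \<Phi> R / M + Y\<^sup>2 / M + ?c u u"
    unfolding form_a_eq A B scale[OF form_b_lin(2)[OF S]] scale[OF psd_formD(1)[OF pc W]] X2 Y2
    using par(3) M(1) by (simp add: \<theta>_def add_divide_distrib)
  have "\<bar>?a \<Phi> R\<bar> \<le> sqrt (?a \<Phi> \<Phi>) * sqrt (?a R R)" by (rule psd_cauchy_schwarz[OF lin_sub_S pa S SR])
  also have "\<dots> \<le> sqrt (?a \<Phi> \<Phi>) * (sqrt M * sqrt (gradient_jump_form \<mu> lam u u))" using nR a0 by (intro mult_left_mono) auto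
  also have "\<dots> = sqrt M * (X * Y)" using par(3) by (simp add: X_def Y_def)
  finally have cs: "\<bar>?a \<Phi> R\<bar> \<le> sqrt M * (X * Y)" .
  have "2 * (sqrt M * X) * Y \<le> M * X\<^sup>2 + Y\<^sup>2"
    using sum_squares_bound[of "sqrt M * X" Y] M(1) by (simp add: power_mult_distrib)
  then have low: "- (M * X\<^sup>2 + Y\<^sup>2) \<le> 2 * ?a \<Phi> R" using cs by (simp add: abs_le_iff)
  have gap: "?c u u \<le> M * ?c u u" "X\<^sup>2 \<le> M * X\<^sup>2" using M(1) c0 mult_right_mono[of 1 M] by auto
  have "2 * X\<^sup>2 + 2 * Z\<^sup>2 \<le> 4 * (M * X\<^sup>2) + 4 * ?a \<Phi> R + 4 * Y\<^sup>2 + 4 * (M * ?c u u)"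
  proof -
    have "2 * x + 2 * (y + c) \<le> 4 * mx + 4 * r + 4 * y + 4 * mc"
      if "- (mx + y) \<le> 2 * r" "c \<le> mc" "x \<le> mx" "0 \<le> c" for x y c mx r mc :: real
      using that by argo
    from this[OF low gap c0] show ?thesis unfolding Z2 .
  qed
  also have "\<dots> = 4 * M * total_form \<mu> lam \<iota> \<Phi> u \<Psi> v"
    unfolding t using M(1) by (simp add: field_simps)
  finally have "2 * X\<^sup>2 + 2 * Z\<^sup>2 \<le> 4 * M * total_form \<mu> lam \<iota> \<Phi> u \<Psi> v" .
  moreover have "(X + Z)\<^sup>2 \<le> 2 * X\<^sup>2 + 2 * Z\<^sup>2" using sum_squares_bound[of X Z] by (simp add: power2_sum)
  ultimately have "(pair_norm \<mu> lam \<iota> \<Phi> u)\<^sup>2 \<le> 4 * M * total_form \<mu> lam \<iota> \<Phi> u \<Psi> v"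
    unfolding N by (rule order_trans[rotated])
  then show ?thesis using that \<Psi> v size by blast
qed

text \<open>
  For a nonzero pair the quotient for the test pair just found is large enough. For the zero pair
  every quotient vanishes, and the supremum is over a nonempty set.
\<close>

lemma inf_sup:
  assumes reg: "shape_regular \<kappa> \<T>" and par: "\<mu> > 0" "lam > 0" "\<iota> > 0"
    and M: "M \<ge> 1" "M \<ge> recovery_constant \<kappa>"
    and \<Phi>: "\<Phi> \<in> Sigma_h \<T> n" and u: "u \<in> V_h \<T> n"
  shows "ereal (pair_norm \<mu> lam \<iota> \<Phi> u) \<le> ereal (8 * M) *
    (SUP (\<Psi>, v) \<in> Sigma_h \<T> n \<times> V_h \<T> n - {(\<lambda>_. 0, \<lambda>_. 0)}.
       ereal (total_form \<mu> lam \<iota> \<Phi> u \<Psi> v / pair_norm \<mu> lam \<iota> \<Psi> v))"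
proof -
  let ?N = "pair_norm \<mu> lam \<iota>" and ?B = "total_form \<mu> lam \<iota> \<Phi> u"
  have "\<exists>\<Psi> v. \<Psi> \<in> Sigma_h \<T> n \<and> v \<in> V_h \<T> n \<and> (\<Psi>, v) \<noteq> (\<lambda>_. 0, \<lambda>_. 0) \<and> ?N \<Phi> u \<le> 8 * M * (?B \<Psi> v / ?N \<Psi> v)"
  proof (cases "(\<Phi>, u) = (\<lambda>_. 0, \<lambda>_. 0)")
    case True
    have "?B \<Psi> v = 0" if "\<Psi> \<in> S_h" "v \<in> W_h" for \<Psi> v
    proof -
      have "compliance_form \<mu> lam (\<lambda>_. 0) \<Psi> = 0" "form_c \<Omega> \<T> n \<mu> lam (\<lambda>_. 0) v = 0"
        using psd_formD(2)[OF psd_compliance_form[OF par(1,2)] Sigma_S[OF zero_Sigma] that(1)]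
          lin_on_zero[OF lin_sub_S psd_formD(1)[OF psd_compliance_form[OF par(1,2)] that(1)]]
          psd_formD(2)[OF psd_form_c[OF par(1,2)] V_W[OF zero_V] that(2)]
          lin_on_zero[OF lin_sub_W psd_formD(1)[OF psd_form_c[OF par(1,2)] that(2)]] by simp_all
      moreover have "form_b \<Omega> \<T> \<Psi> (\<lambda>_. 0) = 0" "form_b \<Omega> \<T> (\<lambda>_. 0) v = 0"
        using lin_on_zero[OF lin_sub_W form_b_lin(2)[OF that(1)]] lin_on_zero[OF lin_sub_S form_b_lin(1)[OF that(2)]] by auto
      ultimately show ?thesis using True by (simp add: form_a_eq)
    qed
    then have "?B const_tensor (\<lambda>_. 0) = 0" using const_tensor(1) zero_V Sigma_S V_W by blast
    moreover have "?N \<Phi> u = 0"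
    proof -
      have z: "compliance_form \<mu> lam (\<lambda>_. 0) (\<lambda>_. 0) = 0"
        by (rule lin_on_zero[OF lin_sub_S psd_formD(1)[OF psd_compliance_form[OF par(1,2)] Sigma_S[OF zero_Sigma]]])
      have z': "form_c \<Omega> \<T> n \<mu> lam (\<lambda>_. 0) (\<lambda>_. 0) = 0" "gradient_jump_form \<mu> lam (\<lambda>_. 0) (\<lambda>_. 0) = 0"
        by (rule lin_on_zero[OF lin_sub_W psd_formD(1)[OF psd_form_c[OF par(1,2)] V_W[OF zero_V]]],
            rule lin_on_zero[OF lin_sub_W psd_formD(1)[OF psd_gradient_jump_form[OF par(1,2)] V_W[OF zero_V]]])
      show ?thesis using True norm_ih_eq[OF par(1,2) V_W[OF zero_V]] by (simp add: norm_A_eq ih_form_def z z')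
    qed
    ultimately show ?thesis using const_tensor zero_V by (intro exI[of _ const_tensor] exI[of _ "\<lambda>_. 0"]) simp
  next
    case False
    have pos: "0 < ?N \<Phi> u" by (rule pair_norm_pos[OF par Sigma_S[OF \<Phi>] V_W[OF u] False])
    obtain \<Psi> v where t: "\<Psi> \<in> Sigma_h \<T> n" "v \<in> V_h \<T> n" "?N \<Psi> v \<le> 2 * ?N \<Phi> u"
      "(?N \<Phi> u)\<^sup>2 \<le> 4 * M * ?B \<Psi> v"
      using inf_sup_test_pair[OF reg par M \<Phi> u] by metis
    have "0 < (?N \<Phi> u)\<^sup>2" using pos by simp
    then have "0 < 4 * M * ?B \<Psi> v" using t(4) by linarith
    then have Bpos: "0 < ?B \<Psi> v" using M(1) by (simp add: zero_less_mult_iff)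
    have nz: "(\<Psi>, v) \<noteq> (\<lambda>_. 0, \<lambda>_. 0)"
    proof
      assume "(\<Psi>, v) = (\<lambda>_. 0, \<lambda>_. 0)"
      then have "?B \<Psi> v = 0"
        using lin_on_zero[OF lin_sub_S psd_formD(1)[OF psd_compliance_form[OF par(1,2)] Sigma_S[OF \<Phi>]]]
          lin_on_zero[OF lin_sub_W psd_formD(1)[OF psd_form_c[OF par(1,2)] V_W[OF u]]]
          lin_on_zero[OF lin_sub_W form_b_lin(2)[OF Sigma_S[OF \<Phi>]]]
          lin_on_zero[OF lin_sub_S form_b_lin(1)[OF V_W[OF u]]] by (simp add: form_a_eq)
      then show False using Bpos by simp
    qed
    have Np: "0 < ?N \<Psi> v" by (rule pair_norm_pos[OF par Sigma_S[OF t(1)] V_W[OF t(2)] nz])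
    have "?N \<Phi> u * ?N \<Psi> v \<le> ?N \<Phi> u * (2 * ?N \<Phi> u)" using t(3) pos by (intro mult_left_mono) auto
    also have "\<dots> = 2 * (?N \<Phi> u)\<^sup>2" by (simp only: power2_eq_square mult.left_commute)
    also have "\<dots> \<le> 8 * M * ?B \<Psi> v" using t(4) by linarith
    finally have "?N \<Phi> u \<le> 8 * M * ?B \<Psi> v / ?N \<Psi> v" using Np by (simp add: pos_le_divide_eq)
    then show ?thesis using t(1,2) nz by auto
  qed
  then obtain \<Psi> v where t: "\<Psi> \<in> Sigma_h \<T> n" "v \<in> V_h \<T> n" "(\<Psi>, v) \<noteq> (\<lambda>_. 0, \<lambda>_. 0)"
    "?N \<Phi> u \<le> 8 * M * (?B \<Psi> v / ?N \<Psi> v)" by blast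
  have "ereal (?N \<Phi> u) \<le> ereal (8 * M) * ereal (?B \<Psi> v / ?N \<Psi> v)" using t(4) by simp
  also have "\<dots> \<le> ereal (8 * M) * (SUP (\<Psi>, v) \<in> Sigma_h \<T> n \<times> V_h \<T> n - {(\<lambda>_. 0, \<lambda>_. 0)}. ereal (?B \<Psi> v / ?N \<Psi> v))"
  proof (rule ereal_mult_left_mono)
    show "ereal (?B \<Psi> v / ?N \<Psi> v) \<le> (SUP (\<Psi>, v) \<in> Sigma_h \<T> n \<times> V_h \<T> n - {(\<lambda>_. 0, \<lambda>_. 0)}. ereal (?B \<Psi> v / ?N \<Psi> v))"
      by (rule SUP_upper2[of "(\<Psi>, v)"]) (use t in auto)
    show "0 \<le> ereal (8 * M)" using M(1) by simp
  qed
  finally show ?thesis .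
qed

lemma form_c_controls:
  assumes par: "\<mu> > 0" "lam > 0" and P: "psd_form W_h P"
  obtains K where "K \<ge> 0" "\<And>v. v \<in> W_h \<Longrightarrow> P v v \<le> K * form_c \<Omega> \<T> n \<mu> lam v v"
proof -
  define E where "E = (\<lambda>(y, b). \<lambda>v::real^'n \<Rightarrow> real^'n. v y \<bullet> b) ` ((\<Union>T\<in>\<T>. nodes T) \<times> Basis)"
  have fin: "finite E" unfolding E_def using finite_nodes by (intro finite_imageI finite_cartesian_product) auto
  have lin: "\<forall>l\<in>E. lin_on W_h l"
    by (auto simp: E_def lin_on_def inner_add_left)
  have sep: "\<forall>v\<in>W_h. (\<forall>l\<in>E. l v = 0) \<longrightarrow> v = (\<lambda>_. 0)"
  proof (intro ballI impI)
    fix v assume v: "v \<in> W_h" and z: "\<forall>l\<in>E. l v = 0"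
    show "v = (\<lambda>_. 0)"
    proof (rule nodes_unisolvent_W[OF v])
      fix T y assume "T \<in> \<T>" "y \<in> nodes T"
      then have "v y \<bullet> b = 0" if "b \<in> Basis" for b using z that by (force simp: E_def)
      then show "v y = 0" by (rule euclidean_all_zero_iff[THEN iffD1, OF ballI])
    qed
  qed
  have pos: "\<forall>v\<in>W_h. v \<noteq> (\<lambda>_. 0) \<longrightarrow> 0 < form_c \<Omega> \<T> n \<mu> lam v v"
    using psd_formD(3)[OF psd_form_c[OF par]] form_c_definite[OF par] by (metis order_le_less)
  show ?thesis
    using psd_form_bounded[OF fin lin_sub_W lin sep psd_form_c[OF par] pos P] that by blast
qed

text \<open>
  With the sign of the second equation reversed, the terms \<open>b\<^sub>h(\<Phi>, u)\<close> cancel on the diagonal, and what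
  remains is definite. So \<open>lax_milgram\<close> applies to the pairs, encoded as functions with values in a product.
\<close>

lemma mixed_solvable:
  assumes par: "\<mu> > 0" "lam > 0" "\<iota> > 0" and L: "lin_on (V_h \<T> n) L"
  obtains \<Phi> u where "\<Phi> \<in> Sigma_h \<T> n" "u \<in> V_h \<T> n"
    "\<And>\<Psi>. \<Psi> \<in> Sigma_h \<T> n \<Longrightarrow> form_a \<Omega> \<mu> lam \<iota> \<Phi> \<Psi> + form_b \<Omega> \<T> \<Psi> u = 0"
    "\<And>v. v \<in> V_h \<T> n \<Longrightarrow> form_b \<Omega> \<T> \<Phi> v - form_c \<Omega> \<T> n \<mu> lam u v = - L v"
proof -
  define s :: "(real^'n \<Rightarrow> (real^'n^'n^'n) \<times> (real^'n)) \<Rightarrow> real^'n \<Rightarrow> real^'n^'n^'n" where "s = (\<lambda>f x. fst (f x))"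
  define t :: "(real^'n \<Rightarrow> (real^'n^'n^'n) \<times> (real^'n)) \<Rightarrow> real^'n \<Rightarrow> real^'n" where "t = (\<lambda>f x. snd (f x))"
  define X where "X = {f. s f \<in> Sigma_h \<T> n \<and> t f \<in> V_h \<T> n}"
  have st: "s (\<lambda>x. f x + c *\<^sub>R g x) = (\<lambda>x. s f x + c *\<^sub>R s g x)" "t (\<lambda>x. f x + c *\<^sub>R g x) = (\<lambda>x. t f x + c *\<^sub>R t g x)"
    for f g c by (simp_all add: s_def t_def)
  have st0: "s (\<lambda>_. 0) = (\<lambda>_. 0)" "t (\<lambda>_. 0) = (\<lambda>_. 0)" by (simp_all add: s_def t_def)
  have X: "lin_sub X" unfolding lin_sub_def X_def mem_Collect_eq st st0
    using zero_Sigma zero_V lin_subD[OF lin_sub_Sigma] lin_subD[OF lin_sub_V] by blast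
  have Xs: "s f \<in> S_h" and Xt: "t f \<in> W_h" and XV: "t f \<in> V_h \<T> n" if "f \<in> X" for f
    using that Sigma_S V_W by (auto simp: X_def)
  have lin_s: "lin_on X (\<lambda>f. l (s f))" if "lin_on S_h l" for l
    using lin_onD[OF that] Xs by (simp add: lin_on_def st)
  have lin_t: "lin_on X (\<lambda>f. l (t f))" if "lin_on W_h l" for l
    using lin_onD[OF that] Xt by (simp add: lin_on_def st)
  have lin4: "lin_on X (\<lambda>f. k1 f / r + k2 f - k3 f + k4 f)"
    if "lin_on X k1" "lin_on X k2" "lin_on X k3" "lin_on X k4" for k1 k2 k3 k4 and r :: real
    using that by (simp add: lin_on_def add_divide_distrib algebra_simps)
  let ?a = "compliance_form \<mu> lam" and ?b = "form_b \<Omega> \<T>" and ?c = "form_c \<Omega> \<T> n \<mu> lam"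
  note pa = psd_compliance_form[OF par(1,2)] and pc = psd_form_c[OF par(1,2)]
  define B where "B = (\<lambda>f g. ?a (s f) (s g) / \<iota>\<^sup>2 + ?b (s g) (t f) - ?b (s f) (t g) + ?c (t f) (t g))"
  have B1: "\<forall>f\<in>X. lin_on X (B f)" unfolding B_def
    using lin4[OF lin_s[OF psd_formD(1)[OF pa]] lin_s[OF form_b_lin(1)] lin_t[OF form_b_lin(2)] lin_t[OF psd_formD(1)[OF pc]]]
      Xs Xt by blast
  have B2: "\<forall>g\<in>X. lin_on X (\<lambda>f. B f g)"
  proof
    fix g assume g: "g \<in> X"
    have "lin_on S_h (\<lambda>\<Phi>. ?a \<Phi> (s g))"
      using psd_formD(1)[OF pa Xs[OF g]] psd_formD(2)[OF pa _ Xs[OF g]] lin_subD[OF lin_sub_S]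
      by (simp add: lin_on_def)
    moreover have "lin_on W_h (\<lambda>u. ?c u (t g))"
      using psd_formD(1)[OF pc Xt[OF g]] psd_formD(2)[OF pc _ Xt[OF g]] lin_subD[OF lin_sub_W]
      by (simp add: lin_on_def)
    ultimately show "lin_on X (\<lambda>f. B f g)" unfolding B_def
      by (intro lin4 lin_s lin_t form_b_lin Xs Xt g)
  qed
  have B3: "\<forall>f\<in>X. f \<noteq> (\<lambda>_. 0) \<longrightarrow> 0 < B f f"
  proof (intro ballI impI)
    fix f assume f: "f \<in> X" "f \<noteq> (\<lambda>_. 0)"
    have "\<not> (s f = (\<lambda>_. 0) \<and> t f = (\<lambda>_. 0))" using f(2) by (auto simp: s_def t_def fun_eq_iff prod_eq_iff)
    then have "?a (s f) (s f) \<noteq> 0 \<or> ?c (t f) (t f) \<noteq> 0"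
      using compliance_form_definite[OF par(1,2) Xs[OF f(1)]] form_c_definite[OF par(1,2) Xt[OF f(1)]] by blast
    moreover have "0 \<le> ?a (s f) (s f)" "0 \<le> ?c (t f) (t f)"
      using psd_formD(3)[OF pa Xs[OF f(1)]] psd_formD(3)[OF pc Xt[OF f(1)]] by auto
    ultimately show "0 < B f f" unfolding B_def using par(3)
      by (auto simp: add_nonneg_pos add_pos_nonneg)
  qed
  have LX: "lin_on X (\<lambda>f. L (t f))" using lin_onD[OF L] XV by (simp add: lin_on_def st)
  define E where "E = (\<lambda>(y, b). \<lambda>f::real^'n \<Rightarrow> (real^'n^'n^'n) \<times> (real^'n). f y \<bullet> b) ` ((\<Union>T\<in>\<T>. nodes T) \<times> Basis)"
  have fin: "finite E" unfolding E_def using finite_nodes by (intro finite_imageI finite_cartesian_product) auto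
  have lin: "\<forall>l\<in>E. lin_on X l" by (auto simp: E_def lin_on_def inner_add_left)
  have sep: "\<forall>f\<in>X. (\<forall>l\<in>E. l f = 0) \<longrightarrow> f = (\<lambda>_. 0)"
  proof (intro ballI impI)
    fix f assume f: "f \<in> X" and z: "\<forall>l\<in>E. l f = 0"
    have fz: "f y = 0" if "T \<in> \<T>" "y \<in> nodes T" for T y
    proof -
      have "f y \<bullet> b = 0" if "b \<in> Basis" for b
      proof -
        have "(\<lambda>f. f y \<bullet> b) \<in> E" unfolding E_def using \<open>T \<in> \<T>\<close> \<open>y \<in> nodes T\<close> that by (intro image_eqI[of _ _ "(y, b)"]) auto
        from bspec[OF z this] show ?thesis .
      qed
      then show ?thesis by (rule euclidean_all_zero_iff[THEN iffD1, OF ballI])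
    qed
    have "s f = (\<lambda>_. 0)" by (rule nodes_unisolvent_S[OF Xs[OF f]]) (simp add: s_def fz)
    moreover have "t f = (\<lambda>_. 0)" by (rule nodes_unisolvent_W[OF Xt[OF f]]) (simp add: t_def fz)
    ultimately show "f = (\<lambda>_. 0)" by (auto simp: s_def t_def fun_eq_iff prod_eq_iff)
  qed
  have "\<exists>f\<in>X. \<forall>g\<in>X. B f g = L (t g)" by (rule lax_milgram[OF fin X lin sep B1 B2 B3 LX])
  then obtain f where f: "f \<in> X" "\<And>g. g \<in> X \<Longrightarrow> B f g = L (t g)" by blast
  have eq: "?a (s f) \<Psi> / \<iota>\<^sup>2 + ?b \<Psi> (t f) - ?b (s f) v + ?c (t f) v = L v"
    if "\<Psi> \<in> Sigma_h \<T> n" "v \<in> V_h \<T> n" for \<Psi> v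
  proof -
    have "s (\<lambda>x. (\<Psi> x, v x)) = \<Psi>" "t (\<lambda>x. (\<Psi> x, v x)) = v" by (simp_all add: s_def t_def)
    then show ?thesis using f(2)[of "\<lambda>x. (\<Psi> x, v x)"] that by (simp add: X_def B_def)
  qed
  show ?thesis
  proof (rule that[of "s f" "t f"])
    show "s f \<in> Sigma_h \<T> n" "t f \<in> V_h \<T> n" using f(1) by (auto simp: X_def)
    fix \<Psi> assume P: "\<Psi> \<in> Sigma_h \<T> n"
    show "form_a \<Omega> \<mu> lam \<iota> (s f) \<Psi> + ?b \<Psi> (t f) = 0"
      using eq[OF P zero_V] lin_on_zero[OF lin_sub_W form_b_lin(2)[OF Xs[OF f(1)]]]
        lin_on_zero[OF lin_sub_W psd_formD(1)[OF pc Xt[OF f(1)]]] lin_on_zero[OF lin_sub_V L]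
      by (simp add: form_a_eq)
  next
    fix v assume v: "v \<in> V_h \<T> n"
    show "?b (s f) v - ?c (t f) v = - L v"
      using eq[OF zero_Sigma v] lin_on_zero[OF lin_sub_S psd_formD(1)[OF pa Xs[OF f(1)]]]
        lin_on_zero[OF lin_sub_S form_b_lin(1)[OF Xt[OF f(1)]]]
      by simp
  qed
qed

text \<open>
  Existence is \<open>mixed_solvable\<close>. The difference of two solutions, tested with itself, has zero energy. For the
  bound, testing with the solution gives \<open>X\<^sup>2 + Y\<^sup>2 \<le> G Y\<close>, where \<open>G\<close> contains the norm of the load, and the norm
  \<open>|||\<cdot>|||\<^sub>2\<^sub>,\<^sub>h\<close> is controlled by the energy on the finite-dimensional space.
\<close>

lemma well_posed:
  assumes par: "\<mu> > 0" "lam > 0" "\<iota> > 0"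
  shows "mixed_well_posed \<Omega> \<T> n \<mu> lam \<iota>"
  unfolding mixed_well_posed_def
proof (intro conjI ballI)
  let ?a = "compliance_form \<mu> lam" and ?b = "form_b \<Omega> \<T>" and ?c = "form_c \<Omega> \<T> n \<mu> lam"
  note pa = psd_compliance_form[OF par(1,2)] and pc = psd_form_c[OF par(1,2)] and pq = psd_gradient_jump_form[OF par(1,2)]
  have L2: "L2_fun \<Omega> = sqint (lebesgue_on \<Omega>)" by (simp add: L2_fun_def sqint_def)
  have idop: "lin_op W_h (lebesgue_on \<Omega>) (\<lambda>v. v)" by (rule lin_op_L2[OF lin_map_id[OF W_sub_pcont]])
  have Wsq: "v \<in> sqint (lebesgue_on \<Omega>)" if "v \<in> W_h" for v using idop that by (simp add: lin_op_def)
  fix f assume f: "f \<in> L2_fun \<Omega>"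
  then have fs: "f \<in> sqint (lebesgue_on \<Omega>)" by (simp add: L2)
  have linL: "lin_on (V_h \<T> n) (L2_ip \<Omega> f)"
    unfolding L2_ip_eq by (rule lin_on_mono[OF lin_on_ip(1)[OF idop fs] V_sub])
  obtain \<Phi> u where sol: "\<Phi> \<in> Sigma_h \<T> n" "u \<in> V_h \<T> n"
    "\<And>\<Psi>. \<Psi> \<in> Sigma_h \<T> n \<Longrightarrow> form_a \<Omega> \<mu> lam \<iota> \<Phi> \<Psi> + ?b \<Psi> u = 0"
    "\<And>v. v \<in> V_h \<T> n \<Longrightarrow> ?b \<Phi> v - ?c u v = - L2_ip \<Omega> f v"
    using mixed_solvable[OF par linL] by metis
  show "\<exists>!p. mixed_solution \<Omega> \<T> n \<mu> lam \<iota> f (fst p) (snd p)"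
  proof (rule ex1I[of _ "(\<Phi>, u)"])
    show "mixed_solution \<Omega> \<T> n \<mu> lam \<iota> f (fst (\<Phi>, u)) (snd (\<Phi>, u))"
      using sol by (simp add: mixed_solution_def)
    fix p assume p: "mixed_solution \<Omega> \<T> n \<mu> lam \<iota> f (fst p) (snd p)"
    define D where "D = (\<lambda>x. fst p x + (- 1) *\<^sub>R \<Phi> x)"
    define w where "w = (\<lambda>x. snd p x + (- 1) *\<^sub>R u x)"
    have pS: "fst p \<in> Sigma_h \<T> n" and pV: "snd p \<in> V_h \<T> n" using p by (simp_all add: mixed_solution_def)
    have D: "D \<in> Sigma_h \<T> n" unfolding D_def by (rule lin_subD[OF lin_sub_Sigma pS sol(1)])
    have w: "w \<in> V_h \<T> n" unfolding w_def by (rule lin_subD[OF lin_sub_V pV sol(2)])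
    note DS = Sigma_S[OF D] and wW = V_W[OF w]
    have "?a (fst p) D / \<iota>\<^sup>2 + ?b D (snd p) = 0" "?a \<Phi> D / \<iota>\<^sup>2 + ?b D u = 0"
      using p D sol(3)[OF D] by (auto simp: mixed_solution_def form_a_eq)
    moreover have "?b (fst p) w - ?c (snd p) w = - L2_ip \<Omega> f w" "?b \<Phi> w - ?c u w = - L2_ip \<Omega> f w"
      using p w sol(4)[OF w] by (auto simp: mixed_solution_def)
    moreover have "?a D D = ?a (fst p) D - ?a \<Phi> D"
      using lin_onD[OF psd_formD(1)[OF pa DS] Sigma_S[OF pS] Sigma_S[OF sol(1)], of "- 1"]
        psd_formD(2)[OF pa DS Sigma_S[OF pS]] psd_formD(2)[OF pa DS Sigma_S[OF sol(1)]] by (simp add: D_def)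
    moreover have "?c w w = ?c (snd p) w - ?c u w"
      using lin_onD[OF psd_formD(1)[OF pc wW] V_W[OF pV] V_W[OF sol(2)], of "- 1"]
        psd_formD(2)[OF pc wW V_W[OF pV]] psd_formD(2)[OF pc wW V_W[OF sol(2)]] by (simp add: w_def)
    moreover have "?b D w = ?b D (snd p) - ?b D u"
      using lin_onD[OF form_b_lin(2)[OF DS] V_W[OF pV] V_W[OF sol(2)], of "- 1"] by (simp add: w_def)
    moreover have "?b D w = ?b (fst p) w - ?b \<Phi> w"
      using lin_onD[OF form_b_lin(1)[OF wW] Sigma_S[OF pS] Sigma_S[OF sol(1)], of "- 1"] by (simp add: D_def)
    ultimately have "?a D D / \<iota>\<^sup>2 + ?c w w = 0" by (simp add: diff_divide_distrib)
    moreover have "0 \<le> ?a D D / \<iota>\<^sup>2" "0 \<le> ?c w w"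
      using psd_formD(3)[OF pa DS] psd_formD(3)[OF pc wW] by auto
    ultimately have "?a D D / \<iota>\<^sup>2 = 0" "?c w w = 0" by linarith+
    then have "D = (\<lambda>_. 0)" "w = (\<lambda>_. 0)"
      using compliance_form_definite[OF par(1,2) DS] form_c_definite[OF par(1,2) wW] par(3) by auto
    then show "p = (\<Phi>, u)" by (simp add: D_def w_def fun_eq_iff prod_eq_iff)
  qed
next
  let ?a = "compliance_form \<mu> lam" and ?b = "form_b \<Omega> \<T>" and ?c = "form_c \<Omega> \<T> n \<mu> lam"
  note pa = psd_compliance_form[OF par(1,2)] and pc = psd_form_c[OF par(1,2)] and pq = psd_gradient_jump_form[OF par(1,2)]
  have idmap: "lin_map W_h (\<lambda>v. v)" by (rule lin_map_id[OF W_sub_pcont])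
  obtain K1 where K1: "K1 \<ge> 0" "\<And>v. v \<in> W_h \<Longrightarrow> L2_ip \<Omega> v v \<le> K1 * ?c v v"
    using form_c_controls[OF par(1,2) psd_L2[OF idmap]] by metis
  obtain K2 where K2: "K2 \<ge> 0" "\<And>v. v \<in> W_h \<Longrightarrow> gradient_jump_form \<mu> lam v v \<le> K2 * ?c v v"
    using form_c_controls[OF par(1,2) pq] by metis
  show "\<exists>K. \<forall>f\<in>L2_fun \<Omega>. \<forall>\<Phi> u. mixed_solution \<Omega> \<T> n \<mu> lam \<iota> f \<Phi> u \<longrightarrow>
        mixed_norm \<Omega> \<T> n \<mu> lam \<iota> \<Phi> u \<le> K * sqrt (L2_ip \<Omega> f f)"
  proof (intro exI ballI allI impI)
    fix f \<Phi> u assume f: "f \<in> L2_fun \<Omega>" and sol: "mixed_solution \<Omega> \<T> n \<mu> lam \<iota> f \<Phi> u"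
    have P: "\<Phi> \<in> Sigma_h \<T> n" and V: "u \<in> V_h \<T> n" using sol by (simp_all add: mixed_solution_def)
    note S = Sigma_S[OF P] and W = V_W[OF V]
    define X where "X = sqrt (?a \<Phi> \<Phi>) / \<iota>"
    define Y where "Y = sqrt (?c u u)"
    define G where "G = sqrt (L2_ip \<Omega> f f) * sqrt K1"
    have a0: "0 \<le> ?a \<Phi> \<Phi>" and c0: "0 \<le> ?c u u" and q0: "0 \<le> gradient_jump_form \<mu> lam u u"
      using psd_formD(3)[OF pa S] psd_formD(3)[OF pc W] psd_formD(3)[OF pq W] by auto
    have X0: "0 \<le> X" and Y0: "0 \<le> Y" using a0 c0 par(3) by (auto simp: X_def Y_def)
    have G0: "0 \<le> G" unfolding G_def L2_ip_eq using K1(1) ip_nonneg by (intro mult_nonneg_nonneg) auto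
    have "?a \<Phi> \<Phi> / \<iota>\<^sup>2 + ?b \<Phi> u = 0" "?b \<Phi> u - ?c u u = - L2_ip \<Omega> f u"
      using sol P V by (auto simp: mixed_solution_def form_a_eq)
    then have "X\<^sup>2 + Y\<^sup>2 = L2_ip \<Omega> f u" using a0 c0 by (simp add: X_def Y_def power_divide)
    also have "\<dots> \<le> sqrt (L2_ip \<Omega> f f) * sqrt (L2_ip \<Omega> u u)"
    proof -
      have "f \<in> sqint (lebesgue_on \<Omega>)" using f by (simp add: L2_fun_def sqint_def)
      then show ?thesis unfolding L2_ip_eq
        using ip_cauchy_schwarz[OF _ pcont_sqint[OF W_pcont[OF W]]] by (metis abs_le_D1)
    qed
    also have "\<dots> \<le> sqrt (L2_ip \<Omega> f f) * (sqrt K1 * Y)"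
    proof (rule mult_left_mono)
      show "sqrt (L2_ip \<Omega> u u) \<le> sqrt K1 * Y"
        unfolding Y_def real_sqrt_mult[symmetric] using K1(2)[OF W] by (rule real_sqrt_le_mono)
      show "0 \<le> sqrt (L2_ip \<Omega> f f)" unfolding L2_ip_eq using ip_nonneg by (rule real_sqrt_ge_zero)
    qed
    finally have *: "X\<^sup>2 + Y\<^sup>2 \<le> G * Y" by (simp add: G_def mult.assoc)
    have YG: "Y \<le> G"
    proof (rule ccontr)
      assume "\<not> Y \<le> G"
      then have "G * Y < Y * Y" using G0 by (intro mult_strict_right_mono) auto
      moreover have "0 \<le> X\<^sup>2" by simp
      ultimately show False using * unfolding power2_eq_square by linarith
    qed
    have "X\<^sup>2 \<le> G\<^sup>2"
      using * mult_left_mono[OF YG G0] zero_le_power2[of Y] unfolding power2_eq_square by linarith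
    then have XG: "X \<le> G" by (rule power2_le_imp_le[OF _ G0])
    have "ih_form \<mu> lam \<iota> u u \<le> (\<iota>\<^sup>2 * K2 + 1) * ?c u u"
      using mult_left_mono[OF K2(2)[OF W], of "\<iota>\<^sup>2"] by (simp add: ih_form_def algebra_simps)
    then have "norm_ih \<Omega> \<T> n \<mu> lam \<iota> u \<le> sqrt (\<iota>\<^sup>2 * K2 + 1) * Y"
      unfolding norm_ih_eq[OF par(1,2) W] Y_def real_sqrt_mult[symmetric] by simp
    also have "\<dots> \<le> sqrt (\<iota>\<^sup>2 * K2 + 1) * G" using YG K2(1) by (intro mult_left_mono) auto
    finally have "mixed_norm \<Omega> \<T> n \<mu> lam \<iota> \<Phi> u \<le> G + sqrt (\<iota>\<^sup>2 * K2 + 1) * G"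
      using XG by (simp add: mixed_norm_def norm_A_eq X_def)
    also have "\<dots> = (sqrt K1 * (1 + sqrt (\<iota>\<^sup>2 * K2 + 1))) * sqrt (L2_ip \<Omega> f f)"
      by (simp add: G_def algebra_simps)
    finally show "mixed_norm \<Omega> \<T> n \<mu> lam \<iota> \<Phi> u \<le>
        (sqrt K1 * (1 + sqrt (\<iota>\<^sup>2 * K2 + 1))) * sqrt (L2_ip \<Omega> f f)" .
  qed
qed

end

theorem theorem3p4:
  fixes \<Omega> :: "(real^'n) set" and \<mu> \<kappa> :: real
  assumes "CARD('n) \<ge> 2" and "polytopal_domain \<Omega>" and "\<mu> > 0"
  shows "\<exists>C>0. \<forall>\<T> n lam \<iota>.
           simplicial_mesh \<Omega> \<T> \<and> shape_regular \<kappa> \<T> \<and> face_normals \<Omega> \<T> n \<and>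
           lam > 0 \<and> 0 < \<iota> \<and> \<iota> \<le> 1 \<longrightarrow>
           (\<forall>\<Phi>\<in>Sigma_h \<T> n. \<forall>u\<in>V_h \<T> n.
              ereal (norm_A \<Omega> \<mu> lam \<Phi> / \<iota> + norm_ih \<Omega> \<T> n \<mu> lam \<iota> u) \<le>
              ereal C * (SUP (\<Psi>, v) \<in> Sigma_h \<T> n \<times> V_h \<T> n - {(\<lambda>_. 0, \<lambda>_. 0)}.
                ereal ((form_a \<Omega> \<mu> lam \<iota> \<Phi> \<Psi> + form_b \<Omega> \<T> \<Psi> u
                          + form_b \<Omega> \<T> \<Phi> v - form_c \<Omega> \<T> n \<mu> lam u v)
                       / (norm_A \<Omega> \<mu> lam \<Psi> / \<iota> + norm_ih \<Omega> \<T> n \<mu> lam \<iota> v)))) \<and>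
           mixed_well_posed \<Omega> \<T> n \<mu> lam \<iota>"
proof -
  define M where "M = max 1 (2 * (real CARD('n) + 1) * \<kappa> ^ 3 / ((real CARD('n))\<^sup>2 * cone_ratio TYPE('n)))"
  show ?thesis
  proof (intro exI[of _ "8 * M"] conjI allI impI)
    show "0 < 8 * M" by (simp add: M_def)
    fix \<T> :: "(real^'n) set set" and n :: "(real^'n) set \<Rightarrow> real^'n" and lam \<iota> :: real
    assume a: "simplicial_mesh \<Omega> \<T> \<and> shape_regular \<kappa> \<T> \<and> face_normals \<Omega> \<T> n \<and>
           lam > 0 \<and> 0 < \<iota> \<and> \<iota> \<le> 1"
    interpret mesh \<Omega> \<T> n using assms a by unfold_locales auto
    have M: "M \<ge> 1" "M \<ge> recovery_constant \<kappa>" by (simp_all add: M_def recovery_constant_def)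
    have par: "shape_regular \<kappa> \<T>" "lam > 0" "\<iota> > 0" using a by auto
    show "\<forall>\<Phi>\<in>Sigma_h \<T> n. \<forall>u\<in>V_h \<T> n.
        ereal (norm_A \<Omega> \<mu> lam \<Phi> / \<iota> + norm_ih \<Omega> \<T> n \<mu> lam \<iota> u) \<le>
        ereal (8 * M) * (SUP (\<Psi>, v) \<in> Sigma_h \<T> n \<times> V_h \<T> n - {(\<lambda>_. 0, \<lambda>_. 0)}.
          ereal ((form_a \<Omega> \<mu> lam \<iota> \<Phi> \<Psi> + form_b \<Omega> \<T> \<Psi> u
                    + form_b \<Omega> \<T> \<Phi> v - form_c \<Omega> \<T> n \<mu> lam u v)
                 / (norm_A \<Omega> \<mu> lam \<Psi> / \<iota> + norm_ih \<Omega> \<T> n \<mu> lam \<iota> v)))"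
      using inf_sup[OF par(1) assms(3) par(2,3) M] by blast
    show "mixed_well_posed \<Omega> \<T> n \<mu> lam \<iota>" by (rule well_posed[OF assms(3) par(2,3)])
  qed
qed

end
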